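(* Let $n\geq 3$. A map $Z:\mathcal{P}_o^n\to C(\mathbb{R}^n\setminus\{o\})$ is an $\operatorname{SL}(n)$ contravariant valuation if and only if there are constants $c_{n-1},c_0,c_0'\in\mathbb{R}$ and a function $\zeta:\mathbb{R}\times(0,\infty)\to\mathbb{R}$ such that $\zeta(t,\cdot)$ is a Cauchy function on $(0,\infty)$ for every $t\in\mathbb{R}$, $\zeta(\cdot,s)$ is continuous on $\mathbb{R}$ for every $s>0$, and $$ZP(x)=\Pi_\zeta(P)(x)+c_{n-1}V_1(P,[-x,x])+c_0V_0(P)+c_0'(-1)^{\dim P}V_0(o\cap\operatorname{relint}P)$$ for every $P\in\mathcal{P}_o^n$ and $x\in\mathbb{R}^n\setminus\{o\}$.
   Context: Here $o$ is the origin of $\mathbb{R}^n$ and $x\cdot y$ the inner product. $\mathcal{P}_o^n$ is the set of (convex) polytopes in $\mathbb{R}^n$ (of any dimension) that contain the origin. $C(\mathbb{R}^n\setminus\{o\})$ is the set of continuous functions $\mathbb{R}^n\setminus\{o\}\to\mathbb{R}$, with pointwise addition. A map $Z$ on $\mathcal{P}_o^n$ is a valuation if $ZP+ZQ=Z(P\cup Q)+Z(P\cap Q)$ whenever $P,Q,P\cup Q,P\cap Q\in\mathcal{P}_o^n$. It is $\operatorname{SL}(n)$ contravariant if $Z(\phi P)(x)=ZP(\phi^{-1}x)$ for all $P\in\mathcal{P}_o^n$, $\phi\in\operatorname{SL}(n)$, $x\in\mathbb{R}^n\setminus\{o\}$. A function $f:(0,\infty)\to\mathbb{R}$ is a Cauchy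 function if $f(r+s)=f(r)+f(s)$ for all $r,s>0$ (no regularity assumed). For a polytope $P$, $h_P(u)=\max\{u\cdot y:y\in P\}$ is the support function. $\mathcal{N}(P)$ is the set of outer unit normals of facets of $P$, i.e. of unit vectors $u$ for which the face $\{y\in P:y\cdot u=h_P(u)\}$ has dimension $n-1$ (an $(n-1)$-dimensional polytope thus has two such normals $\pm u$); $S_P(u)$ denotes the $(n-1)$-dimensional volume of that face; $V_P(u)=\frac1n h_P(u)S_P(u)$ (cone-volume measure). $\mathcal{N}_o(P)=\{u\in\mathcal{N}(P):h_P(u)\neq0\}$ is the set of normals of facets whose affine hulls do not contain the origin. Then $$\Pi_\zeta(P)(x)=\sum_{u\in\mathcal{N}_o(P)}\zeta\left(\frac{x\cdot u}{h_P(u)},V_P(u)\right),\qquad V_1(P,[-x,x])=\frac1n\sum_{u\in\mathcal{N}(P)}|x\cdot u|\,S_P(u)$$ (empty sums are $0$). $V_0(P)=1$ for nonempty $P$. $\dim P$ is the dimension of the affine hull of $P$, $\operatorname{relint}P$ is the interior of $P$ relative to its affine hull, and $V_0(o\cap\operatorname{relint}P)$ equals $1$ if $o\in\operatorname{relint}P$ and $0$ otherwise. *)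

theory Defs
  imports "HOL-Analysis.Analysis"
begin

definition polytopes_o :: "(real ^ 'n) set set" where
  "polytopes_o = {P. polytope P \<and> 0 \<in> P}"

definition valuation_o :: "((real ^ 'n) set \<Rightarrow> real ^ 'n \<Rightarrow> real) \<Rightarrow> bool" where
  "valuation_o Z \<longleftrightarrow>
     (\<forall>P Q. P \<in> polytopes_o \<longrightarrow> Q \<in> polytopes_o \<longrightarrow>
        P \<union> Q \<in> polytopes_o \<longrightarrow> P \<inter> Q \<in> polytopes_o \<longrightarrow>
        (\<forall>x. x \<noteq> 0 \<longrightarrow> Z P x + Z Q x = Z (P \<union> Q) x + Z (P \<inter> Q) x))"

definition SL_contravariant :: "((real ^ 'n) set \<Rightarrow> real ^ 'n \<Rightarrow> real) \<Rightarrow> bool" where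
  "SL_contravariant Z \<longleftrightarrow>
     (\<forall>P \<in> polytopes_o. \<forall>A :: real ^ 'n ^ 'n. det A = 1 \<longrightarrow>
        (\<forall>x. x \<noteq> 0 \<longrightarrow> Z ((\<lambda>y. A *v y) ` P) x = Z P (matrix_inv A *v x)))"

definition cauchy_function :: "(real \<Rightarrow> real) \<Rightarrow> bool" where
  "cauchy_function f \<longleftrightarrow> (\<forall>r > 0. \<forall>s > 0. f (r + s) = f r + f s)"

definition support_fun :: "(real ^ 'n) set \<Rightarrow> real ^ 'n \<Rightarrow> real" where
  "support_fun P u = (SUP y\<in>P. u \<bullet> y)"

definition face_in_direction :: "(real ^ 'n) set \<Rightarrow> real ^ 'n \<Rightarrow> (real ^ 'n) set" where
  "face_in_direction P u = {y \<in> P. y \<bullet> u = support_fun P u}"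

definition facet_normals :: "(real ^ 'n) set \<Rightarrow> (real ^ 'n) set" where
  "facet_normals P =
     {u. norm u = 1 \<and> aff_dim (face_in_direction P u) = int CARD('n) - 1}"

definition facet_normals_o :: "(real ^ 'n) set \<Rightarrow> (real ^ 'n) set" where
  "facet_normals_o P = {u \<in> facet_normals P. support_fun P u \<noteq> 0}"

definition orthonormal_basis_of :: "(real ^ 'n) set \<Rightarrow> (real ^ 'n) set \<Rightarrow> bool" where
  "orthonormal_basis_of S B \<longleftrightarrow>
     pairwise orthogonal B \<and> (\<forall>b\<in>B. norm b = 1) \<and> span B = S"

lemma orthonormal_basis_of_exists:
  fixes u :: "real ^ 'n"
  shows "\<exists>B. orthonormal_basis_of {x. u \<bullet> x = 0} B"
  using orthonormal_basis_subspace[OF subspace_hyperplane[of u]]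
  unfolding orthonormal_basis_of_def by metis

text \<open>
  The \<open>(n-1)\<close>-dimensional volume of a set \<open>F\<close> lying in some hyperplane orthogonal to \<open>u\<close>:
  \<open>F\<close> is written in orthonormal coordinates of the direction space of that hyperplane and
  measured by the product of \<open>n-1\<close> copies of Lebesgue measure on the line (the library
  builds \<^const>\<open>lborel\<close> on Euclidean spaces from \<^const>\<open>Basis\<close> in the same way).
  By orthogonal invariance of Lebesgue measure the value does not depend on the chosen basis.
\<close>

definition hyperplane_volume :: "real ^ 'n \<Rightarrow> (real ^ 'n) set \<Rightarrow> real" where
  "hyperplane_volume u F =
     (let B = (SOME B. orthonormal_basis_of {x. u \<bullet> x = 0} B)
      in measure (Pi\<^sub>M B (\<lambda>_. lborel)) ((\<lambda>y. \<lambda>b\<in>B. y \<bullet> b) ` F))"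

definition facet_volume :: "(real ^ 'n) set \<Rightarrow> real ^ 'n \<Rightarrow> real" where
  "facet_volume P u = hyperplane_volume u (face_in_direction P u)"

definition cone_volume :: "(real ^ 'n) set \<Rightarrow> real ^ 'n \<Rightarrow> real" where
  "cone_volume P u = 1 / real CARD('n) * support_fun P u * facet_volume P u"

definition Pi_zeta :: "(real \<Rightarrow> real \<Rightarrow> real) \<Rightarrow> (real ^ 'n) set \<Rightarrow> real ^ 'n \<Rightarrow> real" where
  "Pi_zeta \<zeta> P x = (\<Sum>u\<in>facet_normals_o P. \<zeta> ((x \<bullet> u) / support_fun P u) (cone_volume P u))"

text \<open>The mixed volume \<open>V\<^sub>1(P, [-x, x])\<close> of a polytope and a segment, through its facet formula.\<close>

definition V1_segment :: "(real ^ 'n) set \<Rightarrow> real ^ 'n \<Rightarrow> real" where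
  "V1_segment P x = 1 / real CARD('n) * (\<Sum>u\<in>facet_normals P. \<bar>x \<bullet> u\<bar> * facet_volume P u)"

text \<open>Only applied to compact convex sets, where the Euler characteristic takes these values.\<close>

definition V0 :: "(real ^ 'n) set \<Rightarrow> real" where
  "V0 S = (if S = {} then 0 else 1)"

end

theory Submission
  imports Defs
begin

text \<open>
  A valuation on polytopes containing \<open>o\<close> is determined by its values on simplices with a vertex at
  \<open>o\<close>: hyperplanes through a point \<open>v\<close> of \<open>P\<close> cut \<open>P\<close> into pyramids \<open>[v, F]\<close>, and \<open>F \<mapsto> Z [v, F]\<close>
  is a valuation in a lower dimension. By contravariance only the simplices \<open>[o, e\<^sub>j : j \<in> J]\<close> and the
  dilates of \<open>[o, e\<^sub>1, \<dots>, e\<^sub>n]\<close> matter, and cutting them by the hyperplane through \<open>o\<close>,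
  \<open>\<theta> e\<^sub>i + (1 - \<theta>) e\<^sub>j\<close> and the remaining vertices yields functional equations. In dimension
  at most \<open>n - 2\<close> shears force constants, and in dimension \<open>n - 1\<close> a continuous even additive function
  of one coordinate, so a combination of \<open>V\<^sub>1\<close> and the two Euler characteristic terms can be subtracted
  to make \<open>Z\<close> vanish there. For \<open>n\<close>-simplices of determinant \<open>r\<close> the values \<open>G r y\<close>, with \<open>y\<close> the
  coordinates of \<open>x\<close> in the edge vectors, satisfy
  \<open>G r y = G (\<theta> r) u + G ((1 - \<theta>) r) u'\<close>. Cutting a triangle in two different orders shows that
  \<open>r \<mapsto> G r (t e\<^sub>i)\<close> is additive up to a constant, which continuity in \<open>y\<close> forces to be \<open>0\<close>; induction on
  the support of \<open>y\<close> then shows that \<open>G r y\<close> depends only on \<open>r\<close> and the sum of the coordinates of \<open>y\<close>.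
  Conversely, the facet terms are valuations because the valuation identity holds in each normal
  direction separately, and they are contravariant because the volume of the prism spanned by a facet
  and a segment \<open>[o, x]\<close> is \<open>|x \<cdot> u|\<close> times the facet volume.
\<close>

section \<open>Linear images of Lebesgue measure\<close>

text \<open>The Cauchy functions \<zeta>(t, .) carry no regularity, so nothing can be gained from
  continuity in the volume variable: every limit is taken in x. This is why the additive defect in r
  has to be shown constant algebraically before continuity in y can remove it, and why the case of
  coordinate sum 0, which no nonzero multiple of an axis vector has, is reached only as a limit. The
  coordinate sum appears because it equals x . u / h(u) for the facet opposite o, the one facet of
  an n-simplex [o, ...] whose hyperplane misses o; r becomes the cone volume after a fixed
  rescaling. The point {o} keeps a value of its own: a cut needs two vertices other than o, so it
  never ties {o} to larger simplices. That freedom is the coefficient c0'. The assumption n >= 3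
  provides a third axis: it leaves room for a two-vertex cut inside a simplex of dimension n - 1,
  corrects the sign of a transposition, and supplies the triangle that is cut in two orders. Facet
  volumes are taken in an arbitrarily chosen orthonormal basis, so they are compared only through
  n-dimensional volumes of prisms.\<close>

definition replace_col :: "'n \<Rightarrow> real ^ 'n \<Rightarrow> real ^ 'n ^ 'n" where
  "replace_col k w = (\<chi> i j. if j = k then w $ i else mat 1 $ i $ j)"

text \<open>Cramer's rule for the identity system. Shears, dilations of one axis and the cuts of
  simplices are all of the form \<open>replace_col k w\<close>, so this determinant serves them
  all.\<close>

lemma det_replace_col: "det (replace_col k w) = w $ k"
  using cramer_lemma[of k "mat 1" w] unfolding replace_col_def matrix_vector_mul_lid by simp

lemma replace_col_mult: "replace_col k w *v y = y + y $ k *\<^sub>R (w - axis k 1)"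
proof -
  have "(replace_col k w *v y) $ i = (y + y $ k *\<^sub>R (w - axis k 1)) $ i" for i
  proof -
    have "(replace_col k w *v y) $ i = (\<Sum>j\<in>UNIV. (if j = i then y $ j else 0)
        + (if j = k then y $ j * (w $ i - axis k 1 $ i) else 0))"
      unfolding replace_col_def matrix_vector_mult_def
      by (simp, intro sum.cong) (auto simp: mat_def axis_def algebra_simps)
    also have "\<dots> = (y + y $ k *\<^sub>R (w - axis k 1)) $ i"
      unfolding sum.distrib by simp
    finally show ?thesis .
  qed
  then show ?thesis by (simp add: vec_eq_iff)
qed

text \<open>The library proves the following only for well-ordered index types.\<close>

lemma
  fixes f :: "real ^ 'n \<Rightarrow> real ^ 'n"
  assumes "linear f" and S: "S \<in> lmeasurable"
  shows lmeasurable_linear_image: "f ` S \<in> lmeasurable"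
    and measure_linear_image_det: "measure lebesgue (f ` S) = \<bar>det (matrix f)\<bar> * measure lebesgue S"
proof -
  define P where "P f \<longleftrightarrow> (\<forall>S \<in> lmeasurable. f ` S \<in> lmeasurable \<and>
      measure lebesgue (f ` S) = \<bar>det (matrix f)\<bar> * measure lebesgue S)" for f :: "real ^ 'n \<Rightarrow> real ^ 'n"
  have unimodular: "P h" if "linear h" "\<bar>det (matrix h)\<bar> = 1"
    and "\<And>a b. cbox a b \<noteq> {} \<Longrightarrow> measure lebesgue (h ` cbox a b) = measure lebesgue (cbox a b)" for h
    unfolding P_def
  proof
    fix S :: "(real ^ 'n) set" assume "S \<in> lmeasurable"
    moreover have "measure lebesgue (h ` cbox a b) = 1 * measure lebesgue (cbox a b)" for a b
      using that(3)[of a b] by (cases "cbox a b = {}") auto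
    ultimately show "h ` S \<in> lmeasurable \<and> measure lebesgue (h ` S) = \<bar>det (matrix h)\<bar> * measure lebesgue S"
      using measure_linear_sufficient[OF that(1), of S 1] that(2) by simp
  qed
  have "P f"
  proof (rule induct_linear_elementary[OF \<open>linear f\<close>])
    fix f g :: "real ^ 'n \<Rightarrow> real ^ 'n"
    assume "linear f" "linear g" "P f" "P g"
    moreover have "(f \<circ> g) ` S = f ` (g ` S)" for S by (simp only: image_comp)
    ultimately show "P (f \<circ> g)"
      unfolding P_def by (simp only: matrix_compose det_mul abs_mult) (simp add: mult.assoc)
  next
    fix f :: "real ^ 'n \<Rightarrow> real ^ 'n" and i
    assume f: "linear f" "\<And>x. f x $ i = 0"
    \<comment> \<open>A map with a vanishing coordinate is singular, and both sides of the volume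
      formula are 0.\<close>
    have "\<not> surj f"
      using f(2) by (metis one_neq_zero surjE vec_component)
    then have ninj: "\<not> inj f" using linear_injective_imp_surjective[OF f(1)] by blast
    then have "det (matrix f) = 0" "negligible (f ` S)" for S
      using det_nz_iff_inj[OF f(1)] negligible_linear_singular_image[OF f(1)] by auto
    then show "P f"
      by (auto simp: P_def negligible_iff_measure)
  next
    fix c :: "'n \<Rightarrow> real"
    show "P (\<lambda>x. \<chi> i. c i * x $ i)"
      by (auto simp: P_def measurable_stretch measure_stretch matrix_def axis_def det_diagonal)
  next
    fix m n :: 'n assume "m \<noteq> n"
    let ?\<tau> = "Transposition.transpose m n"
    let ?h = "\<lambda>v :: real ^ 'n. \<chi> i. v $ ?\<tau> i"
    have "matrix ?h = (\<chi> i. mat 1 $ ?\<tau> i)"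
      by (auto simp: matrix_def mat_def axis_def vec_eq_iff)
    then have d: "\<bar>det (matrix ?h)\<bar> = 1"
      by (simp add: det_permute_rows[OF permutes_swap_id] sign_swap_id abs_mult)
    show "P ?h"
    proof (rule unimodular)
      fix a b :: "real ^ 'n" assume ne: "cbox a b \<noteq> {}"
      have box: "?h ` cbox a b = cbox (?h a) (?h b)"
      proof (intro equalityI subsetI)
        fix x assume x: "x \<in> cbox (?h a) (?h b)"
        have "?h x \<in> cbox a b"
          unfolding mem_box_cart
        proof
          fix i
          have "?h a $ ?\<tau> i \<le> x $ ?\<tau> i" "x $ ?\<tau> i \<le> ?h b $ ?\<tau> i"
            using x unfolding mem_box_cart by blast+
          then show "a $ i \<le> ?h x $ i \<and> ?h x $ i \<le> b $ i" by simp
        qed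
        moreover have "x = ?h (?h x)" by (simp add: vec_eq_iff)
        ultimately show "x \<in> ?h ` cbox a b" by blast
      qed (auto simp: mem_box_cart)
      show "measure lebesgue (?h ` cbox a b) = measure lebesgue (cbox a b)"
      proof -
        have "cbox (?h a) (?h b) \<noteq> {}" using ne box by (metis image_is_empty)
        then show ?thesis
          using ne prod.permute[OF permutes_swap_id, where S=UNIV and g="\<lambda>i. (b - a) $ i", symmetric]
          unfolding box by (simp add: content_cbox_cart)
      qed
    qed (use d in \<open>auto intro!: linearI simp: vec_eq_iff\<close>)
  next
    fix m n :: 'n assume mn: "m \<noteq> n"
    let ?h = "\<lambda>v :: real ^ 'n. \<chi> i. if i = m then v $ m + v $ n else v $ i"
    have lin: "linear ?h" by (rule linearI) (auto simp: vec_eq_iff algebra_simps)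
    have h: "?h = (*v) (replace_col n (axis n 1 + axis m 1))"
      using mn by (auto simp: replace_col_mult vec_eq_iff fun_eq_iff axis_def)
    show "P ?h"
    proof (rule unimodular[OF lin])
      show "\<bar>det (matrix ?h)\<bar> = 1"
        using mn unfolding h by (simp add: det_replace_col axis_def)
      fix a b :: "real ^ 'n" assume ne: "cbox a b \<noteq> {}"
      \<comment> \<open>The library fact on sheared boxes wants a nonnegative lower bound in
        coordinate \<open>n\<close>; this translation makes it 0.\<close>
      define v where "v = (- a $ n) *\<^sub>R axis n (1::real)"
      have ne': "cbox (v + a) (v + b) \<noteq> {}" using ne by (metis cbox_translation image_is_empty)
      have hv: "?h (v + x) = ?h v + ?h x" for x using linear_add[OF lin] .
      have "measure lebesgue (?h ` cbox a b) = measure lebesgue ((+) (?h v) ` ?h ` cbox a b)"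
        by (simp add: measure_translation)
      also have "(+) (?h v) ` ?h ` cbox a b = ?h ` cbox (v + a) (v + b)"
        by (simp only: cbox_translation image_image hv)
      also have "measure lebesgue \<dots> = measure lebesgue (cbox (v + a) (v + b))"
        by (rule measure_shear_interval[OF mn ne']) (simp add: v_def)
      also have "\<dots> = measure lebesgue (cbox a b)"
        unfolding cbox_translation by (rule measure_translation)
      finally show "measure lebesgue (?h ` cbox a b) = measure lebesgue (cbox a b)" .
    qed
  qed
  then show "f ` S \<in> lmeasurable" "measure lebesgue (f ` S) = \<bar>det (matrix f)\<bar> * measure lebesgue S"
    using S by (auto simp: P_def)
qed

lemma
  fixes f :: "real ^ 'n \<Rightarrow> real ^ 'n"
  assumes f: "orthogonal_transformation f" and S: "S \<in> lmeasurable"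
  shows lmeasurable_orthogonal_image: "f ` S \<in> lmeasurable"
    and measure_orthogonal_image_eq: "measure lebesgue (f ` S) = measure lebesgue S"
proof -
  have "linear f" using f by (rule orthogonal_transformation_linear)
  moreover have "\<bar>det (matrix f)\<bar> = 1"
    using f det_orthogonal_matrix orthogonal_transformation_matrix by fastforce
  ultimately show "f ` S \<in> lmeasurable" "measure lebesgue (f ` S) = measure lebesgue S"
    using lmeasurable_linear_image[OF _ S] measure_linear_image_det[OF _ S] by auto
qed

text \<open>The Minkowski sum of \<open>F\<close> and the segment [o, x]. Its n-dimensional measure
  stands in for the (n-1)-dimensional volume of \<open>F\<close>, so that the determinant formula
  applies to facets.\<close>

definition prism :: "(real ^ 'n) set \<Rightarrow> real ^ 'n \<Rightarrow> (real ^ 'n) set" where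
  "prism F x = (\<lambda>(y, t). y + t *\<^sub>R x) ` (F \<times> {0..1})"

section \<open>Lebesgue measure in orthonormal coordinates\<close>

lemma lborel_distr_orthogonal:
  fixes T :: "real ^ 'n \<Rightarrow> real ^ 'n"
  assumes T: "orthogonal_transformation T"
  shows "distr lborel borel T = lborel"
proof (rule lborel_eqI[symmetric])
  have lin: "linear T" using T by (rule orthogonal_transformation_linear)
  have Tm: "T \<in> borel_measurable lborel"
    using lin linear_conv_bounded_linear
    by (auto intro!: borel_measurable_continuous_onI linear_continuous_on)
  fix l u :: "real ^ 'n" assume lu: "\<And>b. b \<in> Basis \<Longrightarrow> l \<bullet> b \<le> u \<bullet> b"
  have oi: "orthogonal_transformation (inv T)" using T by (rule orthogonal_transformation_inv)
  have vi: "T -` box l u = inv T ` box l u"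
    using orthogonal_transformation_bij[OF T] by (rule bij_vimage_eq_inv_image)
  have op: "open (T -` box l u)"
    by (intro open_vimage open_box linear_continuous_on) (use lin linear_conv_bounded_linear in auto)
  have lm: "inv T ` box l u \<in> lmeasurable"
    by (rule lmeasurable_orthogonal_image[OF oi]) auto
  have "emeasure (distr lborel borel T) (box l u) = emeasure lborel (T -` box l u)"
    by (subst emeasure_distr[OF Tm]) auto
  also have "\<dots> = emeasure lebesgue (T -` box l u)" using op by simp
  also have "\<dots> = measure lebesgue (inv T ` box l u)" using lm vi
    by (simp add: emeasure_eq_measure2 fmeasurableD2)
  also have "\<dots> = measure lebesgue (box l u)"
    by (subst measure_orthogonal_image_eq[OF oi]) auto
  also have "\<dots> = ennreal (\<Prod>b\<in>Basis. (u - l) \<bullet> b)"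
    using lu by (subst measure_completion) (auto simp: measure_lborel_box_eq)
  finally show "emeasure (distr lborel borel T) (box l u) = (\<Prod>b\<in>Basis. (u - l) \<bullet> b)" .
qed auto

lemma borel_coordinates:
  fixes A :: "'a::euclidean_space \<Rightarrow> real set"
  assumes "finite B" "B \<noteq> {}" "\<And>b. b \<in> B \<Longrightarrow> A b \<in> sets borel"
  shows "{y. \<forall>b\<in>B. y \<bullet> b \<in> A b} \<in> sets borel"
proof -
  have "{y \<in> space borel. \<forall>b\<in>B. y \<bullet> b \<in> A b} \<in> sets borel"
    by (rule sets.sets_Collect_finite_All'[OF _ assms(1,2)])
       (use assms(3) in \<open>auto intro!: measurable_sets_borel measurable_sets[of "\<lambda>z. z \<bullet> _", unfolded vimage_def Int_def]\<close>)
  then show ?thesis by simp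
qed

lemma emeasure_lborel_coordinates:
  fixes A :: "'a::euclidean_space \<Rightarrow> real set"
  assumes "\<And>i. i \<in> Basis \<Longrightarrow> A i \<in> sets borel"
  shows "emeasure lborel {z. \<forall>i\<in>Basis. z \<bullet> i \<in> A i} = (\<Prod>i\<in>Basis. emeasure lborel (A i))"
proof -
  interpret product_sigma_finite "\<lambda>_::'a. lborel :: real measure" ..
  have m: "{z. \<forall>i\<in>Basis. z \<bullet> i \<in> A i} \<in> sets borel"
    by (rule borel_coordinates) (use assms in auto)
  have eq: "(\<lambda>f. \<Sum>b\<in>Basis. f b *\<^sub>R b) -` {z. \<forall>i\<in>Basis. z \<bullet> i \<in> A i} \<inter> space (Pi\<^sub>M Basis (\<lambda>_. lborel))
     = Pi\<^sub>E Basis A"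
    by (auto simp: space_PiM PiE_def Pi_def extensional_def)
  have "emeasure lborel {z. \<forall>i\<in>Basis. z \<bullet> i \<in> A i}
      = emeasure (distr (Pi\<^sub>M Basis (\<lambda>_. lborel)) borel (\<lambda>f. \<Sum>b\<in>Basis. f b *\<^sub>R b)) {z::'a. \<forall>i\<in>Basis. z \<bullet> i \<in> A i}"
    by (subst lborel_eq) simp
  also have "\<dots> = emeasure (Pi\<^sub>M Basis (\<lambda>_. lborel)) (Pi\<^sub>E Basis A)"
    by (subst emeasure_distr) (use m eq in auto)
  also have "\<dots> = (\<Prod>i\<in>Basis. emeasure lborel (A i))"
    by (rule emeasure_PiM) (use assms in auto)
  finally show ?thesis .
qed

text \<open>The linear map \<open>T\<close> that takes the standard basis to \<open>B\<close> is an
  isometry, hence preserves \<open>lborel\<close>, and pulls conditions on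
  \<open>B\<close>-coordinates back to standard coordinates, where the measure is a product by
  construction.\<close>

lemma emeasure_lborel_orthonormal_coordinates:
  fixes B :: "(real ^ 'n) set" and A :: "real ^ 'n \<Rightarrow> real set"
  assumes orth: "pairwise orthogonal B" and nrm: "\<And>b. b \<in> B \<Longrightarrow> norm b = 1"
    and span: "span B = UNIV" and A: "\<And>b. b \<in> B \<Longrightarrow> A b \<in> sets borel"
  shows "emeasure lborel {y. \<forall>b\<in>B. y \<bullet> b \<in> A b} = (\<Prod>b\<in>B. emeasure lborel (A b))"
proof -
  have ind: "independent B"
    using orth nrm by (intro pairwise_orthogonal_independent) fastforce+
  have "card B = card (Basis :: (real ^ 'n) set)"
    using ind span dim_eq_card[of B UNIV] by (metis dim_UNIV span_UNIV)
  moreover from this have "B \<noteq> {}" by (metis card.empty DIM_positive less_irrefl)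
  moreover have "finite B" using ind by (rule independent_imp_finite)
  ultimately obtain \<beta> where \<beta>: "bij_betw \<beta> (Basis :: (real ^ 'n) set) B"
    using finite_same_card_bij[of "Basis :: (real ^ 'n) set" B] by auto
  have \<beta>B: "\<beta> i \<in> B" if "i \<in> Basis" for i using \<beta> that by (auto simp: bij_betw_def)
  have \<beta>i: "\<beta> i \<bullet> \<beta> j = (if i = j then 1 else 0)" if "i \<in> Basis" "j \<in> Basis" for i j
    using that \<beta> orth nrm[OF \<beta>B] by (simp add: bij_betw_def pairwise_def orthogonal_def inj_on_def norm_eq_1, metis imageI)
  define T where "T z = (\<Sum>i\<in>Basis. (z \<bullet> i) *\<^sub>R \<beta> i)" for z
  have lin: "linear T" unfolding T_def
    by (rule linearI) (simp_all add: inner_add_left scaleR_add_left sum.distrib scaleR_sum_right)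
  have Tb: "T z \<bullet> \<beta> i = z \<bullet> i" if "i \<in> Basis" for z i
  proof -
    have "T z \<bullet> \<beta> i = (\<Sum>j\<in>Basis. (z \<bullet> j) * (if j = i then 1 else 0))"
      unfolding T_def inner_sum_left using that by (intro sum.cong) (auto simp: \<beta>i)
    also have "\<dots> = (\<Sum>j\<in>Basis. if j = i then z \<bullet> j else 0)" by (intro sum.cong) auto
    also have "\<dots> = z \<bullet> i" using that by (simp add: sum.delta)
    finally show ?thesis .
  qed
  have orthT: "orthogonal_transformation T"
    unfolding orthogonal_transformation_def
  proof (intro conjI lin allI)
    fix v w
    have "T v \<bullet> T w = (\<Sum>i\<in>Basis. (w \<bullet> i) * (T v \<bullet> \<beta> i))"
      by (simp add: T_def[of w] inner_sum_right)
    also have "\<dots> = (\<Sum>i\<in>Basis. (v \<bullet> i) * (w \<bullet> i))" by (simp add: Tb mult.commute)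
    also have "\<dots> = v \<bullet> w" by (rule euclidean_inner[symmetric])
    finally show "T v \<bullet> T w = v \<bullet> w" .
  qed
  have pre: "T -` {y. \<forall>b\<in>B. y \<bullet> b \<in> A b} = {z. \<forall>i\<in>Basis. z \<bullet> i \<in> A (\<beta> i)}"
    using \<beta> Tb by (auto simp: bij_betw_def)
  have m: "{y. \<forall>b\<in>B. y \<bullet> b \<in> A b} \<in> sets borel"
    by (rule borel_coordinates) (use A \<open>finite B\<close> \<open>B \<noteq> {}\<close> in auto)
  have Tm: "T \<in> borel_measurable lborel"
    using lin linear_conv_bounded_linear
    by (auto intro!: borel_measurable_continuous_onI linear_continuous_on)
  have "emeasure lborel {y. \<forall>b\<in>B. y \<bullet> b \<in> A b} = emeasure (distr lborel borel T) {y. \<forall>b\<in>B. y \<bullet> b \<in> A b}"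
    by (simp add: lborel_distr_orthogonal[OF orthT])
  also have "\<dots> = emeasure lborel {z. \<forall>i\<in>Basis. z \<bullet> i \<in> A (\<beta> i)}"
    by (subst emeasure_distr[OF Tm m]) (use pre in simp)
  also have "\<dots> = (\<Prod>i\<in>Basis. emeasure lborel (A (\<beta> i)))"
    by (rule emeasure_lborel_coordinates) (use A \<beta>B in auto)
  also have "\<dots> = (\<Prod>b\<in>B. emeasure lborel (A b))"
    using \<beta> by (rule prod.reindex_bij_betw)
  finally show ?thesis .
qed

section \<open>Prisms and hyperplane volume\<close>

lemma prism_alt: "prism F x = {y + t *\<^sub>R x | y t. y \<in> F \<and> t \<in> {0..1}}"
  unfolding prism_def by (auto simp: image_iff; blast)

lemma compact_prism: "compact F \<Longrightarrow> compact (prism F x)"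
  unfolding prism_def
  by (intro compact_continuous_image compact_Times) (auto intro!: continuous_intros simp: case_prod_unfold)

text \<open>Adjoining \<open>u\<close> to the chosen basis \<open>B\<close> gives an orthonormal
  basis of the whole space. On a slab of thickness 1 orthogonal to \<open>u\<close> the factor
  belonging to \<open>u\<close> contributes 1, so the \<open>B\<close>-coordinates push Lebesgue
  measure forward to the product measure of the definition. The prism is the part of the slab above
  \<open>F\<close>; the choice of \<open>B\<close> thereby disappears.\<close>

lemma hyperplane_volume_eq_prism:
  fixes u :: "real ^ 'n"
  assumes u: "norm u = 1" and F: "compact F" and Fh: "\<And>y. y \<in> F \<Longrightarrow> y \<bullet> u = h"
  shows "hyperplane_volume u F = measure lebesgue (prism F u)"
proof -
  define B where "B = (SOME B. orthonormal_basis_of {x. u \<bullet> x = 0} B)"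
  have ob: "orthonormal_basis_of {x. u \<bullet> x = 0} B"
    unfolding B_def by (rule someI_ex) (rule orthonormal_basis_of_exists)
  then have orth: "pairwise orthogonal B" and nrm: "\<And>b. b \<in> B \<Longrightarrow> norm b = 1"
    and spB: "span B = {x. u \<bullet> x = 0}"
    by (auto simp: orthonormal_basis_of_def)
  have uB0: "u \<bullet> b = 0" if "b \<in> B" for b
    using spB span_base[OF that] by auto
  have uu: "u \<bullet> u = 1" using u by (simp add: norm_eq_1)
  have uB: "u \<notin> B" using uB0 uu by force
  have bb: "b \<bullet> b' = (if b = b' then 1 else 0)" if "b \<in> B" "b' \<in> B" for b b'
    using that orth nrm by (auto simp: pairwise_def orthogonal_def norm_eq_1)
  have ind: "independent B"
    using orth nrm by (intro pairwise_orthogonal_independent) fastforce+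
  then have finB: "finite B" by (rule independent_imp_finite)
  have orth': "pairwise orthogonal (insert u B)"
    using orth uB0 by (auto simp: pairwise_insert orthogonal_def inner_commute)
  have sp': "span (insert u B) = UNIV"
  proof -
    have "y \<in> span (insert u B)" for y
    proof -
      have "u \<bullet> (y - (y \<bullet> u) *\<^sub>R u) = 0" by (simp add: inner_diff_right uu inner_commute)
      then show ?thesis using spB span_breakdown_eq[of y u B] by auto
    qed
    then show ?thesis by auto
  qed
  have sumB: "(\<Sum>b\<in>B. f b *\<^sub>R b) \<bullet> b' = f b'" if "b' \<in> B" for f b'
  proof -
    have "(\<Sum>b\<in>B. f b *\<^sub>R b) \<bullet> b' = (\<Sum>b\<in>B. if b = b' then f b else 0)"
      unfolding inner_sum_left using that by (intro sum.cong) (auto simp: bb)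
    also have "\<dots> = f b'" using that finB by simp
    finally show ?thesis .
  qed
  have sumu: "(\<Sum>b\<in>B. f b *\<^sub>R b) \<bullet> u = 0" for f
    unfolding inner_sum_left by (rule sum.neutral) (auto simp: uB0 inner_commute[of _ u])
  have expand: "(\<Sum>b\<in>B. (y \<bullet> b) *\<^sub>R b) = y - (y \<bullet> u) *\<^sub>R u" for y
  proof -
    let ?d = "y - ((y \<bullet> u) *\<^sub>R u + (\<Sum>b\<in>B. (y \<bullet> b) *\<^sub>R b))"
    have "?d \<bullet> z = 0" if "z \<in> insert u B" for z
    proof (cases "z = u")
      case True
      then show ?thesis by (simp add: inner_diff_left inner_add_left sumu uu)
    next
      case False
      then have "z \<in> B" using that by simp
      then show ?thesis by (simp add: inner_diff_left inner_add_left sumB uB0)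
    qed
    then have "orthogonal ?d z" if "z \<in> span (insert u B)" for z
      using that by (intro orthogonal_to_span[OF that]) (auto simp: orthogonal_def)
    then have "orthogonal ?d ?d" using sp' by auto
    then show ?thesis by (simp add: orthogonal_self algebra_simps)
  qed
  interpret product_sigma_finite "\<lambda>_ :: real ^ 'n. lborel :: real measure" ..
  define W where "W = {y. y \<bullet> u \<in> {h..h+1}}"
  define c where "c y = (\<lambda>b\<in>B. y \<bullet> b)" for y
  have Wm: "W \<in> sets borel"
  proof -
    have "closed W" unfolding W_def by (auto intro!: closed_Collect_conj closed_Collect_le continuous_intros)
    then show ?thesis by (rule borel_closed)
  qed
  have cm: "c \<in> restrict_space lborel W \<rightarrow>\<^sub>M Pi\<^sub>M B (\<lambda>_. lborel)"
    unfolding c_def by (intro measurable_restrict measurable_restrict_space1) auto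
  have N: "distr (restrict_space lborel W) (Pi\<^sub>M B (\<lambda>_. lborel)) c = Pi\<^sub>M B (\<lambda>_. lborel)" (is "?N = _")
  proof (rule PiM_eqI[OF finB])
    fix A :: "real ^ 'n \<Rightarrow> real set" assume A: "\<And>i. i \<in> B \<Longrightarrow> A i \<in> sets lborel"
    have "emeasure ?N (Pi\<^sub>E B A) = emeasure (restrict_space lborel W) (c -` Pi\<^sub>E B A \<inter> W)"
      by (subst emeasure_distr[OF cm]) (use A finB in \<open>auto intro!: sets_PiM_I_finite simp: space_restrict_space\<close>)
    also have "\<dots> = emeasure lborel (c -` Pi\<^sub>E B A \<inter> W)"
      by (rule emeasure_restrict_space) (use Wm in auto)
    also have "c -` Pi\<^sub>E B A \<inter> W = {y. \<forall>b\<in>insert u B. y \<bullet> b \<in> (A(u := {h..h+1})) b}"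
      using uB by (auto simp: c_def W_def PiE_iff)
    also have "emeasure lborel \<dots> = (\<Prod>b\<in>insert u B. emeasure lborel ((A(u := {h..h+1})) b))"
      by (rule emeasure_lborel_orthonormal_coordinates[OF orth' _ sp']) (use u nrm A in auto)
    also have "\<dots> = (\<Prod>b\<in>B. emeasure lborel (A b))"
      using finB uB by (simp, intro prod.cong) auto
    finally show "emeasure ?N (Pi\<^sub>E B A) = (\<Prod>b\<in>B. emeasure lborel (A b))" .
  qed simp
  have K: "c ` F = (\<lambda>f. h *\<^sub>R u + (\<Sum>b\<in>B. f b *\<^sub>R b)) -` F \<inter> space (Pi\<^sub>M B (\<lambda>_. lborel))"
  proof (intro equalityI subsetI)
    fix f assume "f \<in> c ` F"
    then obtain y where y: "y \<in> F" "f = c y" by auto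
    have "(\<Sum>b\<in>B. f b *\<^sub>R b) = (\<Sum>b\<in>B. (y \<bullet> b) *\<^sub>R b)"
      by (intro sum.cong) (auto simp: y(2) c_def)
    then have "h *\<^sub>R u + (\<Sum>b\<in>B. f b *\<^sub>R b) = y"
      unfolding expand Fh[OF y(1)] by simp
    with y show "f \<in> (\<lambda>f. h *\<^sub>R u + (\<Sum>b\<in>B. f b *\<^sub>R b)) -` F \<inter> space (Pi\<^sub>M B (\<lambda>_. lborel))"
      by (auto simp: c_def space_PiM)
  next
    fix f assume f: "f \<in> (\<lambda>f. h *\<^sub>R u + (\<Sum>b\<in>B. f b *\<^sub>R b)) -` F \<inter> space (Pi\<^sub>M B (\<lambda>_. lborel))"
    let ?y = "h *\<^sub>R u + (\<Sum>b\<in>B. f b *\<^sub>R b)"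
    have "?y \<bullet> b = f b" if "b \<in> B" for b
      using that by (simp add: inner_add_left sumB uB0)
    moreover have "f \<in> extensional B" using f by (auto simp: space_PiM PiE_def)
    ultimately have "c ?y = f" unfolding c_def by (intro extensionalityI[of _ B]) auto
    moreover have "?y \<in> F" using f by auto
    ultimately show "f \<in> c ` F" by force
  qed
  have Km: "c ` F \<in> sets (Pi\<^sub>M B (\<lambda>_. lborel))"
    unfolding K by (rule measurable_sets[where A=borel]) (use F in \<open>auto intro!: borel_closed compact_imp_closed\<close>)
  have pr: "c -` (c ` F) \<inter> W = prism F u"
  proof (intro equalityI subsetI)
    fix y assume "y \<in> c -` (c ` F) \<inter> W"
    then obtain y' where y': "y' \<in> F" "c y = c y'" and yW: "y \<in> W" by auto
    have "y \<bullet> b = y' \<bullet> b" if "b \<in> B" for b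
      using fun_cong[OF y'(2), of b] that by (simp add: c_def)
    then have "(\<Sum>b\<in>B. (y \<bullet> b) *\<^sub>R b) = (\<Sum>b\<in>B. (y' \<bullet> b) *\<^sub>R b)" by (intro sum.cong) auto
    then have "y - (y \<bullet> u) *\<^sub>R u = y' - h *\<^sub>R u"
      using expand[of y] expand[of y'] unfolding Fh[OF y'(1)] by simp
    then have "y = y' + (y \<bullet> u - h) *\<^sub>R u" by (simp add: algebra_simps)
    moreover have "y \<bullet> u - h \<in> {0..1}" using yW by (auto simp: W_def)
    ultimately show "y \<in> prism F u" unfolding prism_alt using y' by blast
  next
    fix y assume "y \<in> prism F u"
    then obtain y' t where y': "y' \<in> F" "t \<in> {0..1}" "y = y' + t *\<^sub>R u" unfolding prism_alt by auto
    have "y \<bullet> b = y' \<bullet> b" if "b \<in> B" for b using y'(3) uB0[OF that] by (simp add: inner_add_left)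
    then have "c y = c y'" unfolding c_def by (intro restrict_ext) auto
    moreover have "y \<in> W" using y' Fh uu by (auto simp: W_def inner_add_left)
    ultimately show "y \<in> c -` (c ` F) \<inter> W" using y' by auto
  qed
  have "hyperplane_volume u F = measure (Pi\<^sub>M B (\<lambda>_. lborel)) (c ` F)"
    unfolding hyperplane_volume_def Let_def B_def c_def ..
  also have "\<dots> = measure ?N (c ` F)" by (simp add: N)
  also have "\<dots> = measure (restrict_space lborel W) (prism F u)"
    using pr by (subst measure_distr[OF cm Km]) (simp add: space_restrict_space)
  also have "\<dots> = measure lborel (prism F u)"
    by (rule measure_restrict_space) (use Wm pr in auto)
  also have "\<dots> = measure lebesgue (prism F u)"
    using compact_prism[OF F, of u] by (simp add: measure_completion borel_compact)
  finally show ?thesis .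
qed

text \<open>The matrix determinant lemma, up to sign. Conjugation with a rotation taking an axis
  vector to \<open>u\<close> turns the map into some \<open>replace_col\<close>.\<close>

lemma det_rank_one_update:
  fixes u w :: "real ^ 'n"
  assumes u: "norm u = 1"
  shows "\<bar>det (matrix (\<lambda>y. y + (y \<bullet> u) *\<^sub>R w))\<bar> = \<bar>1 + w \<bullet> u\<bar>"
proof -
  fix k :: 'n
  obtain R where R: "orthogonal_transformation R" "R (axis k 1 :: real ^ 'n) = u"
    using orthogonal_transformation_exists[of "axis k (1::real)" u] u by auto
  let ?L = "\<lambda>y. y + (y \<bullet> u) *\<^sub>R w"
  have linR: "linear R" using R(1) by (rule orthogonal_transformation_linear)
  have linL: "linear ?L" by (rule linearI) (auto simp: algebra_simps inner_add_left)
  obtain w' where w': "w = R w'" using orthogonal_transformation_surj[OF R(1)] by (metis surjD)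
  let ?M = "replace_col k (axis k 1 + w')"
  have iR: "R a \<bullet> R b = a \<bullet> b" for a b using R(1) by (auto simp: orthogonal_transformation_def)
  have "?L \<circ> R = R \<circ> (*v) ?M"
  proof
    fix y
    have "R y \<bullet> u = y $ k" using iR[of y "axis k 1"] R(2) by (simp add: inner_axis)
    then show "(?L \<circ> R) y = (R \<circ> (*v) ?M) y"
      by (simp add: replace_col_mult w' linear_add[OF linR] linear_scale[OF linR])
  qed
  then have "matrix ?L ** matrix R = matrix R ** ?M"
    using matrix_compose[OF linR linL] matrix_compose[OF _ linR, of "(*v) ?M"] by simp
  then have "det (matrix ?L) * det (matrix R) = det (matrix R) * det ?M"
    by (metis det_mul)
  moreover have "\<bar>det (matrix R)\<bar> = 1"
    using R(1) det_orthogonal_matrix orthogonal_transformation_matrix by fastforce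
  ultimately have "det (matrix ?L) = det ?M" by auto
  also have "\<dots> = 1 + w' $ k" by (simp add: det_replace_col)
  also have "w' $ k = w \<bullet> u" using iR[of w' "axis k 1"] R(2) w' by (simp add: inner_axis)
  finally show ?thesis by simp
qed

text \<open>Base times height. The map \<open>?L\<close> fixes the directions orthogonal to
  \<open>u\<close> and sends \<open>u\<close> to \<open>x\<close>; it carries the orthogonal prism
  to a translate of the oblique one and has determinant x . u up to sign.\<close>

lemma measure_prism:
  fixes u :: "real ^ 'n"
  assumes u: "norm u = 1" and F: "compact F" and Fh: "\<And>y. y \<in> F \<Longrightarrow> y \<bullet> u = h"
  shows "measure lebesgue (prism F x) = \<bar>x \<bullet> u\<bar> * hyperplane_volume u F"
proof -
  let ?L = "\<lambda>y. y + (y \<bullet> u) *\<^sub>R (x - u)"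
  have uu: "u \<bullet> u = 1" using u by (simp add: norm_eq_1)
  have lin: "linear ?L" by (rule linearI) (auto simp: algebra_simps inner_add_left)
  have "?L (y + t *\<^sub>R u) = h *\<^sub>R (x - u) + (y + t *\<^sub>R x)" if "y \<in> F" for y t
    using Fh[OF that] uu by (simp add: inner_add_left algebra_simps)
  then have "?L ` prism F u = (+) (h *\<^sub>R (x - u)) ` prism F x"
    unfolding prism_def image_image by (intro image_cong) auto
  then have "measure lebesgue (prism F x) = measure lebesgue (?L ` prism F u)"
    by (simp add: measure_translation)
  also have "\<dots> = \<bar>det (matrix ?L)\<bar> * measure lebesgue (prism F u)"
    by (rule measure_linear_image_det[OF lin]) (use compact_prism[OF F] in \<open>auto intro: lmeasurable_compact\<close>)
  also have "\<bar>det (matrix ?L)\<bar> = \<bar>x \<bullet> u\<bar>"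
    by (subst det_rank_one_update[OF u]) (simp add: inner_diff_left uu)
  also have "measure lebesgue (prism F u) = hyperplane_volume u F"
    by (rule hyperplane_volume_eq_prism[OF u F Fh, symmetric])
  finally show ?thesis .
qed

lemma prism_linear_image:
  assumes "linear f"
  shows "prism (f ` F) (f x) = f ` prism F x"
proof -
  have "prism (f ` F) (f x) = (\<lambda>(y, t). f y + t *\<^sub>R f x) ` (F \<times> {0..1})"
    unfolding prism_def by (auto simp: image_iff)
  also have "\<dots> = f ` prism F x"
    unfolding prism_def image_image
    by (intro image_cong) (auto simp: linear_add[OF assms] linear_scale[OF assms])
  finally show ?thesis .
qed

section \<open>Facets\<close>

lemma support_fun_eqI:
  assumes "y \<in> P" "\<And>z. z \<in> P \<Longrightarrow> u \<bullet> z \<le> u \<bullet> y"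
  shows "support_fun P u = u \<bullet> y"
  unfolding support_fun_def by (rule cSup_eq_maximum) (use assms in auto)

lemma support_fun_attained:
  assumes "compact P" "P \<noteq> {}"
  obtains y where "y \<in> P" "support_fun P u = u \<bullet> y" "\<And>z. z \<in> P \<Longrightarrow> u \<bullet> z \<le> u \<bullet> y"
proof -
  have "continuous_on P (\<lambda>z. u \<bullet> z)" by (intro continuous_intros)
  then obtain y where "y \<in> P" "\<forall>z\<in>P. u \<bullet> z \<le> u \<bullet> y"
    using continuous_attains_sup[OF assms] by blast
  then show ?thesis using that support_fun_eqI[of y P u] by blast
qed

lemma support_fun_ge:
  assumes "compact P" "z \<in> P"
  shows "z \<bullet> u \<le> support_fun P u"
proof -
  obtain y where "support_fun P u = u \<bullet> y" "\<And>z. z \<in> P \<Longrightarrow> u \<bullet> z \<le> u \<bullet> y"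
    using support_fun_attained[of P u] assms by blast
  then show ?thesis using assms(2) inner_commute by metis
qed

lemma face_in_direction_nonempty:
  assumes "compact P" "P \<noteq> {}"
  shows "face_in_direction P u \<noteq> {}"
proof -
  obtain y where "y \<in> P" "support_fun P u = u \<bullet> y" using support_fun_attained[OF assms] by metis
  then have "y \<in> face_in_direction P u" by (simp add: face_in_direction_def inner_commute)
  then show ?thesis by blast
qed

lemma face_in_direction_subset: "face_in_direction P u \<subseteq> P"
  and face_in_direction_inner: "y \<in> face_in_direction P u \<Longrightarrow> y \<bullet> u = support_fun P u"
  by (auto simp: face_in_direction_def)

lemma face_in_direction_Int: "face_in_direction P u = P \<inter> {y. u \<bullet> y = support_fun P u}"
  by (auto simp: face_in_direction_def inner_commute)

lemma compact_face_in_direction: "compact P \<Longrightarrow> compact (face_in_direction P u)"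
  unfolding face_in_direction_Int by (intro compact_Int_closed closed_hyperplane)

lemma convex_face_in_direction: "convex P \<Longrightarrow> convex (face_in_direction P u)"
  unfolding face_in_direction_Int by (intro convex_Int convex_hyperplane)

lemma face_in_direction_face_of:
  assumes "compact P" "convex P"
  shows "face_in_direction P u face_of P"
  unfolding face_in_direction_Int
  using support_fun_ge[OF assms(1), of _ u] assms(2)
  by (intro face_of_Int_supporting_hyperplane_le) (auto simp: inner_commute)

lemma hyperplane_volume_nonneg:
  assumes "norm u = 1" "compact F" "\<And>y. y \<in> F \<Longrightarrow> y \<bullet> u = h"
  shows "0 \<le> hyperplane_volume u F"
  by (subst hyperplane_volume_eq_prism[OF assms]) auto

lemma aff_dim_prism:
  assumes u: "norm u = 1" and ne: "F \<noteq> {}" and Fh: "\<And>y. y \<in> F \<Longrightarrow> y \<bullet> u = h"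
  shows "aff_dim (prism F u) = aff_dim F + 1"
proof -
  obtain y0 where y0: "y0 \<in> F" using ne by auto
  let ?I = "insert (y0 + u) F"
  have "?I \<subseteq> prism F u"
  proof
    fix z assume "z \<in> ?I"
    then show "z \<in> prism F u"
    proof
      assume "z = y0 + u"
      then have "z = y0 + 1 *\<^sub>R u" by simp
      then show ?thesis unfolding prism_alt using y0 by fastforce
    next
      assume "z \<in> F"
      then show ?thesis unfolding prism_alt by (intro CollectI exI[of _ z] exI[of _ 0]) auto
    qed
  qed
  then have "aff_dim ?I \<le> aff_dim (prism F u)" by (rule aff_dim_subset)
  moreover have "prism F u \<subseteq> affine hull ?I"
  proof
    fix z assume "z \<in> prism F u"
    then obtain y t where z: "y \<in> F" "z = y + t *\<^sub>R u" unfolding prism_alt by auto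
    have "y + t *\<^sub>R ((y0 + u) - y0) \<in> affine hull ?I"
      by (intro mem_affine_3_minus) (auto simp: hull_inc z y0)
    then show "z \<in> affine hull ?I" using z by simp
  qed
  then have "aff_dim (prism F u) \<le> aff_dim ?I"
    by (metis aff_dim_affine_hull aff_dim_subset)
  moreover have "y0 + u \<notin> affine hull F"
  proof -
    have "affine hull F \<subseteq> {y. u \<bullet> y = h}"
    proof (rule hull_minimal)
      show "F \<subseteq> {y. u \<bullet> y = h}" using Fh by (auto simp: inner_commute)
    qed (rule affine_hyperplane)
    moreover have "u \<bullet> (y0 + u) = h + 1"
      using Fh[OF y0] u by (simp add: inner_add_right norm_eq_1 inner_commute)
    ultimately show ?thesis by auto
  qed
  then have "aff_dim ?I = aff_dim F + 1" by (simp add: aff_dim_insert)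
  ultimately show ?thesis by linarith
qed

lemma convex_prism: "convex F \<Longrightarrow> convex (prism F u)"
  unfolding prism_def
proof (rule convex_linear_image)
  show "linear (\<lambda>(y, t). y + t *\<^sub>R u)"
    by (rule linearI) (auto simp: algebra_simps)
qed (auto intro: convex_Times)

text \<open>A convex set has positive Lebesgue measure exactly when it has interior points; this is
  applied to the prism, whose dimension exceeds that of \<open>F\<close> by one. It identifies facet
  normals as the directions of positive facet volume, so sums over facets may be extended to larger
  sets of directions.\<close>

lemma hyperplane_volume_pos_iff:
  fixes u :: "real ^ 'n"
  assumes u: "norm u = 1" and F: "compact F" "convex F" "F \<noteq> {}" and Fh: "\<And>y. y \<in> F \<Longrightarrow> y \<bullet> u = h"
  shows "0 < hyperplane_volume u F \<longleftrightarrow> aff_dim F = int CARD('n) - 1"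
proof -
  have c: "convex (prism F u)" "compact (prism F u)" using F by (auto intro: convex_prism compact_prism)
  have neq: "prism F u \<noteq> {}" using F(3) unfolding prism_def by auto
  have "0 < hyperplane_volume u F \<longleftrightarrow> 0 < measure lebesgue (prism F u)"
    by (simp add: hyperplane_volume_eq_prism[OF u F(1) Fh])
  also have "\<dots> \<longleftrightarrow> \<not> negligible (prism F u)"
    using c(2) by (auto simp: negligible_iff_measure lmeasurable_compact zero_less_measure_iff)
  also have "\<dots> \<longleftrightarrow> interior (prism F u) \<noteq> {}"
    by (simp add: negligible_convex_interior c(1))
  also have "\<dots> \<longleftrightarrow> aff_dim (prism F u) = int CARD('n)"
    using aff_dim_nonempty_interior[of "prism F u"] interior_rel_interior[of "prism F u"]
      rel_interior_eq_empty[OF c(1)] neq by auto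
  also have "\<dots> \<longleftrightarrow> aff_dim F = int CARD('n) - 1"
    using aff_dim_prism[OF u F(3) Fh] by auto
  finally show ?thesis .
qed

lemma facet_volume_nonneg: "compact P \<Longrightarrow> norm u = 1 \<Longrightarrow> 0 \<le> facet_volume P u"
  unfolding facet_volume_def
  by (rule hyperplane_volume_nonneg[OF _ compact_face_in_direction face_in_direction_inner])

lemma facet_volume_pos_iff:
  assumes "compact P" "convex P" "P \<noteq> {}" "norm u = 1"
  shows "0 < facet_volume P u \<longleftrightarrow> u \<in> facet_normals P"
  using hyperplane_volume_pos_iff[OF assms(4) compact_face_in_direction[OF assms(1)]
    convex_face_in_direction[OF assms(2)] face_in_direction_nonempty[OF assms(1,3)] face_in_direction_inner]
  by (auto simp: facet_volume_def facet_normals_def assms(4))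

text \<open>There are finitely many faces, and a face of codimension one spans a hyperplane, which
  has only two unit normals.\<close>

lemma finite_facet_normals:
  assumes "polytope P"
  shows "finite (facet_normals P)"
proof -
  have fin: "finite {F. F face_of P}" by (rule finite_polytope_faces[OF assms])
  have cc: "compact P" "convex P" using assms by (auto simp: polytope_imp_compact polytope_imp_convex)
  have im: "face_in_direction P ` facet_normals P \<subseteq> {F. F face_of P}"
    using face_in_direction_face_of[OF cc] by auto
  have opp: "v = u \<or> v = - u" if uv: "u \<in> facet_normals P" "v \<in> facet_normals P"
    and eq: "face_in_direction P u = face_in_direction P v" for u v
  proof -
    let ?F = "face_in_direction P u"
    have nu: "u \<bullet> u = 1" "v \<bullet> v = 1" and ad: "aff_dim ?F = int CARD('a) - 1"
      using uv by (auto simp: facet_normals_def norm_eq_1)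
    have Fne: "?F \<noteq> {}" using ad by (auto simp: aff_dim_empty_eq)
    then obtain y0 where y0: "y0 \<in> ?F" by auto
    have sub: "affine hull ?F \<subseteq> {y. w \<bullet> y = support_fun P w}" if "w = u \<or> w = v" for w
    proof (rule hull_minimal)
      have "?F = face_in_direction P w" using that eq by auto
      then show "?F \<subseteq> {y. w \<bullet> y = support_fun P w}"
        by (auto simp: face_in_direction_Int)
    qed (rule affine_hyperplane)
    have "affine hull ?F = {y. u \<bullet> y = support_fun P u}"
    proof (rule affine_dim_equal)
      show "aff_dim (affine hull ?F) = aff_dim {y. u \<bullet> y = support_fun P u}"
      proof -
        have "u \<noteq> 0" using nu(1) by auto
        then show ?thesis using ad by simp
      qed
    qed (use Fne sub in \<open>auto simp: affine_hyperplane\<close>)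
    then have H: "v \<bullet> y = support_fun P v" if "u \<bullet> y = support_fun P u" for y
      using sub[of v] that by auto
    \<comment> \<open>The part of \<open>v\<close> orthogonal to \<open>u\<close>. Moving
      \<open>y0\<close> along it stays in the hyperplane spanned by the face, on which
      \<open>v\<close> is constant too, so \<open>w\<close> is orthogonal to itself.\<close>
    define w where "w = v - (u \<bullet> v) *\<^sub>R u"
    have uw: "u \<bullet> w = 0" by (simp add: w_def inner_diff_right nu)
    have "u \<bullet> (y0 + w) = support_fun P u"
      using face_in_direction_inner[OF y0] uw by (simp add: inner_add_right inner_commute)
    then have "v \<bullet> (y0 + w) = v \<bullet> y0"
      using H[of "y0 + w"] H[of y0] face_in_direction_inner[OF y0] by (simp add: inner_commute)
    then have "v \<bullet> w = 0" by (simp add: inner_add_right)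
    moreover have "w \<bullet> w = v \<bullet> w - (u \<bullet> v) * (u \<bullet> w)"
      by (subst w_def) (simp add: inner_diff_left)
    ultimately have "w \<bullet> w = 0" using uw by simp
    then have v: "v = (u \<bullet> v) *\<^sub>R u" by (simp add: w_def)
    then have "(u \<bullet> v) * (u \<bullet> v) = 1"
      using nu by (metis inner_scaleR_left inner_scaleR_right mult.right_neutral)
    then have "u \<bullet> v = 1 \<or> u \<bullet> v = -1" by (simp add: square_eq_1_iff)
    then show ?thesis using v by auto
  qed
  have "finite {v \<in> facet_normals P. face_in_direction P v = F}" for F
  proof (cases "\<exists>u \<in> facet_normals P. face_in_direction P u = F")
    case True
    then obtain u where "u \<in> facet_normals P" "face_in_direction P u = F" by auto
    then have "{v \<in> facet_normals P. face_in_direction P v = F} \<subseteq> {u, - u}"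
      using opp by blast
    then show ?thesis by (rule finite_subset) auto
  qed (auto intro: finite_subset[of _ "{}"])
  then have "finite (\<Union>F\<in>{F. F face_of P}. {v \<in> facet_normals P. face_in_direction P v = F})"
    using fin by auto
  then show ?thesis by (rule rev_finite_subset) (use im in auto)
qed

lemma facet_normals_o_subset: "facet_normals_o P \<subseteq> facet_normals P"
  by (auto simp: facet_normals_o_def)

text \<open>The point at issue is that the top face of \<open>Q\<close> lies in \<open>P\<close>.
  From a point of it outside \<open>P\<close>, a short step towards a top point of \<open>P\<close>
  stays outside \<open>P\<close>, hence lies in \<open>Q\<close> by convexity of the union, but is
  higher than the top of \<open>Q\<close>.\<close>

lemma face_in_direction_Un_Int_less:
  assumes P: "compact P" "P \<noteq> {}" and Q: "compact Q" "Q \<noteq> {}" and conv: "convex (P \<union> Q)"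
    and less: "support_fun Q u < support_fun P u"
  shows "support_fun (P \<union> Q) u = support_fun P u" "face_in_direction (P \<union> Q) u = face_in_direction P u"
    "support_fun (P \<inter> Q) u = support_fun Q u" "face_in_direction (P \<inter> Q) u = face_in_direction Q u"
proof -
  obtain p where p: "p \<in> P" "support_fun P u = u \<bullet> p" "\<And>z. z \<in> P \<Longrightarrow> u \<bullet> z \<le> u \<bullet> p"
    using support_fun_attained[OF P, of u] by blast
  obtain q where q: "q \<in> Q" "support_fun Q u = u \<bullet> q" "\<And>z. z \<in> Q \<Longrightarrow> u \<bullet> z \<le> u \<bullet> q"
    using support_fun_attained[OF Q, of u] by blast
  have lt: "u \<bullet> z < u \<bullet> p" if "z \<in> Q" for z using q(3)[OF that] less p q by linarith
  show 1: "support_fun (P \<union> Q) u = support_fun P u"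
    unfolding p(2) by (rule support_fun_eqI) (use p lt in \<open>force\<close>)+
  show "face_in_direction (P \<union> Q) u = face_in_direction P u"
    unfolding face_in_direction_def 1 p(2) using lt by (force simp: inner_commute)
  have inP: "y \<in> P" if y: "y \<in> Q" "u \<bullet> y = u \<bullet> q" for y
  proof (rule ccontr)
    assume "y \<notin> P"
    then have "open (- P)" "y \<in> - P" using P compact_imp_closed by auto
    then obtain e where e: "e > 0" "ball y e \<subseteq> - P" using open_contains_ball by blast
    \<comment> \<open>Small enough that the step from \<open>y\<close> towards \<open>p\<close>
      remains in the ball that misses \<open>P\<close>.\<close>
    define s where "s = min 1 (e / (2 * (norm (p - y) + 1)))"
    have s: "0 < s" "s \<le> 1" using e by (auto simp: s_def add_pos_nonneg add_nonneg_pos)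
    define z where "z = y + s *\<^sub>R (p - y)"
    have "s * norm (p - y) \<le> e / (2 * (norm (p - y) + 1)) * norm (p - y)"
      by (rule mult_right_mono) (auto simp: s_def)
    also have "\<dots> < e" using e by (simp add: field_simps add_pos_nonneg)
    finally have "z \<in> ball y e" using s by (simp add: z_def dist_norm)
    then have "z \<notin> P" using e by auto
    moreover have "z \<in> P \<union> Q"
      using convexD_alt[OF conv, of y p s] p y s by (auto simp: z_def algebra_simps)
    moreover have "u \<bullet> z > u \<bullet> q"
    proof -
      have "u \<bullet> z = u \<bullet> q + s * (u \<bullet> p - u \<bullet> q)" by (simp add: z_def inner_add_right inner_diff_right y)
      then show ?thesis using s lt[OF q(1)] by simp
    qed
    ultimately show False using q(3)[of z] by auto
  qed
  show 2: "support_fun (P \<inter> Q) u = support_fun Q u"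
    unfolding q(2) by (rule support_fun_eqI) (use q inP in auto)
  show "face_in_direction (P \<inter> Q) u = face_in_direction Q u"
    unfolding face_in_direction_def 2 q(2) using inP by (auto simp: inner_commute)
qed

text \<open>The two top faces must meet: otherwise they would split the top face of the convex union
  into two disjoint nonempty closed sets, against connectedness. A common point shows that the
  intersection reaches the same height.\<close>

lemma face_in_direction_Un_Int_eq:
  assumes P: "compact P" "P \<noteq> {}" "convex P" and Q: "compact Q" "Q \<noteq> {}" "convex Q"
    and conv: "convex (P \<union> Q)" and eq: "support_fun P u = support_fun Q u"
  shows "support_fun (P \<union> Q) u = support_fun P u"
    "face_in_direction (P \<union> Q) u = face_in_direction P u \<union> face_in_direction Q u"
    "support_fun (P \<inter> Q) u = support_fun P u"
    "face_in_direction (P \<inter> Q) u = face_in_direction P u \<inter> face_in_direction Q u"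
proof -
  obtain p where p: "p \<in> P" "support_fun P u = u \<bullet> p" "\<And>z. z \<in> P \<Longrightarrow> u \<bullet> z \<le> u \<bullet> p"
    using support_fun_attained[OF P(1,2), of u] by blast
  obtain q where q: "q \<in> Q" "support_fun Q u = u \<bullet> q" "\<And>z. z \<in> Q \<Longrightarrow> u \<bullet> z \<le> u \<bullet> q"
    using support_fun_attained[OF Q(1,2), of u] by blast
  show 1: "support_fun (P \<union> Q) u = support_fun P u"
    unfolding p(2) by (rule support_fun_eqI) (use p q eq in \<open>auto\<close>)
  show 2: "face_in_direction (P \<union> Q) u = face_in_direction P u \<union> face_in_direction Q u"
    unfolding face_in_direction_def 1 using eq by auto
  have "face_in_direction P u \<inter> face_in_direction Q u \<noteq> {}"
  proof
    assume disj: "face_in_direction P u \<inter> face_in_direction Q u = {}"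
    have "connected (face_in_direction P u \<union> face_in_direction Q u)"
      unfolding 2[symmetric] by (intro convex_connected convex_face_in_direction conv)
    then show False
      using disj compact_face_in_direction[OF P(1), of u] compact_face_in_direction[OF Q(1), of u]
        face_in_direction_nonempty[OF P(1,2), of u] face_in_direction_nonempty[OF Q(1,2), of u]
      unfolding connected_closed by (auto dest!: compact_imp_closed)
  qed
  then obtain z where z: "z \<in> P" "z \<in> Q" "z \<bullet> u = support_fun P u"
    by (auto simp: face_in_direction_def)
  have "support_fun (P \<inter> Q) u = u \<bullet> z"
    by (rule support_fun_eqI) (use z p in \<open>auto simp: inner_commute\<close>)
  then show 3: "support_fun (P \<inter> Q) u = support_fun P u" using z by (simp add: inner_commute)
  show "face_in_direction (P \<inter> Q) u = face_in_direction P u \<inter> face_in_direction Q u"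
    unfolding face_in_direction_def 3 using eq by auto
qed

text \<open>Since \<open>F\<close> and \<open>G\<close> lie at the same height, the segment
  parameter of a point of a prism is determined by its inner product with \<open>u\<close>. Hence
  prisms commute with intersection, and inclusion-exclusion for Lebesgue measure applies.\<close>

lemma hyperplane_volume_Un_Int:
  assumes u: "norm u = 1" and F: "compact F" "\<And>y. y \<in> F \<Longrightarrow> y \<bullet> u = h"
    and G: "compact G" "\<And>y. y \<in> G \<Longrightarrow> y \<bullet> u = h"
  shows "hyperplane_volume u F + hyperplane_volume u G = hyperplane_volume u (F \<union> G) + hyperplane_volume u (F \<inter> G)"
proof -
  have un: "prism (F \<union> G) u = prism F u \<union> prism G u" unfolding prism_def by auto
  have int: "prism (F \<inter> G) u = prism F u \<inter> prism G u"
  proof (intro equalityI subsetI)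
    fix z assume "z \<in> prism F u \<inter> prism G u"
    then obtain y t y' t' where z: "y \<in> F" "y' \<in> G" "t \<in> {0..1}" "z = y + t *\<^sub>R u" "z = y' + t' *\<^sub>R u"
      unfolding prism_alt by blast
    have "(y + t *\<^sub>R u) \<bullet> u = (y' + t' *\<^sub>R u) \<bullet> u" using z by simp
    moreover have "u \<bullet> u = 1" using u by (simp add: norm_eq_1)
    ultimately have "t = t'"
      using F(2)[OF z(1)] G(2)[OF z(2)] by (simp only: inner_add_left inner_scaleR_left)
    with z show "z \<in> prism (F \<inter> G) u" unfolding prism_alt by auto
  qed (auto simp: prism_def)
  have "compact (F \<union> G)" "compact (F \<inter> G)" using F G by auto
  then show ?thesis
    using measure_Un3[of "prism F u" lebesgue "prism G u"] compact_prism[OF F(1), of u] compact_prism[OF G(1), of u]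
    by (subst (1 2 3 4) hyperplane_volume_eq_prism[OF u, where h=h])
       (use F G in \<open>auto simp: un int lmeasurable_compact\<close>)
qed

text \<open>A functional of the facets of a polytope is a valuation as soon as it is additive
  in the facet volume, because the valuation identity holds in each direction separately.\<close>

lemma facet_functional_Un_Int:
  fixes g :: "real \<Rightarrow> real \<Rightarrow> real"
  assumes add: "\<And>h a b. 0 \<le> a \<Longrightarrow> 0 \<le> b \<Longrightarrow> g h (a + b) = g h a + g h b"
    and P: "compact P" "P \<noteq> {}" "convex P" and Q: "compact Q" "Q \<noteq> {}" "convex Q"
    and conv: "convex (P \<union> Q)" and u: "norm u = 1"
  shows "g (support_fun P u) (facet_volume P u) + g (support_fun Q u) (facet_volume Q u)
    = g (support_fun (P \<union> Q) u) (facet_volume (P \<union> Q) u) + g (support_fun (P \<inter> Q) u) (facet_volume (P \<inter> Q) u)"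
proof -
  consider "support_fun Q u < support_fun P u" | "support_fun P u < support_fun Q u"
    | "support_fun P u = support_fun Q u" by linarith
  then show ?thesis
  proof cases
    case 1
    show ?thesis
      using face_in_direction_Un_Int_less[OF P(1,2) Q(1,2) conv 1] by (simp add: facet_volume_def)
  next
    case 2
    have "convex (Q \<union> P)" using conv by (simp add: Un_commute)
    then show ?thesis
      using face_in_direction_Un_Int_less[OF Q(1,2) P(1,2) _ 2]
      by (simp add: facet_volume_def Un_commute Int_commute)
  next
    case 3
    note f = face_in_direction_Un_Int_eq[OF P Q conv 3]
    have c: "compact (P \<union> Q)" "compact (P \<inter> Q)" using P Q by auto
    have "facet_volume P u + facet_volume Q u = facet_volume (P \<union> Q) u + facet_volume (P \<inter> Q) u"
      unfolding facet_volume_def f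
      by (rule hyperplane_volume_Un_Int[OF u, where h="support_fun P u"])
         (use 3 in \<open>auto intro: compact_face_in_direction P Q simp: face_in_direction_inner\<close>)
    then show ?thesis
      unfolding f 3[symmetric]
      using add[of "facet_volume P u" "facet_volume Q u" "support_fun P u"]
        add[of "facet_volume (P \<union> Q) u" "facet_volume (P \<inter> Q) u" "support_fun P u"]
        facet_volume_nonneg[OF P(1) u] facet_volume_nonneg[OF Q(1) u]
        facet_volume_nonneg[OF c(1) u] facet_volume_nonneg[OF c(2) u]
      by simp
  qed
qed

section \<open>Facets under linear maps\<close>

text \<open>The hypothesis \<open>Av\<close> says that the transpose of \<open>A\<close> sends
  \<open>v\<close> to \<open>c\<close> times \<open>u\<close>, so the two linear functionals order
  corresponding points alike.\<close>

lemma support_face_linear_image: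
  fixes A :: "real ^ 'n ^ 'n"
  assumes P: "compact P" "P \<noteq> {}" and c: "c > 0" and Av: "\<And>y. (A *v y) \<bullet> v = c * (y \<bullet> u)"
  shows "support_fun ((*v) A ` P) v = c * support_fun P u"
    and "face_in_direction ((*v) A ` P) v = (*v) A ` face_in_direction P u"
proof -
  obtain p where p: "p \<in> P" "support_fun P u = u \<bullet> p" "\<And>z. z \<in> P \<Longrightarrow> u \<bullet> z \<le> u \<bullet> p"
    using support_fun_attained[OF P, of u] by blast
  have vA: "v \<bullet> (A *v y) = c * (u \<bullet> y)" for y using Av[of y] by (simp add: inner_commute)
  have "support_fun ((*v) A ` P) v = v \<bullet> (A *v p)"
    by (rule support_fun_eqI) (use p c in \<open>auto simp: vA\<close>)
  then show s: "support_fun ((*v) A ` P) v = c * support_fun P u" by (simp add: vA p(2))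
  show "face_in_direction ((*v) A ` P) v = (*v) A ` face_in_direction P u"
    unfolding face_in_direction_def s using c by (auto simp: Av)
qed

text \<open>The inverse transpose of \<open>A\<close> applied to \<open>u\<close>, normalised: the
  outer normal of the image of a face with outer normal \<open>u\<close>.\<close>

definition dual_normal :: "real ^ 'n ^ 'n \<Rightarrow> real ^ 'n \<Rightarrow> real ^ 'n" where
  "dual_normal A u = (let w = transpose (matrix_inv A) *v u in (1 / norm w) *\<^sub>R w)"

lemma matrix_inv_det:
  fixes A :: "real ^ 'n ^ 'n"
  assumes "det A \<noteq> 0"
  shows "matrix_inv A ** A = mat 1" "A ** matrix_inv A = mat 1"
    "matrix_inv A *v (A *v y) = y" "A *v (matrix_inv A *v y) = y" "det (matrix_inv A) \<noteq> 0"
proof -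
  have i: "invertible A" using assms by (simp add: invertible_det_nz)
  show 1: "matrix_inv A ** A = mat 1" "A ** matrix_inv A = mat 1"
    using someI_ex[OF i[unfolded invertible_def]] unfolding matrix_inv_def by auto
  then show "matrix_inv A *v (A *v y) = y" "A *v (matrix_inv A *v y) = y"
    by (simp_all add: matrix_vector_mul_assoc)
  show "det (matrix_inv A) \<noteq> 0"
    using 1 det_mul[of "matrix_inv A" A] by (auto simp: det_I)
qed

lemma dual_normal:
  fixes A :: "real ^ 'n ^ 'n"
  assumes d: "det A \<noteq> 0" and u: "norm u = 1"
  shows "norm (dual_normal A u) = 1" "\<exists>c>0. \<forall>y. (A *v y) \<bullet> dual_normal A u = c * (y \<bullet> u)"
proof -
  define w where "w = transpose (matrix_inv A) *v u"
  have Aw: "(A *v y) \<bullet> w = y \<bullet> u" for y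
  proof -
    have "(A *v y) \<bullet> w = u \<bullet> (matrix_inv A *v (A *v y))"
      unfolding w_def transpose_matrix_vector by (metis dot_lmul_matrix inner_commute)
    then show ?thesis by (simp add: matrix_inv_det[OF d] inner_commute)
  qed
  have "w \<noteq> 0" using Aw[of u] u by (auto simp: norm_eq_1)
  moreover have dn: "dual_normal A u = (1 / norm w) *\<^sub>R w" by (simp add: dual_normal_def w_def Let_def)
  ultimately show "norm (dual_normal A u) = 1" "\<exists>c>0. \<forall>y. (A *v y) \<bullet> dual_normal A u = c * (y \<bullet> u)"
    by (auto simp: Aw intro!: exI[of _ "1 / norm w"])
qed

text \<open>Both transformations multiply the pairing with a normal by a positive factor, so the
  result is a positive multiple of \<open>u\<close>; positivity excludes the opposite unit
  vector.\<close>

lemma dual_normal_inverse: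
  fixes A B :: "real ^ 'n ^ 'n"
  assumes BA: "B ** A = mat 1" and u: "norm u = 1"
  shows "dual_normal B (dual_normal A u) = u"
proof -
  have "det B * det A = 1" using BA by (metis det_I det_mul)
  then have dA: "det A \<noteq> 0" and dB: "det B \<noteq> 0" by auto
  have BAy: "B *v (A *v y) = y" for y using BA by (simp add: matrix_vector_mul_assoc)
  obtain c where c: "c > 0" "\<And>y. (A *v y) \<bullet> dual_normal A u = c * (y \<bullet> u)"
    using dual_normal(2)[OF dA u] by auto
  obtain c' where c': "c' > 0" "\<And>y. (B *v y) \<bullet> dual_normal B (dual_normal A u) = c' * (y \<bullet> dual_normal A u)"
    using dual_normal(2)[OF dB dual_normal(1)[OF dA u]] by auto
  let ?v = "dual_normal B (dual_normal A u)"
  have "y \<bullet> ?v = y \<bullet> ((c' * c) *\<^sub>R u)" for y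
    using c'(2)[of "A *v y"] c(2)[of y] by (simp add: BAy)
  then have v: "?v = (c' * c) *\<^sub>R u" by (metis vector_eq_ldot)
  moreover have "norm ?v = 1" using dual_normal(1)[OF dB dual_normal(1)[OF dA u]] .
  ultimately have "\<bar>c' * c\<bar> = 1" using u by simp
  moreover have "c' * c > 0" using c(1) c'(1) by simp
  ultimately have "c' * c = 1" by linarith
  then show ?thesis using v by simp
qed

lemma compact_matrix_image: "compact P \<Longrightarrow> compact ((*v) (A :: real ^ 'n ^ 'm) ` P)"
  by (intro compact_continuous_image linear_continuous_on matrix_vector_mul_bounded_linear)

lemma inj_matrix_det: "det (A :: real ^ 'n ^ 'n) \<noteq> 0 \<Longrightarrow> inj ((*v) A)"
  by (metis injI matrix_inv_det(3))

lemma aff_dim_matrix_image: "det (A :: real ^ 'n ^ 'n) \<noteq> 0 \<Longrightarrow> aff_dim ((*v) A ` S) = aff_dim S"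
  by (intro aff_dim_injective_linear_image inj_matrix_det matrix_vector_mul_linear)

lemma image_matrix_inv:
  fixes A :: "real ^ 'n ^ 'n"
  shows "det A \<noteq> 0 \<Longrightarrow> (*v) (matrix_inv A) ` ((*v) A ` P) = P"
  by (auto simp: image_image matrix_inv_det)

lemma dual_normal_facet:
  fixes A :: "real ^ 'n ^ 'n"
  assumes d: "det A \<noteq> 0" and P: "compact P" "P \<noteq> {}"
  shows "u \<in> facet_normals P \<Longrightarrow> dual_normal A u \<in> facet_normals ((*v) A ` P)"
    and "u \<in> facet_normals_o P \<Longrightarrow> dual_normal A u \<in> facet_normals_o ((*v) A ` P)"
proof -
  have *: "dual_normal A u \<in> facet_normals ((*v) A ` P) \<and>
     (support_fun P u \<noteq> 0 \<longrightarrow> support_fun ((*v) A ` P) (dual_normal A u) \<noteq> 0)" if "u \<in> facet_normals P"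
  proof -
    have u: "norm u = 1" "aff_dim (face_in_direction P u) = int CARD('n) - 1"
      using that by (auto simp: facet_normals_def)
    obtain c where c: "c > 0" "\<And>y. (A *v y) \<bullet> dual_normal A u = c * (y \<bullet> u)"
      using dual_normal(2)[OF d u(1)] by auto
    show ?thesis
      using support_face_linear_image[OF P c] c(1) u dual_normal(1)[OF d u(1)]
      by (auto simp: facet_normals_def aff_dim_matrix_image[OF d])
  qed
  show "u \<in> facet_normals P \<Longrightarrow> dual_normal A u \<in> facet_normals ((*v) A ` P)" using * by blast
  show "u \<in> facet_normals_o P \<Longrightarrow> dual_normal A u \<in> facet_normals_o ((*v) A ` P)"
    using * by (auto simp: facet_normals_o_def)
qed

text \<open>The orthogonal prism of height 1 over the facet is mapped to the prism spanned by the
  image facet and \<open>A *v u\<close>, whose height over that facet is \<open>c\<close>. Comparing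
  the two volumes gives the formula.\<close>

lemma facet_volume_linear_image:
  fixes A :: "real ^ 'n ^ 'n"
  assumes P: "compact P" "P \<noteq> {}" and u: "norm u = 1" and v: "norm v = 1"
    and c: "c > 0" and Av: "\<And>y. (A *v y) \<bullet> v = c * (y \<bullet> u)"
  shows "c * facet_volume ((*v) A ` P) v = \<bar>det A\<bar> * facet_volume P u"
proof -
  let ?F = "face_in_direction P u"
  note cF = compact_face_in_direction[OF P(1), of u]
  have uu: "u \<bullet> u = 1" using u by (simp add: norm_eq_1)
  have cAF: "compact ((*v) A ` ?F)"
    by (rule compact_matrix_image[OF cF])
  have "c * facet_volume ((*v) A ` P) v = \<bar>(A *v u) \<bullet> v\<bar> * hyperplane_volume v ((*v) A ` ?F)"
    unfolding facet_volume_def support_face_linear_image[OF P c Av] using c by (simp add: Av uu)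
  also have "\<dots> = measure lebesgue (prism ((*v) A ` ?F) (A *v u))"
    by (rule measure_prism[OF v cAF, where h="c * support_fun P u", symmetric])
       (auto simp: Av face_in_direction_inner)
  also have "prism ((*v) A ` ?F) (A *v u) = (*v) A ` prism ?F u"
    by (rule prism_linear_image) simp
  also have "measure lebesgue \<dots> = \<bar>det A\<bar> * measure lebesgue (prism ?F u)"
    by (subst measure_linear_image_det) (use compact_prism[OF cF, of u] in \<open>auto intro: lmeasurable_compact\<close>)
  also have "measure lebesgue (prism ?F u) = facet_volume P u"
    unfolding facet_volume_def
    by (rule hyperplane_volume_eq_prism[OF u cF face_in_direction_inner, symmetric])
  finally show ?thesis .
qed

lemma bij_betw_dual_normal:
  fixes A :: "real ^ 'n ^ 'n"
  assumes d: "det A \<noteq> 0" and P: "compact P" "P \<noteq> {}"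
  shows "bij_betw (dual_normal A) (facet_normals P) (facet_normals ((*v) A ` P))"
    and "bij_betw (dual_normal A) (facet_normals_o P) (facet_normals_o ((*v) A ` P))"
proof -
  let ?B = "matrix_inv A"
  note dB = matrix_inv_det(5)[OF d]
  have AP: "compact ((*v) A ` P)" "(*v) A ` P \<noteq> {}"
    using P by (auto intro: compact_matrix_image)
  have unit: "norm u = 1" if "u \<in> facet_normals Q \<or> u \<in> facet_normals_o Q" for u Q
    using that by (auto simp: facet_normals_o_def facet_normals_def)
  have inv: "dual_normal ?B (dual_normal A u) = u" "dual_normal A (dual_normal ?B u) = u"
    if "u \<in> facet_normals Q \<or> u \<in> facet_normals_o Q" for u Q
    by (intro dual_normal_inverse matrix_inv_det d unit[OF that])+
  show "bij_betw (dual_normal A) (facet_normals P) (facet_normals ((*v) A ` P))"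
  proof (rule bij_betw_byWitness[where f'="dual_normal ?B"])
    show "dual_normal A ` facet_normals P \<subseteq> facet_normals ((*v) A ` P)"
      using dual_normal_facet(1)[OF d P] by blast
    show "dual_normal ?B ` facet_normals ((*v) A ` P) \<subseteq> facet_normals P"
      using dual_normal_facet(1)[OF dB AP] unfolding image_matrix_inv[OF d] by blast
  qed (use inv in blast)+
  show "bij_betw (dual_normal A) (facet_normals_o P) (facet_normals_o ((*v) A ` P))"
  proof (rule bij_betw_byWitness[where f'="dual_normal ?B"])
    show "dual_normal A ` facet_normals_o P \<subseteq> facet_normals_o ((*v) A ` P)"
      using dual_normal_facet(2)[OF d P] by blast
    show "dual_normal ?B ` facet_normals_o ((*v) A ` P) \<subseteq> facet_normals_o P"
      using dual_normal_facet(2)[OF dB AP] unfolding image_matrix_inv[OF d] by blast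
  qed (use inv in blast)+
qed

text \<open>Numerator and denominator of x . u / h(u) pick up the same factor \<open>c\<close>,
  while in the cone volume this factor cancels against the change of facet volume and leaves the
  determinant. Arbitrary nonzero determinants are allowed because the value on every simplex is to
  be read off from one coordinate simplex.\<close>

lemma Pi_zeta_linear_image:
  fixes A :: "real ^ 'n ^ 'n"
  assumes d: "det A \<noteq> 0" and P: "compact P" "P \<noteq> {}"
  shows "Pi_zeta \<zeta> ((*v) A ` P) (A *v x) = Pi_zeta (\<lambda>t s. \<zeta> t (\<bar>det A\<bar> * s)) P x"
  unfolding Pi_zeta_def sum.reindex_bij_betw[OF bij_betw_dual_normal(2)[OF assms], symmetric]
proof (rule sum.cong)
  fix u assume "u \<in> facet_normals_o P"
  then have u: "norm u = 1" by (auto simp: facet_normals_o_def facet_normals_def)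
  let ?v = "dual_normal A u"
  obtain c where c: "c > 0" "\<And>y. (A *v y) \<bullet> ?v = c * (y \<bullet> u)"
    using dual_normal(2)[OF d u] by auto
  have s: "support_fun ((*v) A ` P) ?v = c * support_fun P u"
    by (rule support_face_linear_image(1)[OF P c])
  have "cone_volume ((*v) A ` P) ?v = 1 / real CARD('n) * support_fun P u * (c * facet_volume ((*v) A ` P) ?v)"
    by (simp add: cone_volume_def s)
  also have "\<dots> = \<bar>det A\<bar> * cone_volume P u"
    unfolding facet_volume_linear_image[OF P u dual_normal(1)[OF d u] c] by (simp add: cone_volume_def)
  finally have cv: "cone_volume ((*v) A ` P) ?v = \<bar>det A\<bar> * cone_volume P u" .
  show "\<zeta> ((A *v x) \<bullet> ?v / support_fun ((*v) A ` P) ?v) (cone_volume ((*v) A ` P) ?v)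
      = \<zeta> (x \<bullet> u / support_fun P u) (\<bar>det A\<bar> * cone_volume P u)"
    unfolding cv s c(2) using c(1) by simp
qed simp

lemma V1_segment_linear_image:
  fixes A :: "real ^ 'n ^ 'n"
  assumes d: "det A \<noteq> 0" and P: "compact P" "P \<noteq> {}"
  shows "V1_segment ((*v) A ` P) (A *v x) = \<bar>det A\<bar> * V1_segment P x"
proof -
  have "\<bar>(A *v x) \<bullet> dual_normal A u\<bar> * facet_volume ((*v) A ` P) (dual_normal A u)
      = \<bar>det A\<bar> * (\<bar>x \<bullet> u\<bar> * facet_volume P u)" if "u \<in> facet_normals P" for u
  proof -
    have u: "norm u = 1" using that by (simp add: facet_normals_def)
    obtain c where c: "c > 0" "\<And>y. (A *v y) \<bullet> dual_normal A u = c * (y \<bullet> u)"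
      using dual_normal(2)[OF d u] by auto
    have "\<bar>(A *v x) \<bullet> dual_normal A u\<bar> * facet_volume ((*v) A ` P) (dual_normal A u)
        = \<bar>x \<bullet> u\<bar> * (c * facet_volume ((*v) A ` P) (dual_normal A u))"
      using c by (simp add: abs_mult)
    then show ?thesis
      unfolding facet_volume_linear_image[OF P u dual_normal(1)[OF d u] c] by simp
  qed
  then show ?thesis
    unfolding V1_segment_def sum.reindex_bij_betw[OF bij_betw_dual_normal(1)[OF assms], symmetric]
    by (simp add: sum_distrib_left)
qed

section \<open>Facet sums as contravariant valuations\<close>

lemma polytopes_oD:
  assumes "P \<in> polytopes_o"
  shows "polytope P" "0 \<in> P" "compact P" "convex P" "P \<noteq> {}"
  using assms by (auto simp: polytopes_o_def polytope_imp_compact polytope_imp_convex)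

text \<open>Additivity forces \<open>g u h 0 = 0\<close>, so the four sums can be taken over one
  common finite set of directions, where the identity is known for each direction.\<close>

lemma facet_functional_valuation:
  fixes g :: "real ^ 'n \<Rightarrow> real \<Rightarrow> real \<Rightarrow> real"
  assumes add: "\<And>u h a b. 0 \<le> a \<Longrightarrow> 0 \<le> b \<Longrightarrow> g u h (a + b) = g u h a + g u h b"
    and PQ: "P \<in> polytopes_o" "Q \<in> polytopes_o" "P \<union> Q \<in> polytopes_o" "P \<inter> Q \<in> polytopes_o"
    and \<Phi>: "\<And>R. R \<in> polytopes_o \<Longrightarrow> \<Phi> R = (\<Sum>u\<in>facet_normals R. g u (support_fun R u) (facet_volume R u))"
  shows "\<Phi> P + \<Phi> Q = \<Phi> (P \<union> Q) + \<Phi> (P \<inter> Q)"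
proof -
  define U where "U = facet_normals P \<union> facet_normals Q \<union> facet_normals (P \<union> Q) \<union> facet_normals (P \<inter> Q)"
  have finU: "finite U" unfolding U_def using PQ by (auto intro!: finite_facet_normals polytopes_oD)
  have unit: "norm u = 1" if "u \<in> U" for u using that by (auto simp: U_def facet_normals_def)
  have g0: "g u h 0 = 0" for u h using add[of 0 0 u h] by simp
  have sumU: "\<Phi> R = (\<Sum>u\<in>U. g u (support_fun R u) (facet_volume R u))"
    if R: "R \<in> polytopes_o" "facet_normals R \<subseteq> U" for R
    unfolding \<Phi>[OF R(1)]
  proof (rule sum.mono_neutral_left[OF finU R(2)], rule ballI)
    fix u assume u: "u \<in> U - facet_normals R"
    have "facet_volume R u = 0"
      using facet_volume_pos_iff[of R u] facet_volume_nonneg[of R u] polytopes_oD[OF R(1)] u unit by force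
    then show "g u (support_fun R u) (facet_volume R u) = 0" by (simp add: g0)
  qed
  have "\<Phi> P + \<Phi> Q = (\<Sum>u\<in>U. g u (support_fun P u) (facet_volume P u) + g u (support_fun Q u) (facet_volume Q u))"
    using sumU[OF PQ(1)] sumU[OF PQ(2)] U_def by (simp add: sum.distrib le_supI1 le_supI2)
  also have "\<dots> = (\<Sum>u\<in>U. g u (support_fun (P \<union> Q) u) (facet_volume (P \<union> Q) u)
      + g u (support_fun (P \<inter> Q) u) (facet_volume (P \<inter> Q) u))"
    by (intro sum.cong refl facet_functional_Un_Int) (use add unit PQ in \<open>auto dest: polytopes_oD\<close>)
  also have "\<dots> = \<Phi> (P \<union> Q) + \<Phi> (P \<inter> Q)"
    using sumU[OF PQ(3)] sumU[OF PQ(4)] U_def by (simp add: sum.distrib le_supI1 le_supI2)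
  finally show ?thesis .
qed

lemma support_fun_nonneg: "P \<in> polytopes_o \<Longrightarrow> 0 \<le> support_fun P u"
  using support_fun_ge[of P 0 u] polytopes_oD[of P] by simp

lemma cone_volume_pos:
  fixes P :: "(real ^ 'n) set"
  assumes P: "P \<in> polytopes_o" and u: "u \<in> facet_normals_o P"
  shows "0 < support_fun P u" "0 < cone_volume P u"
proof -
  have "norm u = 1" "u \<in> facet_normals P" "support_fun P u \<noteq> 0"
    using u by (auto simp: facet_normals_o_def facet_normals_def)
  then have "0 < support_fun P u" "0 < facet_volume P u"
    using support_fun_nonneg[OF P, of u] facet_volume_pos_iff[of P u] polytopes_oD[OF P] by auto
  then show "0 < support_fun P u" "0 < cone_volume P u" by (auto simp: cone_volume_def)
qed

lemma Pi_zeta_valuation: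
  assumes \<zeta>: "\<And>t. cauchy_function (\<zeta> t)"
  shows "valuation_o (Pi_zeta \<zeta> :: (real ^ 'n) set \<Rightarrow> real ^ 'n \<Rightarrow> real)"
  unfolding valuation_o_def
proof (intro allI impI)
  fix P Q :: "(real ^ 'n) set" and x :: "real ^ 'n"
  assume PQ: "P \<in> polytopes_o" "Q \<in> polytopes_o" "P \<union> Q \<in> polytopes_o" "P \<inter> Q \<in> polytopes_o"
  \<comment> \<open>\<zeta> is additive only for positive second arguments, so it is continued by 0.
    The test on \<open>h\<close> discards the facets whose hyperplanes contain the origin, as
    \<open>facet_normals_o\<close> does.\<close>
  define g where "g u h s = (if 0 < h \<and> 0 < s then \<zeta> ((x \<bullet> u) / h) (1 / real CARD('n) * h * s) else 0)"
    for u h s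
  show "Pi_zeta \<zeta> P x + Pi_zeta \<zeta> Q x = Pi_zeta \<zeta> (P \<union> Q) x + Pi_zeta \<zeta> (P \<inter> Q) x"
  proof (rule facet_functional_valuation[OF _ PQ, where g=g])
    fix u and h a b :: real assume ab: "0 \<le> a" "0 \<le> b"
    show "g u h (a + b) = g u h a + g u h b"
    proof (cases "0 < h \<and> 0 < a \<and> 0 < b")
      case True
      then have "\<zeta> ((x \<bullet> u) / h) (1 / real CARD('n) * h * a + 1 / real CARD('n) * h * b)
         = \<zeta> ((x \<bullet> u) / h) (1 / real CARD('n) * h * a) + \<zeta> ((x \<bullet> u) / h) (1 / real CARD('n) * h * b)"
        using \<zeta>[of "(x \<bullet> u) / h"] unfolding cauchy_function_def by auto
      then show ?thesis using True by (simp add: g_def ring_distribs add_divide_distrib)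
    next
      case False
      then show ?thesis using ab by (auto simp: g_def)
    qed
  next
    fix R :: "(real ^ 'n) set" assume R: "R \<in> polytopes_o"
    show "Pi_zeta \<zeta> R x = (\<Sum>u\<in>facet_normals R. g u (support_fun R u) (facet_volume R u))"
      unfolding Pi_zeta_def
    proof (rule sum.mono_neutral_cong_left[OF _ facet_normals_o_subset])
      show "finite (facet_normals R)" by (intro finite_facet_normals polytopes_oD R)
      show "\<forall>u\<in>facet_normals R - facet_normals_o R. g u (support_fun R u) (facet_volume R u) = 0"
        by (auto simp: g_def facet_normals_o_def)
      fix u assume u: "u \<in> facet_normals_o R"
      show "\<zeta> (x \<bullet> u / support_fun R u) (cone_volume R u) = g u (support_fun R u) (facet_volume R u)"
        using cone_volume_pos[OF R u] by (auto simp: g_def cone_volume_def zero_less_mult_iff zero_less_divide_iff)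
    qed
  qed
qed

lemma V1_segment_valuation: "valuation_o (V1_segment :: (real ^ 'n) set \<Rightarrow> real ^ 'n \<Rightarrow> real)"
  unfolding valuation_o_def
proof (intro allI impI)
  fix P Q :: "(real ^ 'n) set" and x :: "real ^ 'n"
  assume PQ: "P \<in> polytopes_o" "Q \<in> polytopes_o" "P \<union> Q \<in> polytopes_o" "P \<inter> Q \<in> polytopes_o"
  show "V1_segment P x + V1_segment Q x = V1_segment (P \<union> Q) x + V1_segment (P \<inter> Q) x"
    by (rule facet_functional_valuation[OF _ PQ, where g="\<lambda>u h s. 1 / real CARD('n) * (\<bar>x \<bullet> u\<bar> * s)"])
       (auto simp: V1_segment_def sum_distrib_left algebra_simps add_divide_distrib)
qed

text \<open>Substituting \<open>A *v x\<close> for \<open>x\<close> removes the inverse matrix; all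
  later uses of contravariance have this form.\<close>

lemma SL_contravariantI:
  fixes Z :: "(real ^ 'n) set \<Rightarrow> real ^ 'n \<Rightarrow> real"
  assumes "\<And>P A x. P \<in> polytopes_o \<Longrightarrow> det A = 1 \<Longrightarrow> x \<noteq> 0 \<Longrightarrow> Z ((*v) A ` P) (A *v x) = Z P x"
  shows "SL_contravariant Z"
  unfolding SL_contravariant_def
proof (intro ballI allI impI)
  fix P :: "(real ^ 'n) set" and A :: "real ^ 'n ^ 'n" and x :: "real ^ 'n"
  assume *: "P \<in> polytopes_o" "det A = 1" "x \<noteq> 0"
  have "matrix_inv A *v x \<noteq> 0"
    using * by (metis matrix_inv_det(4) matrix_vector_mult_0_right one_neq_zero)
  then show "Z ((\<lambda>y. A *v y) ` P) x = Z P (matrix_inv A *v x)"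
    using assms[OF *(1,2), of "matrix_inv A *v x"] *(2) by (simp add: matrix_inv_det)
qed

lemma SL_contravariantD:
  assumes "SL_contravariant Z" "P \<in> polytopes_o" "det A = 1" "x \<noteq> 0"
  shows "Z ((*v) A ` P) (A *v x) = Z P x"
proof -
  have "A *v x \<noteq> 0"
    using assms by (metis matrix_inv_det(3) matrix_vector_mult_0_right one_neq_zero)
  then show ?thesis
    using assms unfolding SL_contravariant_def by (simp add: matrix_inv_det)
qed

lemma V1_segment_contravariant: "SL_contravariant V1_segment"
  by (rule SL_contravariantI) (simp add: V1_segment_linear_image polytopes_oD)

section \<open>The Euler characteristic term\<close>

text \<open>On closed convex cones this is the Euler characteristic with compact supports: (-1)^dim
  for a linear subspace and 0 otherwise. A nonempty convex cone is a subspace exactly when it is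
  symmetric.\<close>

definition euler_cone :: "(real ^ 'n) set \<Rightarrow> real" where
  "euler_cone C = (if \<forall>c\<in>C. - c \<in> C then (-1) ^ nat (aff_dim C) else 0)"

lemma segment_closed_endpoint:
  fixes D :: "(real ^ 'n) set"
  assumes "closed D" "\<And>t. 0 < t \<Longrightarrow> t \<le> 1 \<Longrightarrow> c + t *\<^sub>R v \<in> D"
  shows "c \<in> D"
proof -
  have "((\<lambda>t. c + t *\<^sub>R v) \<longlongrightarrow> c + 0 *\<^sub>R v) (at_right 0)" by (intro tendsto_intros)
  moreover have "\<forall>\<^sub>F t in at_right 0. c + t *\<^sub>R v \<in> D"
    using assms(2) eventually_at_right[of "0::real" 1] by (intro eventually_at_rightI[of 0 1]) auto
  ultimately show ?thesis using Lim_in_closed_set[OF assms(1)] by fastforce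
qed

text \<open>Two cones neither of which contains the other and whose union is a subspace are
  complementary halves of it, meeting in a hyperplane of the subspace. The halves contribute 0, and
  the subspace and the hyperplane contribute opposite signs.\<close>

lemma euler_cone_Un_Int_halves:
  fixes C D :: "(real ^ 'n) set"
  assumes addC: "\<And>x y. x \<in> C \<Longrightarrow> y \<in> C \<Longrightarrow> x + y \<in> C" and addD: "\<And>x y. x \<in> D \<Longrightarrow> y \<in> D \<Longrightarrow> x + y \<in> D"
    and scC: "\<And>c x. 0 \<le> c \<Longrightarrow> x \<in> C \<Longrightarrow> c *\<^sub>R x \<in> C" and scD: "\<And>c x. 0 \<le> c \<Longrightarrow> x \<in> D \<Longrightarrow> c *\<^sub>R x \<in> D"
    and cl: "closed C" "closed D" and conv: "convex C" and L: "subspace (C \<union> D)"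
    and c0: "c0 \<in> C" "c0 \<notin> D" and d0: "d0 \<in> D" "d0 \<notin> C"
  shows "euler_cone C + euler_cone D = euler_cone (C \<union> D) + euler_cone (C \<inter> D)"
proof -
  let ?L = "C \<union> D"
  \<comment> \<open>Strict separation of \<open>d0\<close> from the cone \<open>C\<close>;
    invariance of \<open>C\<close> under dilations improves the bound \<open>b\<close> to 0 on
    \<open>C\<close>.\<close>
  obtain a b where ab: "a \<bullet> d0 < b" "\<And>x. x \<in> C \<Longrightarrow> b < a \<bullet> x"
    using separating_hyperplane_closed_point[OF conv cl(1) d0(2)] by blast
  have zC: "0 \<in> C" using scC[of 0 c0] c0 by simp
  have b0: "b < 0" using ab(2)[OF zC] by simp
  have aC: "a \<bullet> x \<ge> 0" if "x \<in> C" for x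
  proof (rule ccontr)
    assume "\<not> ?thesis"
    then have neg: "a \<bullet> x < 0" by simp
    have "(b / (a \<bullet> x)) *\<^sub>R x \<in> C" using b0 neg by (intro scC that) (simp add: divide_nonpos_neg)
    then have "b < a \<bullet> ((b / (a \<bullet> x)) *\<^sub>R x)" by (rule ab(2))
    then show False using neg by simp
  qed
  have ad0: "a \<bullet> d0 < 0" using ab b0 by simp
  have lin: "x + t *\<^sub>R y \<in> ?L" if "x \<in> ?L" "y \<in> ?L" for x y t
    by (intro subspace_add[OF L] subspace_scale[OF L] that)
  have D1: "x \<in> D" if "x \<in> ?L" "a \<bullet> x \<le> 0" for x
  proof (rule segment_closed_endpoint[OF cl(2), where v=d0])
    fix t :: real assume t: "0 < t" "t \<le> 1"
    have "a \<bullet> (x + t *\<^sub>R d0) < 0" using that(2) ad0 t by (simp add: inner_add_right mult_pos_neg add_nonpos_neg)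
    then show "x + t *\<^sub>R d0 \<in> D" using lin[OF that(1), of d0 t] d0 aC by force
  qed
  \<comment> \<open>If \<open>d\<close> in \<open>D\<close> were on the positive side, a multiple of
    it could be subtracted from \<open>c0\<close> to reach the boundary, which lies in
    \<open>D\<close>; adding the multiple back would place \<open>c0\<close> in
    \<open>D\<close>.\<close>
  have D2: "a \<bullet> d \<le> 0" if d: "d \<in> D" for d
  proof (rule ccontr)
    assume "\<not> ?thesis"
    then have pos: "a \<bullet> d > 0" by simp
    define s where "s = (a \<bullet> c0) / (a \<bullet> d)"
    have s: "s \<ge> 0" using pos aC[OF c0(1)] by (simp add: s_def)
    have "c0 + (- s) *\<^sub>R d \<in> ?L" by (rule lin) (use c0 d in auto)
    moreover have "a \<bullet> (c0 + (- s) *\<^sub>R d) \<le> 0" using pos by (simp add: inner_diff_right s_def)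
    ultimately have "c0 + (- s) *\<^sub>R d \<in> D" by (rule D1)
    from addD[OF this scD[OF s d]] have "(c0 + (- s) *\<^sub>R d) + s *\<^sub>R d \<in> D" .
    then show False using c0 by simp
  qed
  have ac0: "a \<bullet> c0 > 0" using D1[of c0] c0 by force
  have C1: "x \<in> C" if "x \<in> ?L" "a \<bullet> x \<ge> 0" for x
  proof (rule segment_closed_endpoint[OF cl(1), where v=c0])
    fix t :: real assume t: "0 < t" "t \<le> 1"
    have "a \<bullet> (x + t *\<^sub>R c0) > 0" using that(2) ac0 t by (simp add: inner_add_right add_nonneg_pos)
    then show "x + t *\<^sub>R c0 \<in> C" using lin[OF that(1), of c0 t] c0 D2 by force
  qed
  have Int: "C \<inter> D = ?L \<inter> {x. a \<bullet> x = 0}" using C1 D1 aC D2 by force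
  have "- c0 \<notin> C" using aC[of "- c0"] ac0 by auto
  then have eC: "euler_cone C = 0" using c0 by (auto simp: euler_cone_def)
  have "- d0 \<notin> D" using D2[of "- d0"] ad0 by auto
  then have eD: "euler_cone D = 0" using d0 by (auto simp: euler_cone_def)
  have sL: "- x \<in> ?L" if "x \<in> ?L" for x using subspace_neg[OF L that] .
  then have eL: "euler_cone ?L = (-1) ^ nat (aff_dim ?L)" by (auto simp: euler_cone_def)
  have "- x \<in> C \<inter> D" if "x \<in> C \<inter> D" for x using that sL[of x] unfolding Int by auto
  then have eI: "euler_cone (C \<inter> D) = (-1) ^ nat (aff_dim (C \<inter> D))" by (auto simp: euler_cone_def)
  have "aff_dim (C \<inter> D) = aff_dim ?L - 1"
  proof -
    have "?L \<inter> {x. a \<bullet> x = 0} \<noteq> {}" using zC by auto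
    moreover have "\<not> ?L \<subseteq> {x. a \<bullet> x = 0}" using c0 ac0 by auto
    ultimately show ?thesis
      unfolding Int using aff_dim_affine_Int_hyperplane[OF subspace_imp_affine[OF L], of a 0] by simp
  qed
  moreover have "aff_dim (C \<inter> D) \<ge> 0"
  proof -
    have "0 \<in> C \<inter> D" using zC D1[of 0] by auto
    then have "C \<inter> D \<noteq> {}" by blast
    then show ?thesis using aff_dim_negative_iff[of "C \<inter> D"] by linarith
  qed
  ultimately have "nat (aff_dim ?L) = Suc (nat (aff_dim (C \<inter> D)))" by linarith
  then show ?thesis by (simp add: eC eD eL eI)
qed

text \<open>Apart from nested cones there are two cases: either the union is a subspace and the
  cones are halves of it, or none of the four cones is symmetric and all terms vanish.\<close>

lemma euler_cone_Un_Int: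
  fixes C D :: "(real ^ 'n) set"
  assumes addC: "\<And>x y. x \<in> C \<Longrightarrow> y \<in> C \<Longrightarrow> x + y \<in> C" and addD: "\<And>x y. x \<in> D \<Longrightarrow> y \<in> D \<Longrightarrow> x + y \<in> D"
    and scC: "\<And>c x. 0 \<le> c \<Longrightarrow> x \<in> C \<Longrightarrow> c *\<^sub>R x \<in> C" and scD: "\<And>c x. 0 \<le> c \<Longrightarrow> x \<in> D \<Longrightarrow> c *\<^sub>R x \<in> D"
    and cl: "closed C" "closed D" and conv: "convex C" "convex D" "convex (C \<union> D)"
  shows "euler_cone C + euler_cone D = euler_cone (C \<union> D) + euler_cone (C \<inter> D)"
proof (cases "C \<subseteq> D \<or> D \<subseteq> C")
  case True
  then show ?thesis by (auto simp: Un_absorb1 Un_absorb2 Int_absorb1 Int_absorb2)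
next
  case False
  then obtain c0 d0 where c0: "c0 \<in> C" "c0 \<notin> D" and d0: "d0 \<in> D" "d0 \<notin> C" by auto
  have seg: "c + t *\<^sub>R (d - c) \<in> C \<union> D" if "c \<in> C \<union> D" "d \<in> C \<union> D" "0 \<le> t" "t \<le> 1" for c d t
    using convexD_alt[OF conv(3) that] by (simp add: algebra_simps)
  show ?thesis
  proof (cases "\<forall>x \<in> C \<union> D. - x \<in> C \<union> D")
    case True
    have sc: "c *\<^sub>R x \<in> C \<union> D" if "x \<in> C \<union> D" for c x
    proof (cases "c \<ge> 0")
      case False
      then have "(- c) *\<^sub>R (- x) \<in> C \<union> D" using True that scC[of "- c" "- x"] scD[of "- c" "- x"] by auto
      then show ?thesis by simp
    qed (use that scC scD in auto)
    have "subspace (C \<union> D)"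
      unfolding subspace_def
    proof (intro conjI ballI allI)
      show "0 \<in> C \<union> D" using sc[of c0 0] c0 by auto
      show "x + y \<in> C \<union> D" if "x \<in> C \<union> D" "y \<in> C \<union> D" for x y
      proof -
        have "2 *\<^sub>R (x + (1/2) *\<^sub>R (y - x)) \<in> C \<union> D" by (intro sc seg that) auto
        moreover have "2 *\<^sub>R (x + (1/2) *\<^sub>R (y - x)) = x + y" by (simp add: scaleR_add_right scaleR_2)
        ultimately show ?thesis by simp
      qed
    qed (rule sc)
    then show ?thesis
      by (intro euler_cone_Un_Int_halves[of C D c0 d0]) (use assms c0 d0 in auto)
  next
    case nsym: False
    \<comment> \<open>If \<open>C'\<close> were symmetric, a point of the segment from
      \<open>c\<close> to \<open>d\<close>, other than \<open>c\<close>, could not lie in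
      \<open>C'\<close>, since removing its \<open>c\<close>-part would leave a positive multiple of
      \<open>d\<close> in \<open>C'\<close>. So these points lie in the closed set
      \<open>D'\<close>, and with them \<open>c\<close>.\<close>
    have nC: "\<exists>x\<in>C'. - x \<notin> C'"
      if add: "\<And>x y. x \<in> C' \<Longrightarrow> y \<in> C' \<Longrightarrow> x + y \<in> C'" and sc: "\<And>c x. 0 \<le> c \<Longrightarrow> x \<in> C' \<Longrightarrow> c *\<^sub>R x \<in> C'"
        and CD: "C' \<union> D' = C \<union> D" and cl: "closed D'" and c: "c \<in> C'" "c \<notin> D'" and d: "d \<in> D'" "d \<notin> C'" for C' D' c d
    proof (rule ccontr)
      assume "\<not> ?thesis"
      then have sym: "- x \<in> C'" if "x \<in> C'" for x using that by auto
      have "c \<in> D'"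
      proof (rule segment_closed_endpoint[OF cl, where v="d - c"], rule ccontr)
        fix t :: real assume t: "0 < t" "t \<le> 1" and "c + t *\<^sub>R (d - c) \<notin> D'"
        then have "c + t *\<^sub>R (d - c) \<in> C'" using seg[of c d t] c d CD by auto
        moreover have "(1 - t) *\<^sub>R (- c) \<in> C'" using t by (intro sc sym c) auto
        ultimately have "(c + t *\<^sub>R (d - c)) + (1 - t) *\<^sub>R (- c) \<in> C'" by (rule add)
        then have "(1 / t) *\<^sub>R ((c + t *\<^sub>R (d - c)) + (1 - t) *\<^sub>R (- c)) \<in> C'"
          using t by (intro sc) auto
        also have "(c + t *\<^sub>R (d - c)) + (1 - t) *\<^sub>R (- c) = t *\<^sub>R d" by (simp add: algebra_simps)
        finally show False using t d by simp
      qed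
      with c show False by simp
    qed
    have eC: "euler_cone C = 0"
      using nC[of C D c0 d0, OF addC scC _ cl(2) c0 d0] by (auto simp: euler_cone_def)
    have eD: "euler_cone D = 0"
      using nC[of D C d0 c0, OF addD scD _ cl(1) d0 c0] by (auto simp: euler_cone_def)
    have "\<exists>x\<in>C \<inter> D. - x \<notin> C \<inter> D"
    proof (rule ccontr)
      assume "\<not> ?thesis"
      then have symI: "- x \<in> C \<and> - x \<in> D" if "x \<in> C" "x \<in> D" for x using that by auto
      \<comment> \<open>A segment from \<open>c\<close> to \<open>d\<close> meets the intersection
        in some \<open>z\<close>. With the negative of \<open>z\<close> in both cones, the negatives
        of \<open>c\<close> and \<open>d\<close> can be combined, and the union would be
        symmetric.\<close>
      have opp: "- c \<in> D \<and> - d \<in> C" if c: "c \<in> C" "c \<notin> D" and d: "d \<in> D" "d \<notin> C" for c d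
      proof -
        have "connected (closed_segment c d)" by auto
        moreover have "closed_segment c d \<subseteq> C \<union> D"
          using conv(3) c d by (auto simp: closed_segment_subset)
        moreover have "c \<in> closed_segment c d" "d \<in> closed_segment c d" by auto
        ultimately have "C \<inter> D \<inter> closed_segment c d \<noteq> {}"
          using cl c d connected_closedD[of "closed_segment c d" C D] by blast
        then obtain z where z: "z \<in> closed_segment c d" "z \<in> C" "z \<in> D" by auto
        then obtain t where t: "0 \<le> t" "t \<le> 1" "z = (1 - t) *\<^sub>R c + t *\<^sub>R d"
          by (auto simp: closed_segment_def)
        have t0: "t \<noteq> 0" "t \<noteq> 1" using t z c d by auto
        have "t *\<^sub>R d + - z \<in> D" using symI[OF z(2,3)] t(1) by (intro addD scD d) auto
        then have "(1 / (1 - t)) *\<^sub>R (t *\<^sub>R d + - z) \<in> D" using t by (intro scD) auto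
        moreover have "t *\<^sub>R d + - z = (1 - t) *\<^sub>R (- c)" using t(3) by (simp add: algebra_simps)
        ultimately have 1: "- c \<in> D" using t0 by simp
        have "(1 - t) *\<^sub>R c + - z \<in> C"
          using symI[OF z(2,3)] t(2) scC[OF _ c(1), of "1 - t"] by (intro addC) auto
        then have "(1 / t) *\<^sub>R ((1 - t) *\<^sub>R c + - z) \<in> C" using t by (intro scC) auto
        moreover have "(1 - t) *\<^sub>R c + - z = t *\<^sub>R (- d)" using t(3) by (simp add: algebra_simps)
        ultimately show ?thesis using t0 1 by simp
      qed
      have "- x \<in> C \<union> D" if "x \<in> C \<union> D" for x
        using that opp[of x d0] opp[of c0 x] c0 d0 symI[of x] by blast
      with nsym show False by blast
    qed
    then have eI: "euler_cone (C \<inter> D) = 0" by (auto simp: euler_cone_def)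
    show ?thesis using eC eD eI nsym by (auto simp: euler_cone_def)
  qed
qed

definition euler_term :: "(real ^ 'n) set \<Rightarrow> real" where
  "euler_term P = (-1) ^ nat (aff_dim P) * V0 ({0} \<inter> rel_interior P)"

text \<open>The origin is in the relative interior exactly when the cone generated by the polytope
  is a subspace. Passing to cones makes the valuation property a statement about pairs of closed
  convex cones.\<close>

lemma euler_term_eq_cone:
  assumes P: "P \<in> polytopes_o"
  shows "euler_term P = euler_cone (conic hull P)"
proof -
  note p = polytopes_oD[OF P]
  have "aff_dim P = aff_dim (conic hull P)"
  proof -
    have "span (conic hull P) = span P"
    proof (rule span_eq[THEN iffD2], intro conjI)
      show "conic hull P \<subseteq> span P" by (auto simp: conic_hull_explicit intro: span_scale span_base)
      show "P \<subseteq> span (conic hull P)" using hull_subset[of P conic] span_superset by blast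
    qed
    then have "dim (conic hull P) = dim P" by (metis dim_span)
    moreover have "0 \<in> conic hull P" using p(2) by (rule hull_inc)
    ultimately show ?thesis using p(2) by (simp add: aff_dim_zero hull_inc)
  qed
  moreover have "0 \<in> rel_interior P \<longleftrightarrow> (\<forall>c\<in>conic hull P. - c \<in> conic hull P)"
  proof
    assume r: "0 \<in> rel_interior P"
    show "\<forall>c\<in>conic hull P. - c \<in> conic hull P"
    proof
      fix c assume "c \<in> conic hull P"
      then obtain s x where c: "c = s *\<^sub>R x" "0 \<le> s" "x \<in> P" by (auto simp: conic_hull_explicit)
      obtain e where e: "e > 1" "(1 - e) *\<^sub>R x \<in> P"
        using r c(3) convex_rel_interior_iff[OF p(4,5), of 0] by auto
      have "(s / (e - 1)) * (1 - e) = - s" using e(1) by (simp add: field_simps)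
      then have "- c = (s / (e - 1)) *\<^sub>R ((1 - e) *\<^sub>R x)" by (simp add: c)
      then show "- c \<in> conic hull P" unfolding conic_hull_explicit using e c
        by (intro CollectI exI[of _ "s / (e - 1)"] exI[of _ "(1 - e) *\<^sub>R x"]) auto
    qed
  next
    assume s: "\<forall>c\<in>conic hull P. - c \<in> conic hull P"
    show "0 \<in> rel_interior P"
      unfolding convex_rel_interior_iff[OF p(4,5)]
    proof
      fix x assume x: "x \<in> P"
      then have "- x \<in> conic hull P" using s by (simp add: hull_inc)
      then obtain k y where y: "- x = k *\<^sub>R y" "0 \<le> k" "y \<in> P" by (auto simp: conic_hull_explicit)
      \<comment> \<open>With this choice the multiple \<open>r * k\<close> of \<open>y\<close> lies
        between 0 and \<open>y\<close>, and it equals \<open>r\<close> times the negative of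
        \<open>x\<close>: a step past the origin.\<close>
      define r where "r = 1 / (k + 1)"
      have r: "0 < r" "r * k \<le> 1" "0 \<le> r * k" using y by (auto simp: r_def field_simps)
      have "(1 - r * k) *\<^sub>R 0 + (r * k) *\<^sub>R y \<in> P"
        using convexD_alt[OF p(4) p(2) y(3), of "r * k"] r by simp
      also have "(1 - r * k) *\<^sub>R 0 + (r * k) *\<^sub>R y = (1 - (1 + r)) *\<^sub>R x + (1 + r) *\<^sub>R 0"
      proof -
        have "(r * k) *\<^sub>R y = r *\<^sub>R (- x)" unfolding y(1) by simp
        then show ?thesis by (simp add: algebra_simps)
      qed
      finally show "\<exists>e>1. (1 - e) *\<^sub>R x + e *\<^sub>R 0 \<in> P" using r by (intro exI[of _ "1 + r"]) auto
    qed
  qed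
  ultimately show ?thesis by (auto simp: euler_term_def euler_cone_def V0_def)
qed

text \<open>A point reached in both cones with different factors is shrunk by their common bound
  \<open>m\<close>; convexity and the origin then put it in both sets at once.\<close>

lemma conic_hull_Int_convex:
  fixes P Q :: "(real ^ 'n) set"
  assumes P: "convex P" "0 \<in> P" and Q: "convex Q" "0 \<in> Q"
  shows "conic hull (P \<inter> Q) = conic hull P \<inter> conic hull Q"
proof (intro equalityI subsetI)
  fix x assume "x \<in> conic hull P \<inter> conic hull Q"
  then obtain a p b q where x: "x = a *\<^sub>R p" "x = b *\<^sub>R q" "0 \<le> a" "0 \<le> b" "p \<in> P" "q \<in> Q"
    unfolding conic_hull_explicit by blast
  define m where "m = max (max a b) 1"
  have m: "0 < m" "a / m \<le> 1" "b / m \<le> 1" by (auto simp: m_def)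
  have "(1 - a / m) *\<^sub>R 0 + (a / m) *\<^sub>R p \<in> P"
    by (rule convexD_alt[OF P x(5)]) (use m x in auto)
  moreover have "(1 - b / m) *\<^sub>R 0 + (b / m) *\<^sub>R q \<in> Q"
    by (rule convexD_alt[OF Q x(6)]) (use m x in auto)
  moreover have "(a / m) *\<^sub>R p = (1 / m) *\<^sub>R x" "(b / m) *\<^sub>R q = (1 / m) *\<^sub>R x"
    by (simp add: x(1)) (simp add: x(2))
  ultimately have "(1 / m) *\<^sub>R x \<in> P \<inter> Q" by simp
  moreover have "x = m *\<^sub>R ((1 / m) *\<^sub>R x)" using m by simp
  ultimately show "x \<in> conic hull (P \<inter> Q)" unfolding conic_hull_explicit using m(1)
    by (intro CollectI exI[of _ m] exI[of _ "(1 / m) *\<^sub>R x"]) auto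
qed (auto simp: conic_hull_explicit)

lemma euler_term_Un_Int:
  assumes PQ: "P \<in> polytopes_o" "Q \<in> polytopes_o" "P \<union> Q \<in> polytopes_o" "P \<inter> Q \<in> polytopes_o"
  shows "euler_term P + euler_term Q = euler_term (P \<union> Q) + euler_term (P \<inter> Q)"
proof -
  have un: "conic hull (P \<union> Q) = conic hull P \<union> conic hull Q" by (auto simp: conic_hull_explicit)
  have int: "conic hull (P \<inter> Q) = conic hull P \<inter> conic hull Q"
    using PQ by (intro conic_hull_Int_convex polytopes_oD)
  have sc: "c *\<^sub>R x \<in> conic hull R" if "0 \<le> c" "x \<in> conic hull R" for c x and R :: "(real ^ 'a) set"
    using that conic_conic_hull[of R] by (auto simp: conic_def)
  have conv: "convex (conic hull R)" if "R \<in> polytopes_o" for R :: "(real ^ 'a) set"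
    using that by (intro convex_conic_hull polytopes_oD)
  have add: "x + y \<in> conic hull R" if "x \<in> conic hull R" "y \<in> conic hull R" "R \<in> polytopes_o" for x y and R :: "(real ^ 'a) set"
  proof -
    have "2 *\<^sub>R ((1 - 1/2) *\<^sub>R x + (1/2) *\<^sub>R y) \<in> conic hull R"
      by (intro sc convexD_alt[OF conv] that) auto
    then show ?thesis by (simp add: algebra_simps)
  qed
  have cl: "closed (conic hull R)" if "R \<in> polytopes_o" for R :: "(real ^ 'a) set"
    using that by (intro polyhedron_imp_closed polyhedron_conic_hull_polytope polytopes_oD)
  show ?thesis
    unfolding euler_term_eq_cone[OF PQ(1)] euler_term_eq_cone[OF PQ(2)] euler_term_eq_cone[OF PQ(3)]
      euler_term_eq_cone[OF PQ(4)] un int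
    by (rule euler_cone_Un_Int) (use PQ add sc cl conv[OF PQ(1)] conv[OF PQ(2)] conv[OF PQ(3)] un in auto)
qed

lemma euler_term_matrix_image:
  fixes A :: "real ^ 'n ^ 'n"
  assumes d: "det A \<noteq> 0"
  shows "euler_term ((*v) A ` P) = euler_term P"
proof -
  have "rel_interior ((*v) A ` P) = (*v) A ` rel_interior P"
    by (intro rel_interior_injective_linear_image inj_matrix_det[OF d] matrix_vector_mul_bounded_linear)
  moreover have "0 \<in> (*v) A ` R \<longleftrightarrow> 0 \<in> R" for R
    using inj_matrix_det[OF d] by (metis image_iff inj_image_mem_iff matrix_vector_mult_0_right)
  ultimately show ?thesis by (simp add: euler_term_def aff_dim_matrix_image[OF d] V0_def)
qed

section \<open>Valuations vanishing on simplices\<close>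

text \<open>On each ray from \<open>v\<close> through a point of \<open>Q\<close> other than
  \<open>v\<close>, \<open>Q\<close> agrees with \<open>P\<close>. Cutting with half-spaces bounded
  by hyperplanes through \<open>v\<close> preserves this.\<close>

definition radial_in :: "'a::real_vector \<Rightarrow> 'a set \<Rightarrow> 'a set \<Rightarrow> bool" where
  "radial_in v P Q \<longleftrightarrow> (\<forall>x\<in>Q. \<forall>\<tau>\<ge>0. v + \<tau> *\<^sub>R (x - v) \<in> P \<longrightarrow> v + \<tau> *\<^sub>R (x - v) \<in> Q)"

text \<open>For \<open>N\<close> consisting of differences of functionals, a constant sign on
  \<open>Q\<close> means that these functionals are linearly ordered there.\<close>

definition sorted_by :: "'a::real_inner \<Rightarrow> 'a set \<Rightarrow> 'a set \<Rightarrow> bool" where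
  "sorted_by v N Q \<longleftrightarrow> (\<forall>a\<in>N. (\<forall>x\<in>Q. a \<bullet> (x - v) \<le> 0) \<or> (\<forall>x\<in>Q. a \<bullet> (x - v) \<ge> 0))"

text \<open>A hyperplane through \<open>v\<close> produces two halves and a common section, all
  three sorted by one more functional. If \<mu> vanishes on these three pieces, it vanishes on
  \<open>Q\<close>.\<close>

lemma valuation_zero_by_cuts:
  fixes \<mu> :: "'a::euclidean_space set \<Rightarrow> real"
  assumes val: "\<And>P Q. polytope P \<Longrightarrow> polytope Q \<Longrightarrow> polytope (P \<union> Q) \<Longrightarrow> v \<in> P \<Longrightarrow> v \<in> Q \<Longrightarrow> P \<union> Q \<subseteq> P0
      \<Longrightarrow> \<mu> P + \<mu> Q = \<mu> (P \<union> Q) + \<mu> (P \<inter> Q)"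
    and N: "finite N"
    and Q: "polytope Q" "v \<in> Q" "Q \<subseteq> P0" "radial_in v P0 Q"
    and base: "\<And>Q'. polytope Q' \<Longrightarrow> v \<in> Q' \<Longrightarrow> Q' \<subseteq> Q \<Longrightarrow> radial_in v P0 Q' \<Longrightarrow> sorted_by v N Q' \<Longrightarrow> \<mu> Q' = 0"
  shows "\<mu> Q = 0"
  using N Q base
proof (induction N arbitrary: Q rule: finite_induct)
  case empty
  then show ?case by (auto simp: sorted_by_def)
next
  case (insert a N)
  define Hle where "Hle = {x. a \<bullet> x \<le> a \<bullet> v}"
  define Hge where "Hge = {x. a \<bullet> x \<ge> a \<bullet> v}"
  have hz: "\<mu> (Q \<inter> H) = 0" if H: "H = Hle \<or> H = Hge \<or> H = Hle \<inter> Hge" for H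
  proof (rule insert.IH)
    have "polyhedron H" using H by (auto simp: Hle_def Hge_def polyhedron_halfspace_le polyhedron_halfspace_ge)
    then show "polytope (Q \<inter> H)" by (rule polytope_Int_polyhedron[OF insert.prems(1)])
    show "v \<in> Q \<inter> H" using H insert.prems by (auto simp: Hle_def Hge_def)
    show "Q \<inter> H \<subseteq> P0" using insert.prems by auto
    have "v + \<tau> *\<^sub>R (x - v) \<in> H" if "x \<in> H" "\<tau> \<ge> 0" for x \<tau>
    proof -
      have e: "a \<bullet> (v + \<tau> *\<^sub>R (x - v)) = a \<bullet> v + \<tau> * (a \<bullet> x - a \<bullet> v)"
        by (simp add: inner_add_right inner_diff_right)
      show ?thesis using H that by (auto simp: Hle_def Hge_def e mult_nonneg_nonpos)
    qed
    then show "radial_in v P0 (Q \<inter> H)"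
      using insert.prems(4) by (auto simp: radial_in_def)
    fix Q' assume Q': "polytope Q'" "v \<in> Q'" "Q' \<subseteq> Q \<inter> H" "radial_in v P0 Q'" "sorted_by v N Q'"
    have "sorted_by v (insert a N) Q'"
      using Q'(3,5) H by (auto simp: sorted_by_def Hle_def Hge_def inner_diff_right)
    then show "\<mu> Q' = 0" using Q' insert.prems(5)[of Q'] by auto
  qed
  have cov: "Q \<inter> Hle \<union> Q \<inter> Hge = Q" "(Q \<inter> Hle) \<inter> (Q \<inter> Hge) = Q \<inter> (Hle \<inter> Hge)"
    by (auto simp: Hle_def Hge_def)
  have "polytope (Q \<inter> Hle)" "polytope (Q \<inter> Hge)"
    by (auto intro!: polytope_Int_polyhedron[OF insert.prems(1)] simp: Hle_def Hge_def polyhedron_halfspace_le polyhedron_halfspace_ge)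
  moreover have "v \<in> Q \<inter> Hle" "v \<in> Q \<inter> Hge" using insert.prems by (auto simp: Hle_def Hge_def)
  ultimately have "\<mu> (Q \<inter> Hle) + \<mu> (Q \<inter> Hge) = \<mu> Q + \<mu> (Q \<inter> (Hle \<inter> Hge))"
    using val[of "Q \<inter> Hle" "Q \<inter> Hge"] insert.prems unfolding cov by auto
  then show ?case using hz by simp
qed

text \<open>As \<open>v\<close> satisfies all inequalities, their right-hand sides relative to
  \<open>v\<close> are nonnegative and can be scaled to 1, or are 0 when the bounding hyperplane
  contains \<open>v\<close>.\<close>

lemma polyhedron_normal_form:
  fixes P :: "'a::euclidean_space set"
  assumes "polyhedron P" "v \<in> P"
  obtains M M0 where "finite M" "finite M0"
    "P = {x. (\<forall>m\<in>M. m \<bullet> (x - v) \<le> 1) \<and> (\<forall>m\<in>M0. m \<bullet> (x - v) \<le> 0)}"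
proof -
  obtain F where F: "finite F" "P = \<Inter>F" "\<forall>h\<in>F. \<exists>a b. a \<noteq> 0 \<and> h = {x. a \<bullet> x \<le> b}"
    using assms(1) unfolding polyhedron_def by auto
  then obtain a b where ab: "\<And>h. h \<in> F \<Longrightarrow> h = {x. a h \<bullet> x \<le> b h}" by metis
  define \<beta> where "\<beta> h = b h - a h \<bullet> v" for h
  have mem: "x \<in> h \<longleftrightarrow> a h \<bullet> (x - v) \<le> \<beta> h" if "h \<in> F" for x h
    using ab[OF that] by (auto simp: \<beta>_def inner_diff_right)
  have \<beta>0: "\<beta> h \<ge> 0" if "h \<in> F" for h using mem[OF that, of v] assms(2) F(2) that by auto
  define M where "M = (\<lambda>h. (1 / \<beta> h) *\<^sub>R a h) ` {h\<in>F. \<beta> h > 0}"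
  define M0 where "M0 = a ` {h\<in>F. \<beta> h = 0}"
  have "x \<in> P \<longleftrightarrow> (\<forall>m\<in>M. m \<bullet> (x - v) \<le> 1) \<and> (\<forall>m\<in>M0. m \<bullet> (x - v) \<le> 0)" for x
  proof -
    have "x \<in> P \<longleftrightarrow> (\<forall>h\<in>F. a h \<bullet> (x - v) \<le> \<beta> h)" using mem F(2) by auto
    also have "\<dots> \<longleftrightarrow> (\<forall>h\<in>{h\<in>F. \<beta> h > 0}. a h \<bullet> (x - v) \<le> \<beta> h) \<and> (\<forall>h\<in>{h\<in>F. \<beta> h = 0}. a h \<bullet> (x - v) \<le> \<beta> h)"
      using \<beta>0 by force
    also have "\<dots> \<longleftrightarrow> (\<forall>m\<in>M. m \<bullet> (x - v) \<le> 1) \<and> (\<forall>m\<in>M0. m \<bullet> (x - v) \<le> 0)"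
      unfolding M_def M0_def by (auto simp: divide_le_eq)
    finally show ?thesis .
  qed
  moreover have "finite M" "finite M0" using F(1) by (auto simp: M_def M0_def)
  ultimately show ?thesis using that[of M M0] by blast
qed

text \<open>Cutting along the hyperplanes through \<open>v\<close> on which two of the normalised facet functionals
  agree leaves pieces that see a single facet from \<open>v\<close>, that is, pyramids with apex \<open>v\<close>.\<close>

lemma valuation_zero_by_pyramids:
  fixes \<mu> :: "'a::euclidean_space set \<Rightarrow> real"
  assumes val: "\<And>P Q. polytope P \<Longrightarrow> polytope Q \<Longrightarrow> polytope (P \<union> Q) \<Longrightarrow> v \<in> P \<Longrightarrow> v \<in> Q \<Longrightarrow> P \<union> Q \<subseteq> P0
      \<Longrightarrow> \<mu> P + \<mu> Q = \<mu> (P \<union> Q) + \<mu> (P \<inter> Q)"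
    and P0: "polytope P0" "v \<in> P0" and v: "\<mu> {v} = 0"
    and pyr: "\<And>a F. polytope F \<Longrightarrow> F \<subseteq> P0 \<Longrightarrow> (\<And>x. x \<in> F \<Longrightarrow> a \<bullet> (x - v) = 1)
      \<Longrightarrow> \<mu> (convex hull (insert v F)) = 0"
  shows "\<mu> P0 = 0"
proof -
  obtain M M0 where M: "finite M" "finite M0"
    and P0eq: "P0 = {x. (\<forall>m\<in>M. m \<bullet> (x - v) \<le> 1) \<and> (\<forall>m\<in>M0. m \<bullet> (x - v) \<le> 0)}"
    by (rule polyhedron_normal_form[OF polytope_imp_polyhedron[OF P0(1)] P0(2)])
  define N where "N = (\<lambda>(m, m'). m - m') ` (M \<times> M)"
  \<comment> \<open>Otherwise the whole ray from \<open>v\<close> through \<open>x\<close> would lie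
    in the bounded set \<open>P0\<close>.\<close>
  have unb: "\<exists>m\<in>M. m \<bullet> (x - v) > 0" if x: "x \<in> P0" "x \<noteq> v" for x
  proof (rule ccontr)
    assume "\<not> ?thesis"
    then have neg: "m \<bullet> (x - v) \<le> 0" if "m \<in> M" for m using that by force
    have ray: "v + \<tau> *\<^sub>R (x - v) \<in> P0" if "\<tau> \<ge> 0" for \<tau>
    proof -
      have "\<tau> * (m \<bullet> (x - v)) \<le> 1" if "m \<in> M" for m
        using mult_nonneg_nonpos[OF \<open>\<tau> \<ge> 0\<close> neg[OF that]] by simp
      moreover have "\<tau> * (m \<bullet> (x - v)) \<le> 0" if "m \<in> M0" for m
        using that x(1) \<open>\<tau> \<ge> 0\<close> unfolding P0eq by (intro mult_nonneg_nonpos) auto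
      ultimately show ?thesis unfolding P0eq by simp
    qed
    obtain B where B: "\<And>y. y \<in> P0 \<Longrightarrow> norm y \<le> B"
      using polytope_imp_bounded[OF P0(1)] unfolding bounded_iff by blast
    have B0: "B \<ge> 0" using B[OF P0(2)] norm_ge_zero order_trans by blast
    define \<tau> where "\<tau> = (B + norm v + 1) / norm (x - v)"
    have "norm (\<tau> *\<^sub>R (x - v)) = B + norm v + 1"
      using x(2) B0 by (simp add: \<tau>_def add_nonneg_nonneg)
    moreover have "norm (\<tau> *\<^sub>R (x - v)) \<le> norm (v + \<tau> *\<^sub>R (x - v)) + norm v"
      by (metis add_diff_cancel_left' norm_triangle_ineq4)
    moreover have "norm (v + \<tau> *\<^sub>R (x - v)) \<le> B" using B0 by (intro B ray) (simp add: \<tau>_def)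
    ultimately show False by simp
  qed
  show ?thesis
  proof (rule valuation_zero_by_cuts[OF val, where N=N])
    show "finite N" using M by (auto simp: N_def)
    show "radial_in v P0 P0" by (auto simp: radial_in_def)
    fix Q assume Q: "polytope Q" "v \<in> Q" "Q \<subseteq> P0" "radial_in v P0 Q" "sorted_by v N Q"
    show "\<mu> Q = 0"
    proof (cases "Q = {v}")
      case False
      then obtain x0 where x0: "x0 \<in> Q" "x0 \<noteq> v" using Q(2) by blast
      have Mne: "M \<noteq> {}" using unb[of x0] x0 Q(3) by auto
      have tot: "(\<forall>x\<in>Q. m \<bullet> (x - v) \<le> m' \<bullet> (x - v)) \<or> (\<forall>x\<in>Q. m' \<bullet> (x - v) \<le> m \<bullet> (x - v))"
        if "m \<in> M" "m' \<in> M" for m m'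
      proof -
        have "m - m' \<in> N" using that unfolding N_def by (intro image_eqI[of _ _ "(m, m')"]) auto
        then have "(\<forall>x\<in>Q. (m - m') \<bullet> (x - v) \<le> 0) \<or> (\<forall>x\<in>Q. (m - m') \<bullet> (x - v) \<ge> 0)"
          using Q(5) unfolding sorted_by_def by blast
        then show ?thesis by (simp add: inner_diff_left[of m m'])
      qed
      \<comment> \<open>On a sorted piece any two functionals of \<open>M\<close> are comparable, so
        one of them dominates; its level 1 is the only facet seen from \<open>v\<close>.\<close>
      have "\<exists>m\<in>M'. \<forall>m'\<in>M'. \<forall>x\<in>Q. m' \<bullet> (x - v) \<le> m \<bullet> (x - v)" if "finite M'" "M' \<noteq> {}" "M' \<subseteq> M" for M'
        using that
      proof (induction rule: finite_ne_induct)
        case (insert k K)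
        then obtain m where m: "m \<in> K" "\<forall>m'\<in>K. \<forall>x\<in>Q. m' \<bullet> (x - v) \<le> m \<bullet> (x - v)" by auto
        have "k \<in> M" "m \<in> M" using insert.prems m by auto
        from tot[OF this] show ?case
        proof
          assume "\<forall>x\<in>Q. k \<bullet> (x - v) \<le> m \<bullet> (x - v)"
          then show ?thesis using m by (intro bexI[of _ m]) auto
        next
          assume mk: "\<forall>x\<in>Q. m \<bullet> (x - v) \<le> k \<bullet> (x - v)"
          have "m' \<bullet> (x - v) \<le> k \<bullet> (x - v)" if "m' \<in> K" "x \<in> Q" for m' x
            by (rule order_trans[of _ "m \<bullet> (x - v)"]) (use m(2) mk that in blast)+
          then show ?thesis by (intro bexI[of _ k]) auto
        qed
      qed auto
      from this[OF M(1) Mne order_refl] obtain m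
        where m: "m \<in> M" "\<And>m' x. m' \<in> M \<Longrightarrow> x \<in> Q \<Longrightarrow> m' \<bullet> (x - v) \<le> m \<bullet> (x - v)" by blast
      define F where "F = Q \<inter> {x. m \<bullet> x = m \<bullet> v + 1}"
      have Fm: "m \<bullet> (x - v) = 1" if "x \<in> F" for x using that by (auto simp: F_def inner_diff_right)
      have "polytope F" unfolding F_def by (rule polytope_Int_polyhedron[OF Q(1) polyhedron_hyperplane])
      moreover have "F \<subseteq> P0" using Q(3) by (auto simp: F_def)
      moreover have "Q = convex hull (insert v F)"
      proof (intro equalityI subsetI)
        fix x assume x: "x \<in> Q"
        show "x \<in> convex hull (insert v F)"
        proof (cases "x = v")
          case False
          define t where "t = m \<bullet> (x - v)"
          have xP: "x \<in> P0" using x Q(3) by auto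
          obtain m' where "m' \<in> M" "m' \<bullet> (x - v) > 0" using unb[OF xP False] by auto
          then have t0: "t > 0" using m(2)[of m' x] x by (auto simp: t_def)
          have t1: "t \<le> 1" using xP m(1) by (auto simp: P0eq t_def)
          \<comment> \<open>The radial projection of \<open>x\<close> from \<open>v\<close> to the
            level 1 of the dominating functional; it stays in \<open>P0\<close> because no other
            functional exceeds 1 there.\<close>
          define y where "y = v + (1 / t) *\<^sub>R (x - v)"
          have "m' \<bullet> (y - v) \<le> 1" if "m' \<in> M" for m'
            using m(2)[OF that x] t0 by (simp add: y_def t_def[symmetric] divide_le_eq)
          moreover have "m' \<bullet> (y - v) \<le> 0" if "m' \<in> M0" for m'
          proof -
            have "m' \<bullet> (x - v) \<le> 0" using xP that by (auto simp: P0eq)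
            then show ?thesis using t0 by (simp add: y_def divide_nonpos_pos)
          qed
          ultimately have "y \<in> P0" by (auto simp: P0eq)
          then have "y \<in> Q" using Q(4) x t0 unfolding radial_in_def y_def by auto
          moreover have "m \<bullet> (y - v) = 1" using t0 by (simp add: y_def t_def[symmetric])
          ultimately have "y \<in> F" by (simp add: F_def inner_diff_right)
          moreover have "x = (1 - t) *\<^sub>R v + t *\<^sub>R y" using t0 by (simp add: y_def algebra_simps)
          ultimately show ?thesis
            using convexD_alt[OF convex_convex_hull, of v "insert v F" y t] t0 t1 by (simp add: hull_inc)
        qed (simp add: hull_inc)
      next
        fix x assume "x \<in> convex hull (insert v F)"
        moreover have "convex hull (insert v F) \<subseteq> Q"
          by (rule hull_minimal) (use Q in \<open>auto simp: F_def polytope_imp_convex\<close>)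
        ultimately show "x \<in> Q" by auto
      qed
      ultimately show ?thesis using pyr[of F m] Fm by simp
    qed (simp add: v)
  qed (use P0 in auto)
qed

section \<open>Pyramids and the induction on the dimension\<close>

definition pyramid :: "'a::real_vector \<Rightarrow> 'a set \<Rightarrow> 'a set" where
  "pyramid v G = convex hull (insert v G)"

lemma pyramid_explicit:
  assumes "convex G"
  shows "pyramid v G = insert v {v + t *\<^sub>R (y - v) | t y. 0 \<le> t \<and> t \<le> 1 \<and> y \<in> G}"
proof (cases "G = {}")
  case False
  show ?thesis
    unfolding pyramid_def convex_hull_insert[OF False] convex_hull_eq[THEN iffD2, OF assms]
  proof (intro equalityI subsetI)
    fix x assume "x \<in> {x. \<exists>u\<ge>0. \<exists>w\<ge>0. \<exists>b. u + w = 1 \<and> b \<in> G \<and> x = u *\<^sub>R v + w *\<^sub>R b}"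
    then obtain u w b where x: "u \<ge> 0" "w \<ge> 0" "u + w = 1" "b \<in> G" "x = u *\<^sub>R v + w *\<^sub>R b" by blast
    have u: "u = 1 - w" using x(3) by simp
    have "x = v + w *\<^sub>R (b - v)" unfolding x(5) u by (simp add: scaleR_left_diff_distrib scaleR_right_diff_distrib)
    moreover have "w \<le> 1" using x by simp
    ultimately show "x \<in> insert v {v + t *\<^sub>R (y - v) | t y. 0 \<le> t \<and> t \<le> 1 \<and> y \<in> G}" using x by blast
  next
    fix x assume x: "x \<in> insert v {v + t *\<^sub>R (y - v) | t y. 0 \<le> t \<and> t \<le> 1 \<and> y \<in> G}"
    obtain g where g: "g \<in> G" using False by auto
    have "\<exists>t y. 0 \<le> t \<and> t \<le> 1 \<and> y \<in> G \<and> x = v + t *\<^sub>R (y - v)"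
    proof (cases "x = v")
      case True
      then show ?thesis using g by (intro exI[of _ 0] exI[of _ g]) auto
    qed (use x in blast)
    then obtain t y where "0 \<le> t" "t \<le> 1" "y \<in> G" "x = v + t *\<^sub>R (y - v)" by blast
    then show "x \<in> {x. \<exists>u\<ge>0. \<exists>w\<ge>0. \<exists>b. u + w = 1 \<and> b \<in> G \<and> x = u *\<^sub>R v + w *\<^sub>R b}"
      by (intro CollectI exI[of _ "1 - t"] conjI exI[of _ t] exI[of _ y]) (auto simp: algebra_simps)
  qed
qed (simp add: pyramid_def)

lemma pyramid_Un:
  assumes "convex G" "convex H" "convex (G \<union> H)"
  shows "pyramid v (G \<union> H) = pyramid v G \<union> pyramid v H"
  unfolding pyramid_explicit[OF assms(1)] pyramid_explicit[OF assms(2)] pyramid_explicit[OF assms(3)] by blast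

text \<open>The value of a . (x - v) is the radial parameter in both pyramids, so a common point
  other than \<open>v\<close> comes from the same base point.\<close>

lemma pyramid_Int:
  fixes a :: "'a::real_inner"
  assumes "convex G" "convex H" and G: "\<And>x. x \<in> G \<Longrightarrow> a \<bullet> (x - v) = 1" and H: "\<And>x. x \<in> H \<Longrightarrow> a \<bullet> (x - v) = 1"
  shows "pyramid v (G \<inter> H) = pyramid v G \<inter> pyramid v H"
proof (intro equalityI subsetI)
  fix x assume x: "x \<in> pyramid v G \<inter> pyramid v H"
  show "x \<in> pyramid v (G \<inter> H)"
  proof (cases "x = v")
    case False
    then obtain t y t' y' where ty: "0 \<le> t" "t \<le> 1" "y \<in> G" "x = v + t *\<^sub>R (y - v)"
      "y' \<in> H" "x = v + t' *\<^sub>R (y' - v)"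
      using x unfolding pyramid_explicit[OF assms(1)] pyramid_explicit[OF assms(2)] by auto
    have "a \<bullet> (x - v) = t" unfolding ty(4) using G[OF ty(3)] by simp
    moreover have "a \<bullet> (x - v) = t'" unfolding ty(6) using H[OF ty(5)] by simp
    ultimately have "t' = t" by simp
    moreover have "t \<noteq> 0" using False ty by auto
    ultimately have "y = y'" using ty(4,6) by simp
    then show ?thesis unfolding pyramid_explicit[OF convex_Int[OF assms(1,2)]] using ty by blast
  qed (simp add: pyramid_def hull_inc)
qed (auto simp: pyramid_explicit assms convex_Int)

lemma pyramid_convex_hull: "pyramid v (convex hull C) = convex hull (insert v C)"
proof -
  have "convex hull C \<subseteq> convex hull (insert v C)" by (rule hull_mono) auto
  then have "pyramid v (convex hull C) \<subseteq> convex hull (insert v C)"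
    unfolding pyramid_def by (intro hull_minimal) (auto simp: hull_inc)
  moreover have "convex hull (insert v C) \<subseteq> pyramid v (convex hull C)"
    unfolding pyramid_def by (rule hull_mono) (auto simp: hull_inc)
  ultimately show ?thesis by auto
qed

lemma polytope_pyramid: "polytope G \<Longrightarrow> polytope (pyramid v G)"
  unfolding polytope_def by (metis finite_insert pyramid_convex_hull)

text \<open>Polytopes in a hyperplane off \<open>v\<close> need no common base point; their pyramids
  all share \<open>v\<close>. The identity for polytopes through \<open>v\<close> thus becomes an
  unrestricted one in lower dimension. The set \<open>K\<close> keeps the argument inside a given
  affine subspace.\<close>

lemma pyramid_valuation:
  fixes \<mu> :: "'a::euclidean_space set \<Rightarrow> real"
  assumes val: "\<And>P Q. polytope P \<Longrightarrow> polytope Q \<Longrightarrow> polytope (P \<union> Q) \<Longrightarrow> v \<in> P \<Longrightarrow> v \<in> Q \<Longrightarrow> P \<union> Q \<subseteq> K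
      \<Longrightarrow> \<mu> P + \<mu> Q = \<mu> (P \<union> Q) + \<mu> (P \<inter> Q)"
    and K: "convex K" "v \<in> K"
    and PQ: "polytope P" "polytope Q" "polytope (P \<union> Q)" "P \<union> Q \<subseteq> K"
    and a: "\<And>x. x \<in> P \<union> Q \<Longrightarrow> a \<bullet> (x - v) = 1"
  shows "\<mu> (pyramid v P) + \<mu> (pyramid v Q) = \<mu> (pyramid v (P \<union> Q)) + \<mu> (pyramid v (P \<inter> Q))"
proof -
  have un: "pyramid v (P \<union> Q) = pyramid v P \<union> pyramid v Q"
    using PQ by (intro pyramid_Un polytope_imp_convex)
  have "polytope (pyramid v P \<union> pyramid v Q)" unfolding un[symmetric] by (rule polytope_pyramid[OF PQ(3)])
  moreover have "v \<in> pyramid v P" "v \<in> pyramid v Q" by (auto simp: pyramid_def hull_inc)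
  moreover have "pyramid v P \<union> pyramid v Q \<subseteq> K"
    unfolding un[symmetric] unfolding pyramid_def using K PQ(4) by (intro hull_minimal) auto
  moreover have "pyramid v (P \<inter> Q) = pyramid v P \<inter> pyramid v Q"
    using PQ a by (intro pyramid_Int[where a=a] polytope_imp_convex) auto
  ultimately show ?thesis
    unfolding un using val[OF polytope_pyramid[OF PQ(1)] polytope_pyramid[OF PQ(2)]] by simp
qed

text \<open>Induction on the dimension of \<open>H\<close>: pyramids over the section
  \<open>H'\<close> with apex \<open>v\<close> define a valuation on a smaller affine space, and a
  simplex in \<open>H'\<close> together with \<open>v\<close> is again a simplex. Quantifying over
  \<mu> in the induction is what makes this possible.\<close>

lemma valuation_zero_affine:
  fixes \<mu> :: "'a::euclidean_space set \<Rightarrow> real"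
  assumes "affine H" "aff_dim H < int n"
    and "\<And>P Q. polytope P \<Longrightarrow> polytope Q \<Longrightarrow> polytope (P \<union> Q) \<Longrightarrow> P \<union> Q \<subseteq> H
      \<Longrightarrow> \<mu> P + \<mu> Q = \<mu> (P \<union> Q) + \<mu> (P \<inter> Q)"
    and "\<And>C. \<not> affine_dependent C \<Longrightarrow> C \<subseteq> H \<Longrightarrow> \<mu> (convex hull C) = 0"
    and "polytope P" "P \<subseteq> H"
  shows "\<mu> P = 0"
  using assms
proof (induction n arbitrary: H \<mu> P)
  \<comment> \<open>The strict bound makes this the empty affine space; vanishing at the empty
    polytope is the case of the empty simplex.\<close>
  case 0
  then have "H = {}" by simp
  then show ?case using 0(4)[of "{}"] 0(6) by simp
next
  case (Suc n)
  note val = Suc.prems(3)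
  note simplex = Suc.prems(4)
  show ?case
  proof (cases "P = {}")
    case True
    then show ?thesis using simplex[of "{}"] by simp
  next
    case False
    then obtain v where v: "v \<in> P" by auto
    show ?thesis
    proof (rule valuation_zero_by_pyramids[where v=v])
      show "\<mu> {v} = 0" using simplex[of "{v}"] v Suc.prems(6) by auto
      show "\<mu> P' + \<mu> Q' = \<mu> (P' \<union> Q') + \<mu> (P' \<inter> Q')"
        if "polytope P'" "polytope Q'" "polytope (P' \<union> Q')" "P' \<union> Q' \<subseteq> P" for P' Q'
        using that Suc.prems(6) by (intro val) auto
      fix a F assume F: "polytope F" "F \<subseteq> P" and a: "\<And>x. x \<in> F \<Longrightarrow> a \<bullet> (x - v) = 1"
      define H' where "H' = H \<inter> {x. a \<bullet> x = a \<bullet> v + 1}"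
      have aH': "affine H'" unfolding H'_def by (intro affine_Int Suc.prems(1) affine_hyperplane)
      have vH: "v \<in> H" "v \<notin> H'" using v Suc.prems(6) by (auto simp: H'_def)
      have a1: "a \<bullet> (x - v) = 1" if "x \<in> H'" for x using that by (auto simp: H'_def inner_diff_right)
      have lt: "aff_dim H' < aff_dim H"
      proof (rule aff_dim_psubset)
        show "affine hull H' \<subset> affine hull H"
          using vH by (metis H'_def Int_lower1 aH' Suc.prems(1) hull_same psubsetI)
      qed
      have "\<mu> (pyramid v F) = 0"
      proof (rule Suc.IH[OF aH', where \<mu>="\<lambda>G. \<mu> (pyramid v G)"])
        show "aff_dim H' < int n" using lt Suc.prems(2) by simp
        show "\<mu> (pyramid v P') + \<mu> (pyramid v Q') = \<mu> (pyramid v (P' \<union> Q')) + \<mu> (pyramid v (P' \<inter> Q'))"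
          if PQ: "polytope P'" "polytope Q'" "polytope (P' \<union> Q')" "P' \<union> Q' \<subseteq> H'" for P' Q'
        proof (rule pyramid_valuation[where a=a and K=H])
          show "P' \<union> Q' \<subseteq> H" using PQ(4) by (auto simp: H'_def)
          show "a \<bullet> (x - v) = 1" if "x \<in> P' \<union> Q'" for x using a1 PQ(4) that by blast
          show "convex H" by (rule affine_imp_convex[OF Suc.prems(1)])
          show "\<mu> P + \<mu> Q = \<mu> (P \<union> Q) + \<mu> (P \<inter> Q)"
            if "polytope P" "polytope Q" "polytope (P \<union> Q)" "P \<union> Q \<subseteq> H" for P Q
            using that by (rule val)
        qed (use PQ vH in auto)
        show "\<mu> (pyramid v (convex hull C)) = 0" if C: "\<not> affine_dependent C" "C \<subseteq> H'" for C
          unfolding pyramid_convex_hull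
        proof (rule simplex)
          have "affine hull C \<subseteq> H'" using C aH' by (metis hull_minimal)
          then show "\<not> affine_dependent (insert v C)" using vH C(1) by (intro affine_independent_insert) auto
          show "insert v C \<subseteq> H" using C vH by (auto simp: H'_def)
        qed
        show "F \<subseteq> H'" using F(2) a Suc.prems(6) by (fastforce simp: H'_def inner_diff_right)
      qed (rule F(1))
      then show "\<mu> (convex hull insert v F) = 0" by (simp add: pyramid_def)
    qed (use v Suc.prems in auto)
  qed
qed

text \<open>At the first step the apex has to be the origin, since the identity is available only
  for polytopes containing it. Afterwards G \<mapsto> \<open>Y (pyramid 0 G)\<close> is free of that
  restriction. Affinely independent points of a hyperplane missing the origin are linearly
  independent.\<close>

lemma valuation_zero_from_simplices:
  fixes Y :: "(real ^ 'n) set \<Rightarrow> real"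
  assumes val: "\<And>P Q. P \<in> polytopes_o \<Longrightarrow> Q \<in> polytopes_o \<Longrightarrow> P \<union> Q \<in> polytopes_o \<Longrightarrow> P \<inter> Q \<in> polytopes_o
      \<Longrightarrow> Y P + Y Q = Y (P \<union> Q) + Y (P \<inter> Q)"
    and simplex: "\<And>B. independent B \<Longrightarrow> Y (convex hull (insert 0 B)) = 0"
    and P: "P \<in> polytopes_o"
  shows "Y P = 0"
proof -
  have val': "Y P + Y Q = Y (P \<union> Q) + Y (P \<inter> Q)"
    if "polytope P" "polytope Q" "polytope (P \<union> Q)" "0 \<in> P" "0 \<in> Q" for P Q
    using that by (intro val) (auto simp: polytopes_o_def polytope_Int)
  show ?thesis
  proof (rule valuation_zero_by_pyramids[where v=0])
    show "polytope P" "0 \<in> P" using P by (auto simp: polytopes_o_def)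
    show "Y {0} = 0" using simplex[of "{}"] by (simp add: independent_empty)
    fix a and F :: "(real ^ 'n) set" assume F: "polytope F" "\<And>x. x \<in> F \<Longrightarrow> a \<bullet> (x - 0) = 1"
    define H where "H = {x. a \<bullet> x = 1}"
    have "Y (pyramid 0 F) = 0"
    proof (rule valuation_zero_affine[where H=H and \<mu>="\<lambda>G. Y (pyramid 0 G)" and n="Suc DIM(real ^ 'n)"])
      show "affine H" unfolding H_def by (rule affine_hyperplane)
      show "aff_dim H < int (Suc DIM(real ^ 'n))" using aff_dim_le_DIM[of H] by simp
      show "Y (pyramid 0 P) + Y (pyramid 0 Q) = Y (pyramid 0 (P \<union> Q)) + Y (pyramid 0 (P \<inter> Q))"
        if PQ: "polytope P" "polytope Q" "polytope (P \<union> Q)" "P \<union> Q \<subseteq> H" for P Q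
        by (rule pyramid_valuation[where a=a and K=UNIV]) (use PQ val' in \<open>auto simp: H_def\<close>)
      show "Y (pyramid 0 (convex hull C)) = 0" if C: "\<not> affine_dependent C" "C \<subseteq> H" for C
        unfolding pyramid_convex_hull
      proof (rule simplex)
        have "affine hull C \<subseteq> H" using C by (simp add: H_def affine_hyperplane hull_minimal)
        then have "0 \<notin> affine hull C" by (auto simp: H_def)
        then have "\<not> affine_dependent (insert 0 C)" using C(1) by (intro affine_independent_insert)
        moreover have "0 \<notin> C" using C(2) by (auto simp: H_def)
        ultimately show "independent C" using affine_dependent_iff_dependent[of 0 C] by simp
      qed
      show "F \<subseteq> H" using F(2) by (auto simp: H_def)
    qed (rule F(1))
    then show "Y (convex hull insert 0 F) = 0" by (simp add: pyramid_def)
  qed (use val' in auto)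
qed

section \<open>Coordinate simplices\<close>

definition corner :: "'n set \<Rightarrow> (real ^ 'n) set" where
  "corner J = {y. (\<forall>j. 0 \<le> y $ j) \<and> (\<forall>j. j \<notin> J \<longrightarrow> y $ j = 0) \<and> (\<Sum>j\<in>UNIV. y $ j) \<le> 1}"

lemma corner_eq_hull: "corner J = convex hull (insert 0 ((\<lambda>j. axis j 1) ` J))"
proof -
  let ?d = "(\<lambda>j. axis j (1::real)) ` J"
  have d: "?d \<subseteq> Basis" by (auto simp: axis_in_Basis_iff)
  have B: "(\<forall>i\<in>Basis. Q i) \<longleftrightarrow> (\<forall>j. Q (axis j (1::real)))" for Q :: "real ^ 'a \<Rightarrow> bool"
    by (auto simp: Basis_vec_def)
  have inj: "inj_on (\<lambda>j. axis j (1::real)) J" by (auto simp: inj_on_def axis_eq_axis)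
  have "x \<in> corner J \<longleftrightarrow> (\<forall>i\<in>Basis. 0 \<le> x \<bullet> i) \<and> (\<Sum>i\<in>?d. x \<bullet> i) \<le> 1 \<and> (\<forall>i\<in>Basis. i \<notin> ?d \<longrightarrow> x \<bullet> i = 0)" for x
  proof -
    have s: "(\<Sum>i\<in>?d. x \<bullet> i) = (\<Sum>j\<in>J. x $ j)"
      by (simp add: sum.reindex[OF inj] inner_axis)
    have n: "(\<forall>i\<in>Basis. i \<notin> ?d \<longrightarrow> x \<bullet> i = 0) \<longleftrightarrow> (\<forall>j. j \<notin> J \<longrightarrow> x $ j = 0)"
      unfolding B by (simp add: inner_axis image_iff axis_eq_axis)
    have "(\<forall>j. j \<notin> J \<longrightarrow> x $ j = 0) \<Longrightarrow> (\<Sum>j\<in>J. x $ j) = (\<Sum>j\<in>UNIV. x $ j)"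
      by (intro sum.mono_neutral_left) auto
    moreover have "(\<forall>i\<in>Basis. 0 \<le> x \<bullet> i) \<longleftrightarrow> (\<forall>j. 0 \<le> x $ j)"
      unfolding B by (simp add: inner_axis)
    ultimately show ?thesis unfolding corner_def s n by auto
  qed
  then show ?thesis unfolding substd_simplex[OF d] by auto
qed

lemma corner_polytopes_o: "corner J \<in> polytopes_o"
  by (auto simp: polytopes_o_def corner_eq_hull polytope_def hull_inc intro!: exI[of _ "insert 0 ((\<lambda>j. axis j 1) ` J)"])

lemma matrix_image_polytopes_o: "P \<in> polytopes_o \<Longrightarrow> (*v) (A :: real ^ 'n ^ 'n) ` P \<in> polytopes_o"
  by (auto simp: polytopes_o_def polytope_linear_image image_iff intro: bexI[of _ 0])

lemma matrix_mult_nonzero: "det (A :: real ^ 'n ^ 'n) \<noteq> 0 \<Longrightarrow> y \<noteq> 0 \<Longrightarrow> A *v y \<noteq> 0"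
  by (metis matrix_inv_det(3) matrix_vector_mult_0_right)

text \<open>Sends e_i to the point \<theta> e_i + (1 - \<theta>) e_j and fixes the other axis
  vectors, so it maps a coordinate simplex onto one piece of the cut. The other piece is obtained by
  exchanging \<open>i\<close> with \<open>j\<close> and \<theta> with 1 - \<theta>.\<close>

definition cut_matrix :: "'n \<Rightarrow> 'n \<Rightarrow> real \<Rightarrow> real ^ 'n ^ 'n" where
  "cut_matrix i j \<theta> = replace_col i (\<theta> *\<^sub>R axis i 1 + (1 - \<theta>) *\<^sub>R axis j 1)"

lemma cut_matrix_mult:
  assumes "i \<noteq> j"
  shows "(cut_matrix i j \<theta> *v y) $ a = (if a = i then \<theta> * y $ i else if a = j then y $ j + (1 - \<theta>) * y $ i else y $ a)"
  using assms by (auto simp: cut_matrix_def replace_col_mult axis_def algebra_simps)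

lemma det_cut_matrix: "i \<noteq> j \<Longrightarrow> det (cut_matrix i j \<theta>) = \<theta>"
  by (simp add: cut_matrix_def det_replace_col axis_def)

text \<open>All columns have sum 1: a cut through the origin leaves the hyperplane of the opposite
  facet in place. The coordinate sum is the invariant on which the final formula depends.\<close>

lemma sum_cut_matrix:
  assumes "i \<noteq> j"
  shows "(\<Sum>a\<in>UNIV. (cut_matrix i j \<theta> *v y) $ a) = (\<Sum>a\<in>UNIV. y $ a)"
  unfolding cut_matrix_def replace_col_mult
  by (simp add: sum.distrib sum_subtractf flip: sum_distrib_left) (simp add: axis_def)

lemma cut_matrix_image:
  assumes ij: "i \<noteq> j" "i \<in> J" "j \<in> J" and l: "0 < \<theta>" "\<theta> < 1"
  shows "(*v) (cut_matrix i j \<theta>) ` corner J = {x \<in> corner J. (1 - \<theta>) * x $ i \<le> \<theta> * x $ j}"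
    and "(*v) (cut_matrix i j \<theta>) ` corner (J - {j}) = {x \<in> corner J. (1 - \<theta>) * x $ i = \<theta> * x $ j}"
proof -
  note mult = cut_matrix_mult[OF ij(1)]
  define inv where "inv x = (\<chi> a. if a = i then x $ i / \<theta> else if a = j then x $ j - (1 - \<theta>) * x $ i / \<theta> else x $ a)"
    for x :: "real ^ 'a"
  have cut_inv: "cut_matrix i j \<theta> *v inv x = x" for x
    using l ij(1) by (simp add: vec_eq_iff mult inv_def)
  have inv_sum: "(\<Sum>a\<in>UNIV. inv x $ a) = (\<Sum>a\<in>UNIV. x $ a)" for x
    using sum_cut_matrix[OF ij(1), of \<theta> "inv x"] by (simp add: cut_inv)
  have fwd: "cut_matrix i j \<theta> *v y \<in> corner J" if "y \<in> corner J" for y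
    using that ij l unfolding corner_def mem_Collect_eq sum_cut_matrix[OF ij(1)] by (auto simp: mult)
  have bwd: "inv x \<in> corner J" if "x \<in> corner J" "(1 - \<theta>) * x $ i \<le> \<theta> * x $ j" for x
    using that ij l unfolding corner_def mem_Collect_eq inv_sum by (auto simp: inv_def field_simps)
  \<comment> \<open>The sign of this expression tells the side of the cutting hyperplane; it
    vanishes exactly for \<open>y $ j = 0\<close>, which is why \<open>J - {j}\<close> gives the
    common face.\<close>
  have rel: "(1 - \<theta>) * (cut_matrix i j \<theta> *v y) $ i - \<theta> * (cut_matrix i j \<theta> *v y) $ j = - (\<theta> * y $ j)" for y
    using ij(1) by (simp add: mult algebra_simps)
  show "(*v) (cut_matrix i j \<theta>) ` corner J = {x \<in> corner J. (1 - \<theta>) * x $ i \<le> \<theta> * x $ j}"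
  proof (intro equalityI subsetI)
    fix x assume "x \<in> (*v) (cut_matrix i j \<theta>) ` corner J"
    then obtain y where y: "y \<in> corner J" "x = cut_matrix i j \<theta> *v y" by auto
    have "0 \<le> \<theta> * y $ j" using y(1) l by (auto simp: corner_def)
    then show "x \<in> {x \<in> corner J. (1 - \<theta>) * x $ i \<le> \<theta> * x $ j}" using fwd[OF y(1)] rel[of y] y(2) by auto
  next
    fix x assume "x \<in> {x \<in> corner J. (1 - \<theta>) * x $ i \<le> \<theta> * x $ j}"
    then show "x \<in> (*v) (cut_matrix i j \<theta>) ` corner J" using bwd[of x] cut_inv[of x] by (metis (lifting) imageI mem_Collect_eq)
  qed
  have sub: "y \<in> corner (J - {j}) \<longleftrightarrow> y \<in> corner J \<and> y $ j = 0" for y by (auto simp: corner_def)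
  show "(*v) (cut_matrix i j \<theta>) ` corner (J - {j}) = {x \<in> corner J. (1 - \<theta>) * x $ i = \<theta> * x $ j}"
  proof (intro equalityI subsetI)
    fix x assume "x \<in> (*v) (cut_matrix i j \<theta>) ` corner (J - {j})"
    then obtain y where y: "y \<in> corner J" "y $ j = 0" "x = cut_matrix i j \<theta> *v y" using sub by auto
    then show "x \<in> {x \<in> corner J. (1 - \<theta>) * x $ i = \<theta> * x $ j}" using fwd[OF y(1)] rel[of y] by auto
  next
    fix x assume x: "x \<in> {x \<in> corner J. (1 - \<theta>) * x $ i = \<theta> * x $ j}"
    then have "inv x \<in> corner J" using bwd[of x] by auto
    moreover have "inv x $ j = 0" using x ij(1) l by (auto simp: inv_def field_simps)
    ultimately have "inv x \<in> corner (J - {j})" by (simp add: sub)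
    then show "x \<in> (*v) (cut_matrix i j \<theta>) ` corner (J - {j})" using cut_inv[of x] by (metis imageI)
  qed
qed

definition swap_matrix :: "'n \<Rightarrow> 'n \<Rightarrow> real ^ 'n ^ 'n" where
  "swap_matrix i j = (\<chi> a. mat 1 $ Transposition.transpose i j a)"

lemma swap_matrix_mult: "(swap_matrix i j *v y) $ a = y $ Transposition.transpose i j a"
proof -
  have "(swap_matrix i j *v y) $ a = (mat 1 *v y) $ Transposition.transpose i j a"
    unfolding swap_matrix_def matrix_vector_mult_def by simp
  then show ?thesis by simp
qed

lemma det_swap_matrix: "i \<noteq> j \<Longrightarrow> det (swap_matrix i j :: real ^ 'n ^ 'n) = -1"
  unfolding swap_matrix_def by (subst det_permute_rows[OF permutes_swap_id]) (auto simp: sign_swap_id)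

lemma swap_matrix_image:
  assumes "J' = Transposition.transpose i j ` J"
  shows "(*v) (swap_matrix i j) ` corner J = corner J'"
proof -
  let ?\<tau> = "Transposition.transpose i j"
  have sum: "(\<Sum>a\<in>UNIV. y $ ?\<tau> a) = (\<Sum>a\<in>UNIV. y $ a)" for y :: "real ^ 'a"
    using sum.permute[OF permutes_swap_id[of i UNIV j], of "\<lambda>a. y $ a"] by (simp add: comp_def)
  have corner: "swap_matrix i j *v y \<in> corner (?\<tau> ` K)" if y: "y \<in> corner K" for y and K
  proof -
    have "y $ ?\<tau> a = 0" if "a \<notin> ?\<tau> ` K" for a
    proof -
      have "?\<tau> a \<notin> K" using that by (metis imageI transpose_involutory)
      then show ?thesis using y by (auto simp: corner_def)
    qed
    then show ?thesis using y unfolding corner_def mem_Collect_eq swap_matrix_mult sum by auto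
  qed
  have inv: "swap_matrix i j *v (swap_matrix i j *v y) = y" for y
    by (simp add: vec_eq_iff swap_matrix_mult)
  have tt: "?\<tau> ` J' = J" by (simp add: assms image_image)
  show ?thesis
  proof (intro equalityI subsetI)
    fix x assume "x \<in> corner J'"
    then have "swap_matrix i j *v x \<in> corner J" using corner[of x J'] tt by simp
    then show "x \<in> (*v) (swap_matrix i j) ` corner J" using inv[of x] by (metis imageI)
  qed (use corner assms in auto)
qed

lemma continuous_line_limit:
  fixes f :: "real ^ 'n \<Rightarrow> real"
  assumes "continuous_on (- {0}) f" "y \<noteq> 0"
  shows "((\<lambda>t. f (y + t *\<^sub>R v)) \<longlongrightarrow> f y) (at 0)"
proof -
  have "isCont f y" using assms by (simp add: continuous_on_eq_continuous_at open_Compl)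
  moreover have "((\<lambda>t. y + t *\<^sub>R v) \<longlongrightarrow> y + 0 *\<^sub>R v) (at 0)" by (intro tendsto_intros)
  ultimately show ?thesis using isCont_tendsto_compose[of y f "\<lambda>t. y + t *\<^sub>R v" "at 0"] by simp
qed

text \<open>Subtracting the linear function leaves an additive \<open>k\<close> with k(1) = 0. Such
  a \<open>k\<close> is unchanged by integer shifts, hence bounded by its values on [0,1], and a
  bounded function with k(m t) = m k(t) vanishes.\<close>

lemma continuous_additive_ray:
  fixes h :: "real \<Rightarrow> real"
  assumes cont: "continuous_on UNIV h"
    and add: "\<And>a b. 0 < a \<Longrightarrow> 0 < b \<Longrightarrow> h (a + b) = h a + h b" and h0: "h 0 = 0"
    and t: "t \<ge> 0"
  shows "h t = h 1 * t"
proof -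
  define k where "k x = h x - h 1 * x" for x
  have kadd: "k (a + b) = k a + k b" if "0 \<le> a" "0 \<le> b" for a b
  proof (cases "a = 0 \<or> b = 0")
    case False
    then show ?thesis using that add[of a b] by (simp add: k_def algebra_simps)
  qed (use h0 in \<open>auto simp: k_def\<close>)
  have k0: "k 0 = 0" "k 1 = 0" by (auto simp: k_def h0)
  have kmul: "k (real m * x) = real m * k x" if "0 \<le> x" for m x
    by (induction m) (use that kadd k0 in \<open>auto simp: algebra_simps\<close>)
  have "continuous_on {0..1} k" unfolding k_def
    by (intro continuous_intros continuous_on_subset[OF cont]) auto
  then have "compact (k ` {0..1})" by (rule compact_continuous_image) auto
  then obtain M where M: "\<And>x. 0 \<le> x \<Longrightarrow> x \<le> 1 \<Longrightarrow> \<bar>k x\<bar> \<le> M"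
    using compact_imp_bounded[of "k ` {0..1}"] unfolding bounded_iff by (metis atLeastAtMost_iff imageI real_norm_def)
  have bd: "\<bar>k x\<bar> \<le> M" if "0 \<le> x" for x
  proof -
    define m where "m = nat \<lfloor>x\<rfloor>"
    have "x = real m * 1 + frac x" using that by (simp add: m_def frac_def)
    then have "k x = k (real m * 1) + k (frac x)" using kadd[of "real m * 1" "frac x"] by simp
    then have "k x = k (frac x)" using kmul[of 1 m] k0 by simp
    then show ?thesis using M[of "frac x"] frac_lt_1[of x] by simp
  qed
  have "k t = 0"
  proof (rule ccontr)
    assume "k t \<noteq> 0"
    then obtain m :: nat where "M < real m * \<bar>k t\<bar>" using reals_Archimedean3[of "\<bar>k t\<bar>"] by auto
    then show False using bd[of "real m * t"] kmul[OF t, of m] t by (simp add: abs_mult)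
  qed
  then show ?thesis by (simp add: k_def)
qed

lemma exists_two_others:
  fixes k :: "'n::finite"
  assumes "CARD('n) \<ge> 3"
  shows "\<exists>i j. i \<noteq> j \<and> i \<noteq> k \<and> j \<noteq> k"
proof -
  have "card (UNIV - {k}) \<ge> 2" using assms by (simp add: card_Diff_singleton)
  then have "\<not> card (UNIV - {k}) \<le> 1" by simp
  then show ?thesis using card_le_Suc0_iff_eq[of "UNIV - {k}"] by auto
qed

section \<open>Values on simplices of dimension below n\<close>

locale sl_valuation =
  fixes Z :: "(real ^ 'n) set \<Rightarrow> real ^ 'n \<Rightarrow> real"
  assumes contra: "SL_contravariant Z" and val: "valuation_o Z"
    and cont: "\<And>P. P \<in> polytopes_o \<Longrightarrow> continuous_on (- {0}) (Z P)"
begin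

lemma Z_matrix: "det A = 1 \<Longrightarrow> y \<noteq> 0 \<Longrightarrow> Z ((*v) A ` corner J) (A *v y) = Z (corner J) y"
  by (rule SL_contravariantD[OF contra corner_polytopes_o])

lemma Z_limit: "y \<noteq> 0 \<Longrightarrow> ((\<lambda>t. Z (corner J) (y + t *\<^sub>R v)) \<longlongrightarrow> Z (corner J) y) (at 0)"
  by (rule continuous_line_limit[OF cont[OF corner_polytopes_o]])

text \<open>Rescaling an axis missing from \<open>J\<close> leaves the coordinate simplex pointwise
  fixed. It corrects any nonzero determinant to 1, negative ones included, at the price of changing
  one coordinate of the argument.\<close>

lemma Z_rescale:
  assumes k: "k \<notin> J" and d: "det A \<noteq> 0" and y: "y \<noteq> 0"
  shows "Z ((*v) A ` corner J) (A *v y) = Z (corner J) (replace_col k (det A *\<^sub>R axis k 1) *v y)"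
proof -
  let ?D = "replace_col k (det A *\<^sub>R axis k 1)" and ?D' = "replace_col k ((1 / det A) *\<^sub>R axis k 1)"
  have fixd: "?D' *v z = z" if "z \<in> corner J" for z
    using that k by (simp add: replace_col_mult corner_def)
  have "(*v) (A ** ?D') ` corner J = (*v) A ` (*v) ?D' ` corner J"
    by (simp add: image_image matrix_vector_mul_assoc)
  also have "(*v) ?D' ` corner J = corner J" using fixd by (force simp: image_iff)
  finally have im: "(*v) (A ** ?D') ` corner J = (*v) A ` corner J" .
  have inv: "?D' *v (?D *v y) = y"
    using d by (simp add: replace_col_mult vec_eq_iff axis_def field_simps)
  have "det (A ** ?D') = 1" using d by (simp add: det_mul det_replace_col)
  moreover have "?D *v y \<noteq> 0" using inv y by (metis matrix_vector_mult_0_right)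
  ultimately have "Z ((*v) (A ** ?D') ` corner J) ((A ** ?D') *v (?D *v y)) = Z (corner J) (?D *v y)"
    by (rule Z_matrix)
  then show ?thesis unfolding im by (simp add: inv flip: matrix_vector_mul_assoc)
qed

lemma Z_cut:
  assumes ij: "i \<noteq> j" "i \<in> J" "j \<in> J" and l: "0 < \<theta>" "\<theta> < 1" and A: "det A \<noteq> 0" and x: "x \<noteq> 0"
  shows "Z ((*v) A ` corner J) x + Z ((*v) (A ** cut_matrix i j \<theta>) ` corner (J - {j})) x
    = Z ((*v) (A ** cut_matrix i j \<theta>) ` corner J) x + Z ((*v) (A ** cut_matrix j i (1 - \<theta>)) ` corner J) x"
proof -
  let ?P = "(*v) (cut_matrix i j \<theta>) ` corner J" and ?Q = "(*v) (cut_matrix j i (1 - \<theta>)) ` corner J"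
  have comp: "(*v) (A ** B) ` S = (*v) A ` (*v) B ` S" for B S
    by (simp add: image_image matrix_vector_mul_assoc)
  have P: "?P = {x \<in> corner J. (1 - \<theta>) * x $ i \<le> \<theta> * x $ j}" by (rule cut_matrix_image(1)[OF ij l])
  have Q: "?Q = {x \<in> corner J. \<theta> * x $ j \<le> (1 - \<theta>) * x $ i}"
    using cut_matrix_image(1)[of j i J "1 - \<theta>"] ij l by simp
  have un: "?P \<union> ?Q = corner J" unfolding P Q by auto
  have int: "?P \<inter> ?Q = (*v) (cut_matrix i j \<theta>) ` corner (J - {j})"
    unfolding P Q cut_matrix_image(2)[OF ij l] by auto
  have mem: "(*v) A ` ?P \<in> polytopes_o" "(*v) A ` ?Q \<in> polytopes_o"
    by (intro matrix_image_polytopes_o corner_polytopes_o)+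
  have unA: "(*v) A ` ?P \<union> (*v) A ` ?Q = (*v) A ` corner J" unfolding image_Un[symmetric] un ..
  have intA: "(*v) A ` ?P \<inter> (*v) A ` ?Q = (*v) A ` (*v) (cut_matrix i j \<theta>) ` corner (J - {j})"
    unfolding image_Int[OF inj_matrix_det[OF A], symmetric] int ..
  have "Z ((*v) A ` ?P) x + Z ((*v) A ` ?Q) x = Z ((*v) A ` ?P \<union> (*v) A ` ?Q) x + Z ((*v) A ` ?P \<inter> (*v) A ` ?Q) x"
    using val mem x unfolding valuation_o_def unA intA
    by (metis intA unA matrix_image_polytopes_o corner_polytopes_o)
  then show ?thesis unfolding comp unA intA by simp
qed

text \<open>A shear moving only e_k fixes the simplex pointwise and can move \<open>y\<close> to any
  point with the same nonzero coordinate \<open>k\<close>.\<close>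

lemma Z_shear:
  assumes k: "k \<notin> J" and y: "y $ k \<noteq> 0" "y $ k = z $ k"
  shows "Z (corner J) y = Z (corner J) z"
proof -
  define v where "v = (1 / y $ k) *\<^sub>R (z - y)"
  let ?A = "replace_col k (axis k 1 + v)"
  have "v $ k = 0" using y by (simp add: v_def)
  then have "det ?A = 1" by (simp add: det_replace_col)
  moreover have "?A *v y = z" using y by (simp add: replace_col_mult v_def)
  moreover have "?A *v x = x" if "x \<in> corner J" for x using that k by (simp add: replace_col_mult corner_def)
  then have "(*v) ?A ` corner J = corner J" by (force simp: image_iff)
  moreover have "y \<noteq> 0" using y by auto
  ultimately show ?thesis using Z_matrix[of ?A y J] by simp
qed

text \<open>With two missing axes, shears along \<open>k\<close>, \<open>l\<close> and
  \<open>k\<close> again lead from any \<open>y\<close> with nonzero coordinate \<open>k\<close> to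
  e_k. The remaining \<open>y\<close> are limits of such points.\<close>

lemma Z_codim2_const:
  assumes kl: "k \<noteq> l" "k \<notin> J" "l \<notin> J"
  shows "\<exists>a. \<forall>y. y \<noteq> 0 \<longrightarrow> Z (corner J) y = a"
proof (intro exI allI impI)
  let ?e = "\<lambda>k. axis k (1::real)"
  have generic: "Z (corner J) y = Z (corner J) (?e k)" if "y $ k \<noteq> 0" for y
  proof -
    have "Z (corner J) y = Z (corner J) (y $ k *\<^sub>R ?e k + ?e l)"
      using that kl by (intro Z_shear[OF kl(2)]) (auto simp: axis_def)
    also have "\<dots> = Z (corner J) (?e k + ?e l)"
      using kl by (intro Z_shear[OF kl(3)]) (auto simp: axis_def)
    also have "\<dots> = Z (corner J) (?e k)"
      using kl by (intro Z_shear[OF kl(2)]) (auto simp: axis_def)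
    finally show ?thesis .
  qed
  fix y :: "real ^ 'n" assume y: "y \<noteq> 0"
  show "Z (corner J) y = Z (corner J) (?e k)"
  proof (cases "y $ k = 0")
    case True
    have "((\<lambda>t. Z (corner J) (y + t *\<^sub>R ?e k)) \<longlongrightarrow> Z (corner J) (?e k)) (at 0)"
    proof (rule tendsto_eventually)
      show "\<forall>\<^sub>F t in at 0. Z (corner J) (y + t *\<^sub>R ?e k) = Z (corner J) (?e k)"
        unfolding eventually_at by (intro exI[of _ 1]) (auto intro!: generic simp: True)
    qed
    then show ?thesis using tendsto_unique[OF _ Z_limit[OF y]] by (metis at_neq_bot)
  qed (rule generic)
qed

text \<open>With a single missing axis only coordinate \<open>k\<close> survives. The summand e_j
  keeps the representative away from the origin when that coordinate is 0.\<close>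

lemma Z_codim1:
  assumes jk: "j \<noteq> k" and y: "y \<noteq> 0"
  shows "Z (corner (- {k})) y = Z (corner (- {k})) (axis j 1 + y $ k *\<^sub>R axis k 1)"
proof (cases "y $ k = 0")
  case False
  then show ?thesis using jk by (intro Z_shear) (auto simp: axis_def)
next
  case True
  have ne: "axis j 1 \<noteq> (0 :: real ^ 'n)" by simp
  have "\<forall>\<^sub>F t in at 0. Z (corner (- {k})) (y + t *\<^sub>R axis k 1) = Z (corner (- {k})) (axis j 1 + t *\<^sub>R axis k 1)"
    unfolding eventually_at
    by (intro exI[of _ 1]) (use jk True in \<open>auto intro!: Z_shear simp: axis_def\<close>)
  then have "((\<lambda>t. Z (corner (- {k})) (y + t *\<^sub>R axis k 1)) \<longlongrightarrow> Z (corner (- {k})) (axis j 1)) (at 0)"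
    using Z_limit[OF ne, of "- {k}" "axis k 1"] by (simp add: tendsto_cong)
  then show ?thesis using tendsto_unique[OF _ Z_limit[OF y]] True by (metis add.right_neutral at_neq_bot scale_zero_left)
qed

end

context sl_valuation
begin

lemma Z_const_image:
  assumes a: "\<And>y. y \<noteq> 0 \<Longrightarrow> Z (corner J) y = a" and k: "k \<notin> J" and B: "det B \<noteq> 0" and x: "x \<noteq> 0"
  shows "Z ((*v) B ` corner J) x = a"
proof -
  define y where "y = matrix_inv B *v x"
  have xy: "x = B *v y" by (simp add: y_def matrix_inv_det[OF B])
  then have y: "y \<noteq> 0" using x by auto
  have "replace_col k (det B *\<^sub>R axis k 1) *v y \<noteq> 0"
    using B by (intro matrix_mult_nonzero y) (simp add: det_replace_col)
  then show ?thesis unfolding xy Z_rescale[OF k B y] by (rule a)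
qed

text \<open>With constant values a on \<open>J\<close> and b on \<open>J - {j}\<close>, cutting once
  reads a + b = a + a; the determinants of the pieces are absorbed by the missing axes.\<close>

lemma Z_const_drop:
  assumes ij: "i \<noteq> j" "i \<in> J" "j \<in> J" and kl: "k \<noteq> l" "k \<notin> J" "l \<notin> J" and x: "x \<noteq> 0"
  shows "Z (corner (J - {j})) x = Z (corner J) x"
proof -
  obtain a where a: "\<And>y. y \<noteq> 0 \<Longrightarrow> Z (corner J) y = a" using Z_codim2_const[OF kl] by blast
  have "k \<notin> J - {j}" "l \<notin> J - {j}" using kl by auto
  then obtain b where b: "\<And>y. y \<noteq> 0 \<Longrightarrow> Z (corner (J - {j})) y = b"
    using Z_codim2_const[OF kl(1)] by blast
  let ?C = "mat 1 ** cut_matrix i j (1/2)" and ?C' = "mat 1 ** cut_matrix j i (1 - 1/2)"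
  have d: "det ?C \<noteq> 0" "det ?C' \<noteq> 0" using ij(1) det_cut_matrix[of i j "1/2"] det_cut_matrix[of j i "1 - 1/2"] by auto
  have "Z ((*v) (mat 1) ` corner J) x + Z ((*v) ?C ` corner (J - {j})) x = Z ((*v) ?C ` corner J) x + Z ((*v) ?C' ` corner J) x"
    by (rule Z_cut[OF ij]) (use x in auto)
  moreover have "Z ((*v) ?C ` corner (J - {j})) x = b"
    by (rule Z_const_image[OF b _ d(1) x, of k]) (use kl in auto)
  moreover have "Z ((*v) ?C ` corner J) x = a" "Z ((*v) ?C' ` corner J) x = a"
    using Z_const_image[OF a kl(2) d(1) x] Z_const_image[OF a kl(2) d(2) x] by auto
  ultimately show ?thesis using a[OF x] b[OF x] by simp
qed

text \<open>Cuts remove vertices down to a single one, and transpositions compare the singletons.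
  The empty \<open>J\<close> stays out of reach, because a cut needs two indices.\<close>

lemma Z_lower_const:
  assumes card: "CARD('n) \<ge> 3"
  shows "\<exists>A. \<forall>J. J \<noteq> {} \<longrightarrow> (\<exists>k l. k \<noteq> l \<and> k \<notin> J \<and> l \<notin> J) \<longrightarrow> (\<forall>y. y \<noteq> 0 \<longrightarrow> Z (corner J) y = A)"
proof -
  fix i0 :: 'n
  obtain k l where kl: "k \<noteq> l" "k \<noteq> i0" "l \<noteq> i0" using exists_two_others[OF card] by blast
  then obtain A where A: "\<And>y. y \<noteq> 0 \<Longrightarrow> Z (corner {i0}) y = A"
    using Z_codim2_const[OF kl(1), of "{i0}"] by blast
  have single: "Z (corner {i}) y = A" if y: "y \<noteq> 0" for i y
  proof (cases "i = i0")
    case False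
    have "(*v) (swap_matrix i0 i) ` corner {i0} = corner {i}" by (rule swap_matrix_image) simp
    then show ?thesis
      using Z_const_image[OF A _ _ y, of k "swap_matrix i0 i"] kl False det_swap_matrix[of i0 i] by simp
  qed (simp add: A y)
  have "Z (corner J) y = A" if "i \<in> J" "k \<noteq> l" "k \<notin> J" "l \<notin> J" "y \<noteq> 0" for J i k l y
    using that(1,3,4)
  proof (induction "card J" arbitrary: J rule: less_induct)
    case less
    show ?case
    proof (cases "J = {i}")
      case False
      then obtain j where j: "j \<in> J" "j \<noteq> i" using less.prems by auto
      have "card (J - {j}) < card J" using j by (intro card_Diff1_less) auto
      then have "Z (corner (J - {j})) y = A" using less.hyps[of "J - {j}"] less.prems j by auto
      moreover have "Z (corner (J - {j})) y = Z (corner J) y"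
        by (rule Z_const_drop[of i j J k l]) (use less.prems j that in auto)
      ultimately show ?thesis by simp
    qed (simp add: single that)
  qed
  then show ?thesis
  proof (intro exI allI impI)
    fix J :: "'n set" and y :: "real ^ 'n"
    assume gen: "\<And>i J k l y. i \<in> J \<Longrightarrow> k \<noteq> l \<Longrightarrow> k \<notin> J \<Longrightarrow> l \<notin> J \<Longrightarrow> y \<noteq> 0 \<Longrightarrow> Z (corner J) y = A"
    assume "J \<noteq> {}" "\<exists>k l. k \<noteq> l \<and> k \<notin> J \<and> l \<notin> J" "y \<noteq> 0"
    then obtain i k l where "i \<in> J" "k \<noteq> l" "k \<notin> J" "l \<notin> J" by blast
    then show "Z (corner J) y = A" by (rule gen) fact
  qed
qed

text \<open>Here the missing axis matters to the value, so the determinant absorbed by it reappears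
  as a factor of the argument of \<open>g\<close>.\<close>

lemma Z_codim1_image:
  assumes g: "\<And>y. y \<noteq> 0 \<Longrightarrow> Z (corner (- {k})) y = g (y $ k)"
    and B: "det B \<noteq> 0" "\<And>y. (B *v y) $ l = y $ k" and x: "x \<noteq> 0"
  shows "Z ((*v) B ` corner (- {k})) x = g (det B * x $ l)"
proof -
  define y where "y = matrix_inv B *v x"
  have xy: "x = B *v y" by (simp add: y_def matrix_inv_det[OF B(1)])
  then have y: "y \<noteq> 0" using x by auto
  let ?D = "replace_col k (det B *\<^sub>R axis k 1)"
  have "?D *v y \<noteq> 0" using B by (intro matrix_mult_nonzero y) (simp add: det_replace_col)
  moreover have "(?D *v y) $ k = det B * x $ l"
    by (simp add: replace_col_mult xy B(2) algebra_simps)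
  moreover have "Z ((*v) B ` corner (- {k})) x = Z (corner (- {k})) (?D *v y)"
    unfolding xy by (rule Z_rescale) (use B y in auto)
  ultimately show ?thesis using g by simp
qed

text \<open>The common face of a cut has codimension 2 and value \<open>A\<close>, so g - A is
  additive on positive arguments, hence linear there by continuity.\<close>

lemma Z_codim1_abs:
  assumes card: "CARD('n) \<ge> 3"
    and A: "\<And>J k l y. J \<noteq> {} \<Longrightarrow> k \<noteq> l \<Longrightarrow> k \<notin> J \<Longrightarrow> l \<notin> J \<Longrightarrow> y \<noteq> 0 \<Longrightarrow> Z (corner J) y = A"
  shows "\<exists>c. \<forall>k y. y \<noteq> 0 \<longrightarrow> Z (corner (- {k})) y = A + c * \<bar>y $ k\<bar>"
proof -
  have "\<exists>c. \<forall>y. y \<noteq> 0 \<longrightarrow> Z (corner (- {k})) y = A + c * \<bar>y $ k\<bar>" for k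
  proof -
    obtain i j where ij: "i \<noteq> j" "i \<noteq> k" "j \<noteq> k" using exists_two_others[OF card] by blast
    define p where "p t = (axis i 1 + t *\<^sub>R axis k 1 :: real ^ 'n)" for t
    have pk: "p t $ k = t" "p t $ i = 1" for t using ij by (auto simp: p_def axis_def)
    then have p0: "p t \<noteq> 0" for t by (metis zero_index zero_neq_one)
    define g where "g t = Z (corner (- {k})) (p t)" for t
    have g: "Z (corner (- {k})) y = g (y $ k)" if "y \<noteq> 0" for y
      unfolding g_def p_def by (rule Z_codim1[OF ij(2) that])
    have gc: "continuous_on UNIV g"
      unfolding g_def
      by (rule continuous_on_compose2[OF cont[OF corner_polytopes_o]])
         (use p0 in \<open>auto simp: p_def intro!: continuous_intros\<close>)
    have split: "g t + A = g (\<theta> * t) + g ((1 - \<theta>) * t)" if th: "0 < \<theta>" "\<theta> < 1" for t \<theta>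
    proof -
      let ?C = "mat 1 ** cut_matrix i j \<theta>" and ?C' = "mat 1 ** cut_matrix j i (1 - \<theta>)"
      have d: "det ?C = \<theta>" "det ?C' = 1 - \<theta>" using ij(1) by (simp_all add: det_cut_matrix)
      have "Z ((*v) (mat 1) ` corner (- {k})) (p t) + Z ((*v) ?C ` corner (- {k} - {j})) (p t)
          = Z ((*v) ?C ` corner (- {k})) (p t) + Z ((*v) ?C' ` corner (- {k})) (p t)"
        by (rule Z_cut) (use ij th p0 in auto)
      moreover have "Z ((*v) ?C ` corner (- {k} - {j})) (p t) = A"
      proof (rule Z_const_image[where k=k])
        show "Z (corner (- {k} - {j})) y = A" if "y \<noteq> 0" for y
          by (rule A[of _ k j]) (use ij that in auto)
      qed (use d th p0 in auto)
      moreover have "Z ((*v) ?C ` corner (- {k})) (p t) = g (\<theta> * t)"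
        using Z_codim1_image[OF g, of ?C k "p t"] d th p0 pk ij by (simp add: cut_matrix_mult)
      moreover have "Z ((*v) ?C' ` corner (- {k})) (p t) = g ((1 - \<theta>) * t)"
        using Z_codim1_image[OF g, of ?C' k "p t"] d th p0 pk ij by (simp add: cut_matrix_mult)
      ultimately show ?thesis using g[OF p0[of t]] pk by simp
    qed
    have "Transposition.transpose i j ` (- {k}) = - {k}"
      using ij by (auto simp: image_iff Transposition.transpose_def)
    then have "(*v) (swap_matrix i j) ` corner (- {k}) = corner (- {k})" by (intro swap_matrix_image) simp
    \<comment> \<open>A transposition of two axes other than \<open>k\<close> preserves the simplex
      but has determinant -1, which acts on the argument as a change of sign.\<close>
    then have even: "g t = g (- t)" for t
      using Z_codim1_image[OF g, of "swap_matrix i j" k "p t"] det_swap_matrix[OF ij(1)] p0 pk ij g[OF p0[of t]]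
      by (simp add: swap_matrix_mult)
    define c where "c = g 1 - A"
    have "g t - A = (g 1 - A) * t" if "t \<ge> 0" for t
    proof (rule continuous_additive_ray[where h="\<lambda>t. g t - A"])
      show "continuous_on UNIV (\<lambda>t. g t - A)" by (intro continuous_intros gc)
      show "g (a + b) - A = (g a - A) + (g b - A)" if "0 < a" "0 < b" for a b
      proof -
        have "a / (a + b) * (a + b) = a" "(1 - a / (a + b)) * (a + b) = b"
          using that by (auto simp: field_simps)
        then show ?thesis using split[of "a / (a + b)" "a + b"] that by simp
      qed
      show "g 0 - A = 0" using split[of "1/2" 0] by simp
    qed (rule that)
    then have pos: "g t = A + c * t" if "t \<ge> 0" for t
      unfolding c_def using that by (metis add_diff_cancel_left' diff_add_cancel add.commute)
    have "g t = A + c * \<bar>t\<bar>" for t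
      using even[of t] pos[of t] pos[of "- t"] by (cases "t \<ge> 0") simp_all
    then show ?thesis using g by auto
  qed
  then obtain c where c: "\<And>k y. y \<noteq> 0 \<Longrightarrow> Z (corner (- {k})) y = A + c k * \<bar>y $ k\<bar>" by metis
  \<comment> \<open>A transposition also carries the missing axis \<open>k\<close> to
    \<open>l\<close>, so all facets through the origin share one constant.\<close>
  have "c l = c k" for k l
  proof (cases "l = k")
    case False
    have "Transposition.transpose k l ` (- {k}) = - {l}"
      using False by (auto simp: image_iff Transposition.transpose_def split: if_splits)
    then have "(*v) (swap_matrix k l) ` corner (- {k}) = corner (- {l})" by (intro swap_matrix_image) simp
    then have "Z (corner (- {l})) (axis l 1) = Z ((*v) (swap_matrix k l) ` corner (- {k})) (axis l 1)" by simp
    also have "\<dots> = (\<lambda>t. A + c k * \<bar>t\<bar>) (det (swap_matrix k l :: real ^ 'n ^ 'n) * (axis l 1 :: real ^ 'n) $ l)"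
      by (rule Z_codim1_image) (use c det_swap_matrix[of k l] False in \<open>auto simp: swap_matrix_mult\<close>)
    finally have "Z (corner (- {l})) (axis l 1) = A + c k * \<bar>det (swap_matrix k l :: real ^ 'n ^ 'n) * (axis l 1 :: real ^ 'n) $ l\<bar>" .
    then show ?thesis using c[of "axis l 1" l] det_swap_matrix[of k l] False by simp
  qed simp
  then show ?thesis using c by metis
qed

end

section \<open>The functional equation of a cut\<close>

lemma sum_axis: "(\<Sum>a\<in>UNIV. axis k c $ a) = (c::real)"
  by (simp add: axis_def)

lemmas sum_component_simps = vector_add_component vector_minus_component vector_scaleR_component real_scaleR_def
  sum.distrib sum_subtractf sum_distrib_left[symmetric] sum_axis

text \<open>\<open>E s \<rho>\<close> is the failure of additivity when s is split in the ratio
  \<rho> : 1. The hypothesis says that E(c, \<alpha>/\<beta>) = E(\<alpha>, c/\<beta>), hence E(c,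
  k) = E(1, c k); the symmetry k \<mapsto> 1/k gives E(c, k) = E(1, c/k) as well.\<close>

lemma constant_defect:
  fixes \<gamma> :: "real \<Rightarrow> real"
  assumes id: "\<And>\<alpha> \<beta> c. 0 < \<alpha> \<Longrightarrow> 0 < \<beta> \<Longrightarrow> 0 < c \<Longrightarrow>
      \<gamma> \<alpha> + \<gamma> (\<alpha> * c / (\<alpha> + \<beta>)) + \<gamma> (\<beta> * c / (\<alpha> + \<beta>)) = \<gamma> c + \<gamma> (\<alpha> * \<beta> / (\<beta> + c)) + \<gamma> (\<alpha> * c / (\<beta> + c))"
  shows "\<exists>\<delta>. \<forall>a b. 0 < a \<longrightarrow> 0 < b \<longrightarrow> \<gamma> a + \<gamma> b = \<gamma> (a + b) + \<delta>"
proof -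
  define E where "E s \<rho> = \<gamma> (s * \<rho> / (1 + \<rho>)) + \<gamma> (s / (1 + \<rho>)) - \<gamma> s" for s \<rho>
  have E1: "E c (\<alpha> / \<beta>) = E \<alpha> (c / \<beta>)" if p: "0 < \<alpha>" "0 < \<beta>" "0 < c" for \<alpha> \<beta> c
  proof -
    have eqs: "c * (\<alpha> / \<beta>) / (1 + \<alpha> / \<beta>) = \<alpha> * c / (\<alpha> + \<beta>)" "c / (1 + \<alpha> / \<beta>) = \<beta> * c / (\<alpha> + \<beta>)"
      "\<alpha> * (c / \<beta>) / (1 + c / \<beta>) = \<alpha> * c / (\<beta> + c)" "\<alpha> / (1 + c / \<beta>) = \<alpha> * \<beta> / (\<beta> + c)"
    proof -
      have "1 + \<alpha> / \<beta> = (\<alpha> + \<beta>) / \<beta>" "1 + c / \<beta> = (\<beta> + c) / \<beta>"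
        using p by (simp_all add: add_divide_distrib)
      then show "c * (\<alpha> / \<beta>) / (1 + \<alpha> / \<beta>) = \<alpha> * c / (\<alpha> + \<beta>)" "c / (1 + \<alpha> / \<beta>) = \<beta> * c / (\<alpha> + \<beta>)"
        "\<alpha> * (c / \<beta>) / (1 + c / \<beta>) = \<alpha> * c / (\<beta> + c)" "\<alpha> / (1 + c / \<beta>) = \<alpha> * \<beta> / (\<beta> + c)"
        using p by (simp_all add: mult.commute)
    qed
    show ?thesis unfolding E_def eqs using id[OF p] by simp
  qed
  have E2: "E s (1 / \<rho>) = E s \<rho>" if "0 < \<rho>" for s \<rho>
  proof -
    have eqs: "s * (1 / \<rho>) / (1 + 1 / \<rho>) = s / (1 + \<rho>)" "s / (1 + 1 / \<rho>) = s * \<rho> / (1 + \<rho>)"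
    proof -
      have "1 + 1 / \<rho> = (1 + \<rho>) / \<rho>" using that by (simp add: add_divide_distrib)
      then show "s * (1 / \<rho>) / (1 + 1 / \<rho>) = s / (1 + \<rho>)" "s / (1 + 1 / \<rho>) = s * \<rho> / (1 + \<rho>)"
        using that by simp_all
    qed
    show ?thesis unfolding E_def eqs by simp
  qed
  have E3: "E c k = E 1 (c * k)" if "0 < c" "0 < k" for c k
    using E1[OF zero_less_one _ that(1), of "1 / k"] that(2) by simp
  have E4: "E c k = E 1 (c / k)" if "0 < c" "0 < k" for c k
  proof -
    have "E c (1 / k) = E 1 (c * (1 / k))" by (rule E3) (use that in auto)
    then show ?thesis unfolding E2[OF that(2)] by simp
  qed
  have E5: "E 1 m = E 1 1" if "0 < m" for m
  proof -
    \<comment> \<open>Taking both arguments equal to the root of \<open>m\<close> makes the product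
      \<open>m\<close> and the quotient 1.\<close>
    have "E (sqrt m) (sqrt m) = E 1 (sqrt m * sqrt m)" by (rule E3) (use that in auto)
    moreover have "E (sqrt m) (sqrt m) = E 1 (sqrt m / sqrt m)" by (rule E4) (use that in auto)
    ultimately show ?thesis using that by simp
  qed
  have "\<gamma> a + \<gamma> b = \<gamma> (a + b) + E 1 1" if ab: "0 < a" "0 < b" for a b
  proof -
    have "E (a + b) (a / b) = E 1 1" using E3[of "a + b" "a / b"] E5[of "(a + b) * (a / b)"] ab by simp
    moreover have "(a + b) * (a / b) / (1 + a / b) = a" "(a + b) / (1 + a / b) = b"
    proof -
      have "1 + a / b = (a + b) / b" using ab by (simp add: add_divide_distrib)
      then show "(a + b) * (a / b) / (1 + a / b) = a" "(a + b) / (1 + a / b) = b" using ab by simp_all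
    qed
    ultimately show ?thesis unfolding E_def by simp
  qed
  then show ?thesis by blast
qed

text \<open>The functional equation detached from the geometry: \<open>u\<close> and
  \<open>u'\<close> are the coordinates of the point \<open>y\<close> in the edge vectors of the two
  pieces, whose determinants are \<theta> r and (1 - \<theta>) r.\<close>

locale cut_function =
  fixes G :: "real \<Rightarrow> real ^ 'n \<Rightarrow> real"
  assumes card: "CARD('n) \<ge> 3"
    and cut: "\<And>i j \<theta> r u u' y. i \<noteq> j \<Longrightarrow> 0 < \<theta> \<Longrightarrow> \<theta> < 1 \<Longrightarrow> 0 < r \<Longrightarrow> y \<noteq> 0 \<Longrightarrow> u \<noteq> 0 \<Longrightarrow> u' \<noteq> 0
        \<Longrightarrow> cut_matrix i j \<theta> *v u = y \<Longrightarrow> cut_matrix j i (1 - \<theta>) *v u' = y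
        \<Longrightarrow> G r y = G (\<theta> * r) u + G ((1 - \<theta>) * r) u'"
    and perm: "\<And>i j r t. i \<noteq> j \<Longrightarrow> 0 < r \<Longrightarrow> t \<noteq> 0 \<Longrightarrow> G r (t *\<^sub>R axis i 1) = G r (t *\<^sub>R axis j 1)"
    and cont: "\<And>r. 0 < r \<Longrightarrow> continuous_on (- {0}) (G r)"
begin

lemma split:
  assumes ij: "i \<noteq> j" and z: "z $ i = 0" "z $ j = 0" and s: "\<sigma> \<noteq> 0" and th: "0 < \<theta>" "\<theta> < 1" and r: "0 < r"
  shows "G r (z + (\<sigma> * \<theta>) *\<^sub>R axis i 1 + (\<sigma> * (1 - \<theta>)) *\<^sub>R axis j 1)
    = G (\<theta> * r) (z + \<sigma> *\<^sub>R axis i 1) + G ((1 - \<theta>) * r) (z + \<sigma> *\<^sub>R axis j 1)"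
proof (rule cut[OF ij th r])
  let ?y = "z + (\<sigma> * \<theta>) *\<^sub>R axis i 1 + (\<sigma> * (1 - \<theta>)) *\<^sub>R axis j 1"
  have "?y $ i \<noteq> 0" "(z + \<sigma> *\<^sub>R axis i 1) $ i \<noteq> 0" "(z + \<sigma> *\<^sub>R axis j 1) $ j \<noteq> 0"
    using ij z s th by (auto simp: axis_def)
  then show "?y \<noteq> 0" "z + \<sigma> *\<^sub>R axis i 1 \<noteq> 0" "z + \<sigma> *\<^sub>R axis j 1 \<noteq> 0" by (metis zero_index)+
  show "cut_matrix i j \<theta> *v (z + \<sigma> *\<^sub>R axis i 1) = ?y"
    using ij z by (simp add: vec_eq_iff cut_matrix_mult axis_def)
  have "cut_matrix j i (1 - \<theta>) *v (z + \<sigma> *\<^sub>R axis j 1) = z + (\<sigma> * \<theta>) *\<^sub>R axis i 1 + (\<sigma> * (1 - \<theta>)) *\<^sub>R axis j 1"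
    using ij z by (simp add: vec_eq_iff cut_matrix_mult axis_def)
  then show "cut_matrix j i (1 - \<theta>) *v (z + \<sigma> *\<^sub>R axis j 1) = ?y" .
qed

text \<open>For coordinates of opposite sign the cut is read backwards: \<open>y\<close> is a point
  as seen from one piece of a larger simplex of determinant (1 - \<alpha>) r, and its value is a
  difference.\<close>

lemma split_outer:
  assumes ij: "i \<noteq> j" and z: "z $ i = 0" "z $ j = 0" and s: "\<sigma> \<noteq> 0" and a: "\<alpha> < 0" and r: "0 < r"
  shows "G r (z + (\<sigma> * \<alpha>) *\<^sub>R axis i 1 + (\<sigma> * (1 - \<alpha>)) *\<^sub>R axis j 1)
    = G ((1 - \<alpha>) * r) (z + \<sigma> *\<^sub>R axis j 1) - G (- \<alpha> * r) (z + \<sigma> *\<^sub>R axis j 1)"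
proof -
  let ?y = "z + (\<sigma> * \<alpha>) *\<^sub>R axis i 1 + (\<sigma> * (1 - \<alpha>)) *\<^sub>R axis j 1" and ?x = "z + \<sigma> *\<^sub>R axis j 1"
  \<comment> \<open>Chosen so that the second piece of the larger simplex has determinant exactly
    \<open>r\<close>.\<close>
  define \<theta> where "\<theta> = - \<alpha> / (1 - \<alpha>)"
  have th: "0 < \<theta>" "\<theta> < 1" using a by (auto simp: \<theta>_def field_simps)
  have e: "\<theta> * (1 - \<alpha>) = - \<alpha>" "(1 - \<theta>) * (1 - \<alpha>) = 1" using a by (auto simp: \<theta>_def field_simps)
  have "?y $ i \<noteq> 0" "?x $ j \<noteq> 0" using ij z s a by (auto simp: axis_def)
  then have ne: "?y \<noteq> 0" "?x \<noteq> 0" by (metis zero_index)+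
  have "G ((1 - \<alpha>) * r) ?x = G (\<theta> * ((1 - \<alpha>) * r)) ?x + G ((1 - \<theta>) * ((1 - \<alpha>) * r)) ?y"
  proof (rule cut[OF ij th _ ne(2,2,1)])
    show "0 < (1 - \<alpha>) * r" using a r by simp
    show "cut_matrix i j \<theta> *v ?x = ?x" using ij z by (simp add: vec_eq_iff cut_matrix_mult axis_def)
    have 1: "(1 - \<theta>) * (\<sigma> * (1 - \<alpha>)) = \<sigma>" using e(2) by (metis mult.commute mult.left_commute mult.right_neutral)
    have 2: "\<sigma> * \<alpha> + \<theta> * (\<sigma> * (1 - \<alpha>)) = 0" using e(1) by (simp add: mult.left_commute)
    show "cut_matrix j i (1 - \<theta>) *v ?y = ?x" using ij z 1 2 by (simp add: vec_eq_iff cut_matrix_mult axis_def)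
  qed
  moreover have "\<theta> * ((1 - \<alpha>) * r) = - \<alpha> * r" "(1 - \<theta>) * ((1 - \<alpha>) * r) = r"
    using e by (metis mult.assoc) (use e in \<open>metis mult.assoc mult_1\<close>)
  ultimately show ?thesis by simp
qed

definition \<gamma> :: "real \<Rightarrow> real \<Rightarrow> real" where
  "\<gamma> t r = G r (t *\<^sub>R axis (SOME i. True) 1)"

lemma G_axis: "0 < r \<Longrightarrow> t \<noteq> 0 \<Longrightarrow> G r (t *\<^sub>R axis i 1) = \<gamma> t r"
  unfolding \<gamma>_def using perm[of i "SOME i. True" r t] by (cases "i = (SOME i. True)") auto

lemma two_points:
  assumes ij: "i \<noteq> j" and t: "t \<noteq> 0" and pq: "0 < p" "0 < q"
  shows "G (p + q) ((t * (p / (p + q))) *\<^sub>R axis i 1 + (t * (q / (p + q))) *\<^sub>R axis j 1) = \<gamma> t p + \<gamma> t q"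
proof -
  have e: "1 - p / (p + q) = q / (p + q)" using pq by (simp add: field_simps)
  have th: "0 < p / (p + q)" "p / (p + q) < 1" using pq by auto
  show ?thesis
    using split[OF ij _ _ t th, of 0 "p + q"] pq t unfolding e by (simp add: G_axis)
qed

text \<open>The triangle is cut between \<open>i\<close> and \<open>j\<close>, and each half against
  \<open>k\<close>. The half belonging to \<nu> in {\<alpha>, \<beta>} has determinant \<nu> + \<nu>
  c / (\<alpha> + \<beta>), and its second cut separates these two summands. The right-hand side is
  tied to this order of cutting.\<close>

lemma three_points:
  assumes d: "i \<noteq> j" "i \<noteq> k" "j \<noteq> k" and t: "t \<noteq> 0" and p: "0 < \<alpha>" "0 < \<beta>" "0 < c"
    and r: "r = \<alpha> + \<beta> + c"
  shows "G r ((t * (c / r)) *\<^sub>R axis k 1 + (t * (\<alpha> / r)) *\<^sub>R axis i 1 + (t * (\<beta> / r)) *\<^sub>R axis j 1)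
    = \<gamma> t \<alpha> + \<gamma> t (\<alpha> * c / (\<alpha> + \<beta>)) + (\<gamma> t \<beta> + \<gamma> t (\<beta> * c / (\<alpha> + \<beta>)))"
proof -
  define S where "S = \<alpha> + \<beta>"
  have S: "S > 0" "S \<noteq> 0" and r0: "0 < r" "r \<noteq> 0" and rS: "r = S + c" using p r by (auto simp: S_def)
  define \<sigma> where "\<sigma> = t * (S / r)"
  define \<theta> where "\<theta> = \<alpha> / S"
  have s0: "\<sigma> \<noteq> 0" using t S r0 by (simp add: \<sigma>_def)
  have th: "0 < \<theta>" "\<theta> < 1" using p S by (auto simp: \<theta>_def S_def)
  have "1 - \<theta> = (S - \<alpha>) / S" using S by (simp add: \<theta>_def diff_divide_distrib)
  then have th': "1 - \<theta> = \<beta> / S" by (simp add: S_def)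
  have e: "\<sigma> * \<theta> = t * (\<alpha> / r)" "\<sigma> * (1 - \<theta>) = t * (\<beta> / r)"
    unfolding th' using S by (simp_all add: \<sigma>_def \<theta>_def)
  let ?z = "(t * (c / r)) *\<^sub>R axis k (1::real)"
  have half: "G (\<nu> / S * r) (?z + \<sigma> *\<^sub>R axis l 1) = \<gamma> t \<nu> + \<gamma> t (\<nu> * c / S)" if \<nu>: "0 < \<nu>" and l: "l \<noteq> k" for \<nu> l
  proof -
    have s: "\<nu> + \<nu> * c / S = \<nu> / S * r" using S by (simp add: rS distrib_left)
    have "\<nu> / (\<nu> / S * r) = S / r" "\<nu> * c / S / (\<nu> / S * r) = c / r"
      using S r0 \<nu> by simp_all
    moreover have "0 < \<nu> * c / S" using \<nu> p S by simp
    ultimately show ?thesis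
      using two_points[OF l t \<nu>, of "\<nu> * c / S"] unfolding s by (simp only: \<sigma>_def add.commute)
  qed
  have "G r (?z + (\<sigma> * \<theta>) *\<^sub>R axis i 1 + (\<sigma> * (1 - \<theta>)) *\<^sub>R axis j 1)
      = G (\<theta> * r) (?z + \<sigma> *\<^sub>R axis i 1) + G ((1 - \<theta>) * r) (?z + \<sigma> *\<^sub>R axis j 1)"
    by (rule split) (use d th r0 s0 in \<open>auto simp: axis_def\<close>)
  then show ?thesis
    unfolding e unfolding \<theta>_def th'[unfolded \<theta>_def] using half[of \<alpha> i] half[of \<beta> j] p d by (simp add: S_def)
qed

text \<open>Equating two orders of cutting the same triangle gives the hypothesis of
  \<open>constant_defect\<close>. The remaining constant \<delta> is detected on the segment from t
  e_j to t e_i: the value is \<gamma> t 1 + \<delta> in its interior and \<gamma> t 1 at the end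
  point.\<close>

lemma \<gamma>_cauchy:
  assumes t: "t \<noteq> 0" and ab: "0 < a" "0 < b"
  shows "\<gamma> t (a + b) = \<gamma> t a + \<gamma> t b"
proof -
  fix i :: 'n
  obtain j k where d: "i \<noteq> j" "i \<noteq> k" "j \<noteq> k" using exists_two_others[OF card, of i] by metis
  have "\<gamma> t \<alpha> + \<gamma> t (\<alpha> * c / (\<alpha> + \<beta>)) + \<gamma> t (\<beta> * c / (\<alpha> + \<beta>))
      = \<gamma> t c + \<gamma> t (\<alpha> * \<beta> / (\<beta> + c)) + \<gamma> t (\<alpha> * c / (\<beta> + c))"
    if p: "0 < \<alpha>" "0 < \<beta>" "0 < c" for \<alpha> \<beta> c
  proof -
    have "\<gamma> t \<alpha> + \<gamma> t (\<alpha> * c / (\<alpha> + \<beta>)) + (\<gamma> t \<beta> + \<gamma> t (\<beta> * c / (\<alpha> + \<beta>)))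
        = \<gamma> t \<beta> + \<gamma> t (\<beta> * \<alpha> / (\<beta> + c)) + (\<gamma> t c + \<gamma> t (c * \<alpha> / (\<beta> + c)))"
      using three_points[OF d t p refl] three_points[of j k i t \<beta> c \<alpha> "\<alpha> + \<beta> + c"] d t p
      by (simp add: add_ac)
    then show ?thesis by (simp add: mult.commute)
  qed
  then obtain \<delta> where \<delta>: "\<And>a b. 0 < a \<Longrightarrow> 0 < b \<Longrightarrow> \<gamma> t a + \<gamma> t b = \<gamma> t (a + b) + \<delta>"
    using constant_defect[of "\<gamma> t"] by blast
  have "((\<lambda>\<theta>. G 1 (t *\<^sub>R axis j 1 + \<theta> *\<^sub>R (t *\<^sub>R axis i 1 - t *\<^sub>R axis j 1))) \<longlongrightarrow> G 1 (t *\<^sub>R axis j 1)) (at_right 0)"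
    by (rule filterlim_mono[OF continuous_line_limit[OF cont] order_refl]) (use t in \<open>auto simp: at_le\<close>)
  moreover have "\<forall>\<^sub>F \<theta> in at_right 0. G 1 (t *\<^sub>R axis j 1 + \<theta> *\<^sub>R (t *\<^sub>R axis i 1 - t *\<^sub>R axis j 1)) = \<gamma> t 1 + \<delta>"
  proof (rule eventually_at_rightI[of 0 1])
    fix \<theta> :: real assume th: "\<theta> \<in> {0<..<1}"
    have "t *\<^sub>R axis j 1 + \<theta> *\<^sub>R (t *\<^sub>R axis i 1 - t *\<^sub>R axis j 1)
      = (t * \<theta>) *\<^sub>R axis i 1 + (t * (1 - \<theta>)) *\<^sub>R axis j (1::real)" by (simp add: algebra_simps)
    then show "G 1 (t *\<^sub>R axis j 1 + \<theta> *\<^sub>R (t *\<^sub>R axis i 1 - t *\<^sub>R axis j 1)) = \<gamma> t 1 + \<delta>"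
      using two_points[OF d(1) t, of \<theta> "1 - \<theta>"] \<delta>[of \<theta> "1 - \<theta>"] th by simp
  qed simp
  ultimately have "((\<lambda>\<theta>. \<gamma> t 1 + \<delta>) \<longlongrightarrow> G 1 (t *\<^sub>R axis j 1)) (at_right (0::real))"
    using tendsto_cong by fastforce
  then have "\<gamma> t 1 + \<delta> = \<gamma> t 1" using t by (simp add: tendsto_const_iff G_axis)
  then show ?thesis using \<delta>[OF ab] by simp
qed

text \<open>Two coordinates are merged into one with the same sum, by an inner or an outer split
  according to their signs, and additivity of \<gamma> restores the determinant.\<close>

lemma G_eq_\<gamma>:
  assumes "0 < r" "(\<Sum>a\<in>UNIV. y $ a) = t" "t \<noteq> 0"
  shows "G r y = \<gamma> t r"
  using assms(1,2)
proof (induction "card {a. y $ a \<noteq> 0}" arbitrary: y r rule: less_induct)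
  case less
  let ?S = "\<lambda>y. {a. y $ a \<noteq> (0::real)}"
  obtain i where i: "y $ i \<noteq> 0" using less.prems assms(3) by (metis sum.neutral)
  show ?case
  proof (cases "?S y = {i}")
    case True
    then have yi: "y = y $ i *\<^sub>R axis i 1" by (auto simp: vec_eq_iff axis_def)
    have "(\<Sum>a\<in>UNIV. y $ a) = (\<Sum>a\<in>{i}. y $ a)" by (rule sum.mono_neutral_right) (use True in auto)
    then have "y $ i = t" using less.prems by simp
    then show ?thesis using G_axis[OF less.prems(1) assms(3), of i] yi by simp
  next
    case False
    \<comment> \<open>Merging must not cancel. If all pairs of nonzero coordinates cancelled, there
      could be only two of them, and the coordinate sum would be 0.\<close>
    have "\<exists>i j. i \<noteq> j \<and> y $ i \<noteq> 0 \<and> y $ j \<noteq> 0 \<and> y $ i + y $ j \<noteq> 0"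
    proof (rule ccontr)
      assume "\<not> ?thesis"
      then have opp: "y $ a + y $ b = 0" if "a \<noteq> b" "y $ a \<noteq> 0" "y $ b \<noteq> 0" for a b using that by blast
      obtain j where j: "j \<noteq> i" "y $ j \<noteq> 0" using False i by auto
      have "y $ a = 0" if "a \<noteq> i" "a \<noteq> j" for a
      proof (rule ccontr)
        assume "y $ a \<noteq> 0"
        then have "y $ i + y $ j = 0" "y $ i + y $ a = 0" "y $ j + y $ a = 0" using opp i j that by metis+
        then show False using i by simp
      qed
      then have "(\<Sum>a\<in>UNIV. y $ a) = (\<Sum>a\<in>{i,j}. y $ a)" by (intro sum.mono_neutral_right) auto
      also have "\<dots> = 0" using opp[of i j] i j by simp
      finally show False using less.prems assms(3) by simp
    qed
    then obtain i j where ij: "i \<noteq> j" "y $ i \<noteq> 0" "y $ j \<noteq> 0" and s: "y $ i + y $ j \<noteq> 0" by blast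
    define \<sigma> where "\<sigma> = y $ i + y $ j"
    define \<alpha> where "\<alpha> = y $ i / \<sigma>"
    define z where "z = y - y $ i *\<^sub>R axis i 1 - y $ j *\<^sub>R axis j 1"
    have z0: "z $ i = 0" "z $ j = 0" using ij by (auto simp: z_def axis_def)
    have s0: "\<sigma> \<noteq> 0" using s by (simp add: \<sigma>_def)
    have sa: "\<sigma> * \<alpha> = y $ i" "\<sigma> * (1 - \<alpha>) = y $ j" using s0 by (simp_all add: \<alpha>_def right_diff_distrib) (simp add: \<sigma>_def)
    have a01: "\<alpha> \<noteq> 0" "\<alpha> \<noteq> 1" using sa ij by auto
    have y: "y = z + (\<sigma> * \<alpha>) *\<^sub>R axis i 1 + (\<sigma> * (1 - \<alpha>)) *\<^sub>R axis j 1" unfolding sa by (simp add: z_def)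
    have y': "y = z + (\<sigma> * (1 - \<alpha>)) *\<^sub>R axis j 1 + (\<sigma> * (1 - (1 - \<alpha>))) *\<^sub>R axis i 1" using y by (simp add: add_ac)
    have IH: "G r' (z + \<sigma> *\<^sub>R axis k 1) = \<gamma> t r'" if "0 < r'" "k = i \<or> k = j" for r' k
    proof (rule less.hyps)
      have "?S (z + \<sigma> *\<^sub>R axis k 1) \<subseteq> ?S y - (if k = i then {j} else {i})"
        using that(2) ij z0 by (auto simp: z_def axis_def split: if_splits)
      moreover have "card (?S y - (if k = i then {j} else {i})) < card (?S y)"
        using card_Diff1_less[of "?S y" j] card_Diff1_less[of "?S y" i] ij by simp
      ultimately show "card (?S (z + \<sigma> *\<^sub>R axis k 1)) < card (?S y)"
        by (meson card_mono finite le_less_trans)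
      have "(\<Sum>a\<in>UNIV. (z + \<sigma> *\<^sub>R axis k 1) $ a) = (\<Sum>a\<in>UNIV. y $ a)"
        unfolding z_def \<sigma>_def sum_component_simps by simp
      then show "(\<Sum>a\<in>UNIV. (z + \<sigma> *\<^sub>R axis k 1) $ a) = t" using less.prems by simp
    qed (rule that(1))
    consider "0 < \<alpha>" "\<alpha> < 1" | "\<alpha> < 0" | "\<alpha> > 1" using a01 by linarith
    then show ?thesis
    proof cases
      case 1
      have "G r y = \<gamma> t (\<alpha> * r) + \<gamma> t ((1 - \<alpha>) * r)"
        by (subst y, subst split[OF ij(1) z0 s0 1 less.prems(1)]) (use 1 less.prems(1) in \<open>simp add: IH\<close>)
      also have "\<dots> = \<gamma> t r"
        using \<gamma>_cauchy[OF assms(3), of "\<alpha> * r" "(1 - \<alpha>) * r"] 1 less.prems(1) by (simp add: algebra_simps)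
      finally show ?thesis .
    next
      case 2
      have "G r y = \<gamma> t ((1 - \<alpha>) * r) - \<gamma> t (- \<alpha> * r)"
        by (subst y, subst split_outer[OF ij(1) z0 s0 2 less.prems(1)])
           (use 2 less.prems(1) in \<open>simp add: IH mult_neg_pos\<close>)
      also have "\<dots> = \<gamma> t r"
        using \<gamma>_cauchy[OF assms(3), of "- \<alpha> * r" r] 2 less.prems(1) by (simp add: algebra_simps mult_neg_pos)
      finally show ?thesis .
    next
      case 3
      then have neg: "1 - \<alpha> < 0" by simp
      have "G r y = \<gamma> t (\<alpha> * r) - \<gamma> t (- (1 - \<alpha>) * r)"
        by (subst y', subst split_outer[OF ij(1)[symmetric] z0(2,1) s0 neg less.prems(1)])
           (use 3 less.prems(1) in \<open>simp add: IH\<close>)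
      also have "\<dots> = \<gamma> t r"
        using \<gamma>_cauchy[OF assms(3), of "- (1 - \<alpha>) * r" r] 3 less.prems(1) by (simp add: algebra_simps)
      finally show ?thesis .
    qed
  qed
qed

text \<open>For t = 0 no multiple of an axis vector is admissible, so \<zeta> is defined along a
  path of nonzero points instead; its properties at t = 0 are limits of those for other t.\<close>

lemma G_representation:
  "\<exists>\<zeta>. (\<forall>t. cauchy_function (\<zeta> t)) \<and> (\<forall>s>0. continuous_on UNIV (\<lambda>t. \<zeta> t s)) \<and>
    (\<forall>r>0. \<forall>y. y \<noteq> 0 \<longrightarrow> G r y = \<zeta> (\<Sum>a\<in>UNIV. y $ a) r)"
proof -
  fix k :: 'n
  obtain i j :: 'n where ij: "i \<noteq> j" using exists_two_others[OF card, of k] by blast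
  \<comment> \<open>The component -1 along e_j keeps the path away from the origin, and the
    coordinate sum of \<open>p t\<close> is t.\<close>
  define p where "p t = (axis i 1 - axis j 1 + t *\<^sub>R axis i 1 :: real ^ 'n)" for t
  have "p t $ j \<noteq> 0" for t using ij by (auto simp: p_def axis_def)
  then have p0: "p t \<noteq> 0" for t by (metis zero_index)
  have ps: "(\<Sum>a\<in>UNIV. p t $ a) = t" for t
    unfolding p_def sum_component_simps by simp
  define \<zeta> where "\<zeta> t r = G r (p t)" for t r
  have z\<gamma>: "\<zeta> t r = \<gamma> t r" if "0 < r" "t \<noteq> 0" for t r
    unfolding \<zeta>_def by (rule G_eq_\<gamma>[OF that(1) ps that(2)])
  have cz: "continuous_on UNIV (\<lambda>t. \<zeta> t r)" if "0 < r" for r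
    unfolding \<zeta>_def by (rule continuous_on_compose2[OF cont[OF that]]) (use p0 in \<open>auto simp: p_def intro!: continuous_intros\<close>)
  have lim: "((\<lambda>t. \<zeta> t r) \<longlongrightarrow> \<zeta> 0 r) (at 0)" if "0 < r" for r
    using cz[OF that] by (simp add: continuous_on_eq_continuous_at isCont_def)
  have ev: "\<forall>\<^sub>F t in at (0::real). t \<noteq> 0" by (simp add: eventually_at_filter)
  have "\<zeta> t (r + s) = \<zeta> t r + \<zeta> t s" if rs: "0 < r" "0 < s" for t r s
  proof (cases "t = 0")
    case True
    have "((\<lambda>t. \<zeta> t r + \<zeta> t s) \<longlongrightarrow> \<zeta> 0 r + \<zeta> 0 s) (at 0)" by (intro tendsto_intros lim rs)
    moreover have "\<forall>\<^sub>F t in at 0. \<zeta> t r + \<zeta> t s = \<zeta> t (r + s)"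
      using ev by eventually_elim (use rs in \<open>simp add: z\<gamma> \<gamma>_cauchy\<close>)
    ultimately have "((\<lambda>t. \<zeta> t (r + s)) \<longlongrightarrow> \<zeta> 0 r + \<zeta> 0 s) (at 0)" by (rule Lim_transform_eventually)
    then show ?thesis using tendsto_unique[OF _ lim[of "r + s"]] rs True by (metis add_pos_pos at_neq_bot)
  qed (use rs in \<open>simp add: z\<gamma> \<gamma>_cauchy\<close>)
  moreover have "G r y = \<zeta> (\<Sum>a\<in>UNIV. y $ a) r" if r: "0 < r" and y: "y \<noteq> 0" for r y
  proof (cases "(\<Sum>a\<in>UNIV. y $ a) = 0")
    case True
    have s: "(\<Sum>a\<in>UNIV. (y + t *\<^sub>R axis i 1) $ a) = t" for t
      unfolding sum_component_simps using True by simp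
    have "\<forall>\<^sub>F t in at 0. G r (y + t *\<^sub>R axis i 1) = \<zeta> t r"
      using ev by eventually_elim (use r in \<open>simp add: z\<gamma> G_eq_\<gamma>[OF r s]\<close>)
    then have "((\<lambda>t. \<zeta> t r) \<longlongrightarrow> G r y) (at 0)"
      using continuous_line_limit[OF cont[OF r] y] by (rule Lim_transform_eventually[rotated])
    then show ?thesis using tendsto_unique[OF _ lim[OF r]] True by (metis at_neq_bot)
  qed (use r in \<open>simp add: z\<gamma> G_eq_\<gamma>\<close>)
  ultimately show ?thesis using cz unfolding cauchy_function_def by blast
qed

end

section \<open>Full-dimensional simplices\<close>

lemma swap_matrix_corner_UNIV: "(*v) (swap_matrix i j) ` corner UNIV = corner UNIV"
  by (rule swap_matrix_image) (rule permutes_image[OF permutes_swap_id, symmetric], auto)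

definition scaling :: "real \<Rightarrow> real ^ 'n ^ 'n" where
  "scaling r = mat (root CARD('n) r)"

lemma det_scaling: "0 < r \<Longrightarrow> det (scaling r :: real ^ 'n ^ 'n) = r"
  unfolding scaling_def by (subst det_diagonal) (auto simp: mat_def)

locale simple_sl_valuation = sl_valuation Z for Z :: "(real ^ 'n) set \<Rightarrow> real ^ 'n \<Rightarrow> real" +
  assumes card: "CARD('n) \<ge> 3"
    and low: "\<And>J y. J \<noteq> UNIV \<Longrightarrow> y \<noteq> 0 \<Longrightarrow> Z (corner J) y = 0"
begin

lemma low_image:
  assumes "J \<noteq> UNIV" "det B \<noteq> 0" "x \<noteq> 0"
  shows "Z ((*v) B ` corner J) x = 0"
proof -
  obtain k where "k \<notin> J" using assms(1) by auto
  then show ?thesis using Z_const_image[of J 0 k B x] low assms by blast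
qed

definition G :: "real \<Rightarrow> real ^ 'n \<Rightarrow> real" where
  "G r y = Z ((*v) (scaling r) ` corner UNIV) (scaling r *v y)"

text \<open>Two matrices of the same positive determinant differ by a factor in SL(n), so the
  multiple of the identity in the definition of \<open>G\<close> represents them all.\<close>

lemma G_matrix:
  assumes d: "0 < det A" and y: "y \<noteq> 0"
  shows "Z ((*v) A ` corner UNIV) (A *v y) = G (det A) y"
proof -
  let ?S = "scaling (det A) :: real ^ 'n ^ 'n"
  have dSA: "det ?S = det A" by (rule det_scaling[OF d])
  then have dS: "det ?S \<noteq> 0" using d by simp
  define B where "B = A ** matrix_inv ?S"
  have "det (matrix_inv ?S) * det ?S = 1"
    using matrix_inv_det(1)[OF dS] by (metis det_I det_mul)
  then have "det B = 1" unfolding B_def det_mul dSA by (simp add: mult.commute)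
  moreover have BS: "B *v (?S *v z) = A *v z" for z
    unfolding B_def by (simp add: matrix_inv_det[OF dS] flip: matrix_vector_mul_assoc)
  then have "(*v) B ` (*v) ?S ` corner UNIV = (*v) A ` corner UNIV" by (simp add: image_image)
  ultimately show ?thesis
    using SL_contravariantD[OF contra matrix_image_polytopes_o[OF corner_polytopes_o], of B "?S *v y" ?S UNIV]
      matrix_mult_nonzero[OF dS y] BS by (simp add: G_def)
qed

lemma cut_function_G: "cut_function G"
proof
  show "CARD('n) \<ge> 3" by (rule card)
next
  fix i j :: 'n and \<theta> r :: real and y u u' :: "real ^ 'n"
  assume ij: "i \<noteq> j" and th: "0 < \<theta>" "\<theta> < 1" and r: "0 < r" and ne: "y \<noteq> 0" "u \<noteq> 0" "u' \<noteq> 0"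
    and u: "cut_matrix i j \<theta> *v u = y" "cut_matrix j i (1 - \<theta>) *v u' = y"
  let ?S = "scaling r :: real ^ 'n ^ 'n" and ?C = "cut_matrix i j \<theta>" and ?C' = "cut_matrix j i (1 - \<theta>)"
  have dS: "det ?S = r" by (rule det_scaling[OF r])
  have d: "det (?S ** ?C) = \<theta> * r" "det (?S ** ?C') = (1 - \<theta>) * r"
    using ij dS by (simp_all add: det_mul det_cut_matrix)
  have x: "?S *v y \<noteq> 0" using matrix_mult_nonzero[of ?S y] dS r ne by simp
  have "Z ((*v) ?S ` corner UNIV) (?S *v y) + Z ((*v) (?S ** ?C) ` corner (UNIV - {j})) (?S *v y)
      = Z ((*v) (?S ** ?C) ` corner UNIV) (?S *v y) + Z ((*v) (?S ** ?C') ` corner UNIV) (?S *v y)"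
    by (rule Z_cut) (use ij th dS r x in auto)
  moreover have "Z ((*v) (?S ** ?C) ` corner (UNIV - {j})) (?S *v y) = 0"
    by (rule low_image) (use d th r x in auto)
  moreover have "Z ((*v) (?S ** ?C) ` corner UNIV) (?S *v y) = G (\<theta> * r) u"
  proof -
    have "(?S ** ?C) *v u = ?S *v y" by (simp only: matrix_vector_mul_assoc[symmetric] u)
    moreover have "0 < det (?S ** ?C)" unfolding d using th r by simp
    ultimately show ?thesis using G_matrix[of "?S ** ?C" u] ne d by metis
  qed
  moreover have "Z ((*v) (?S ** ?C') ` corner UNIV) (?S *v y) = G ((1 - \<theta>) * r) u'"
  proof -
    have "(?S ** ?C') *v u' = ?S *v y" by (simp only: matrix_vector_mul_assoc[symmetric] u)
    moreover have "0 < det (?S ** ?C')" unfolding d using th r by simp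
    ultimately show ?thesis using G_matrix[of "?S ** ?C'" u'] ne d by metis
  qed
  ultimately show "G r y = G (\<theta> * r) u + G ((1 - \<theta>) * r) u'" by (simp add: G_def)
next
  fix i j :: 'n and r t :: real assume ij: "i \<noteq> j" and r: "0 < r" and t: "t \<noteq> 0"
  obtain k where k: "k \<noteq> i" "k \<noteq> j" using exists_two_others[OF card, of i] by metis
  \<comment> \<open>A single transposition has determinant -1; a second one involving a third axis
    restores determinant 1 without moving e_i.\<close>
  let ?S = "scaling r :: real ^ 'n ^ 'n" and ?W = "swap_matrix i j ** swap_matrix j k"
  have dW: "det ?W = 1" using ij k by (simp add: det_mul det_swap_matrix)
  have "(*v) (?S ** ?W) ` corner UNIV = (*v) ?S ` (*v) (swap_matrix i j) ` (*v) (swap_matrix j k) ` corner UNIV"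
    unfolding image_image matrix_vector_mul_assoc ..
  then have W: "(*v) (?S ** ?W) ` corner UNIV = (*v) ?S ` corner UNIV" by (simp only: swap_matrix_corner_UNIV)
  have Wi: "?W *v (t *\<^sub>R axis i 1) = t *\<^sub>R axis j 1"
  proof -
    have "swap_matrix j k *v (t *\<^sub>R axis i 1) = t *\<^sub>R axis i 1"
      using ij k by (auto simp: vec_eq_iff swap_matrix_mult axis_def Transposition.transpose_def)
    moreover have "swap_matrix i j *v (t *\<^sub>R axis i 1) = t *\<^sub>R axis j 1"
      using ij by (auto simp: vec_eq_iff swap_matrix_mult axis_def Transposition.transpose_def)
    ultimately show ?thesis by (simp only: matrix_vector_mul_assoc[symmetric])
  qed
  have d: "det (?S ** ?W) = r" using dW det_scaling[OF r] by (simp add: det_mul)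
  have "G r (t *\<^sub>R axis i 1) = Z ((*v) (?S ** ?W) ` corner UNIV) ((?S ** ?W) *v (t *\<^sub>R axis i 1))"
  proof -
    have "t *\<^sub>R axis i 1 \<noteq> (0 :: real ^ 'n)" using t by simp
    then show ?thesis using G_matrix[of "?S ** ?W" "t *\<^sub>R axis i 1"] unfolding d using r by metis
  qed
  also have "\<dots> = G r (t *\<^sub>R axis j 1)"
    unfolding W G_def by (simp only: matrix_vector_mul_assoc[symmetric, of ?S ?W] Wi)
  finally show "G r (t *\<^sub>R axis i 1) = G r (t *\<^sub>R axis j 1)" .
next
  fix r :: real assume r: "0 < r"
  let ?S = "scaling r :: real ^ 'n ^ 'n"
  have dS: "det ?S \<noteq> 0" unfolding det_scaling[OF r] using r by simp
  have im: "(*v) ?S ` (- {0}) \<subseteq> - {0}"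
  proof
    fix z assume "z \<in> (*v) ?S ` (- {0})"
    then obtain y where "y \<noteq> 0" "z = ?S *v y" by (elim imageE) simp
    then show "z \<in> - {0}" using matrix_mult_nonzero[OF dS] by simp
  qed
  have c: "continuous_on (- {0}) ((*v) (scaling r :: real ^ 'n ^ 'n))"
    by (intro linear_continuous_on matrix_vector_mul_bounded_linear)
  show "continuous_on (- {0}) (G r)"
    unfolding G_def
    by (rule continuous_on_compose2[OF cont[OF matrix_image_polytopes_o[OF corner_polytopes_o]] c im])
qed

lemma full_dim_representation:
  "\<exists>\<zeta>. (\<forall>t. cauchy_function (\<zeta> t)) \<and> (\<forall>s>0. continuous_on UNIV (\<lambda>t. \<zeta> t s)) \<and>
    (\<forall>A y. 0 < det A \<longrightarrow> y \<noteq> 0 \<longrightarrow> Z ((*v) A ` corner UNIV) (A *v y) = \<zeta> (\<Sum>a\<in>UNIV. y $ a) (det A))"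
proof -
  interpret cut_function G by (rule cut_function_G)
  obtain \<zeta> where z: "\<forall>t. cauchy_function (\<zeta> t)" "\<forall>s>0. continuous_on UNIV (\<lambda>t. \<zeta> t s)"
    and G: "\<forall>r>0. \<forall>y. y \<noteq> 0 \<longrightarrow> G r y = \<zeta> (\<Sum>a\<in>UNIV. y $ a) r"
    using G_representation by (elim exE conjE)
  show ?thesis
  proof (intro exI[of _ \<zeta>] conjI z allI impI)
    fix A :: "real ^ 'n ^ 'n" and y :: "real ^ 'n" assume *: "0 < det A" "y \<noteq> 0"
    show "Z ((*v) A ` corner UNIV) (A *v y) = \<zeta> (\<Sum>a\<in>UNIV. y $ a) (det A)"
      unfolding G_matrix[OF *] using G * by blast
  qed
qed

end

section \<open>The terms of the formula on coordinate simplices\<close>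

lemma aff_dim_corner: "aff_dim (corner J) = int (card J)"
proof -
  let ?B = "(\<lambda>j. axis j (1::real)) ` J"
  have "independent ?B"
    by (rule independent_mono[OF independent_Basis]) (auto simp: axis_in_Basis_iff)
  moreover have "card ?B = card J" by (rule card_image) (auto simp: inj_on_def axis_eq_axis)
  moreover have "span (insert 0 ?B) = span ?B" by (rule span_insert_0)
  ultimately have "dim (insert 0 ?B) = card J" by (metis dim_eq_card_independent dim_span)
  moreover have "0 \<in> affine hull (insert 0 ?B)" by (simp add: hull_inc)
  ultimately show ?thesis unfolding corner_eq_hull aff_dim_convex_hull by (simp only: aff_dim_zero)
qed

lemma axis_in_corner: "j \<in> J \<Longrightarrow> axis j 1 \<in> corner J"
  unfolding corner_eq_hull by (intro hull_inc) auto

lemma facet_normals_empty: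
  fixes P :: "(real ^ 'n) set"
  assumes "aff_dim P < int CARD('n) - 1"
  shows "facet_normals P = {}"
proof -
  have "aff_dim (face_in_direction P u) < int CARD('n) - 1" for u
    using aff_dim_subset[OF face_in_direction_subset[of P u]] assms by linarith
  then have "aff_dim (face_in_direction P u) \<noteq> int CARD('n) - 1" for u by (metis less_irrefl)
  then show ?thesis unfolding facet_normals_def by blast
qed

text \<open>A set of dimension n - 1 inside a lower-dimensional polytope spans its whole affine
  hull, which contains the origin; the support value is therefore 0.\<close>

lemma facet_normals_o_empty:
  fixes P :: "(real ^ 'n) set"
  assumes P: "aff_dim P < int CARD('n)" "0 \<in> P"
  shows "facet_normals_o P = {}"
proof -
  have "support_fun P u = 0" if "u \<in> facet_normals P" for u
  proof -
    let ?F = "face_in_direction P u"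
    have aF: "aff_dim ?F = int CARD('n) - 1" using that by (simp add: facet_normals_def)
    then have ne: "?F \<noteq> {}" by (auto simp: aff_dim_empty_eq)
    have sub: "affine hull ?F \<subseteq> affine hull P" by (intro hull_mono face_in_direction_subset)
    then have "aff_dim (affine hull ?F) = aff_dim (affine hull P)"
      using aF P(1) aff_dim_subset[OF sub] by (simp add: aff_dim_affine_hull)
    then have "affine hull ?F = affine hull P"
      using ne sub by (intro affine_dim_equal) (auto simp: affine_affine_hull)
    then have "0 \<in> affine hull ?F" using P(2) by (simp add: hull_inc)
    moreover have "affine hull ?F \<subseteq> {y. u \<bullet> y = support_fun P u}"
      by (rule hull_minimal) (auto simp: face_in_direction_Int affine_hyperplane)
    ultimately show ?thesis by auto
  qed
  then show ?thesis by (auto simp: facet_normals_o_def)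
qed

lemma Pi_zeta_corner_lower: "J \<noteq> UNIV \<Longrightarrow> Pi_zeta \<zeta> (corner J) x = 0"
proof -
  assume "J \<noteq> UNIV"
  then have "card J < CARD('a)" by (intro psubset_card_mono) auto
  then show ?thesis
    using facet_normals_o_empty[of "corner J"] polytopes_oD(2)[OF corner_polytopes_o[of J]]
    by (simp add: aff_dim_corner Pi_zeta_def)
qed

text \<open>The facet opposite the origin has all coordinates of its normal equal, and dividing by
  the support value turns the inner product into the coordinate sum.\<close>

lemma corner_simplex_facet:
  defines "u \<equiv> (\<chi> i. 1 / sqrt (real CARD('n))) :: real ^ 'n"
  shows "facet_normals_o (corner UNIV) = {u}" "x \<bullet> u / support_fun (corner UNIV) u = (\<Sum>a\<in>UNIV. x $ a)"
proof -
  let ?T = "corner UNIV :: (real ^ 'n) set" and ?s = "1 / sqrt (real CARD('n))"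
  have s0: "?s > 0" by simp
  note T = polytopes_oD[OF corner_polytopes_o[of "UNIV :: 'n set"]]
  have in_u: "y \<bullet> u = ?s * (\<Sum>a\<in>UNIV. y $ a)" for y
    by (simp add: u_def inner_vec_def sum_divide_distrib)
  have nu: "norm u = 1" by (simp add: norm_eq_1 in_u) (simp add: u_def real_div_sqrt)
  have supp: "support_fun ?T u = ?s"
  proof -
    fix j :: 'n
    have "support_fun ?T u = u \<bullet> axis j 1"
      by (rule support_fun_eqI[OF axis_in_corner])
         (auto simp: in_u inner_commute[of u] sum_axis corner_def mult_left_le divide_right_mono)
    then show ?thesis by (simp add: inner_commute[of u] in_u sum_axis)
  qed
  show "x \<bullet> u / support_fun ?T u = (\<Sum>a\<in>UNIV. x $ a)" using s0 by (simp add: supp in_u)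
  have "u \<in> facet_normals ?T"
  proof -
    let ?F = "face_in_direction ?T u" and ?B = "range (\<lambda>j. axis j (1::real)) :: (real ^ 'n) set"
    have sub: "?B \<subseteq> ?F" by (auto simp: face_in_direction_def supp in_u sum_axis axis_in_corner)
    have "int CARD('n) = aff_dim (insert 0 ?B)"
      using aff_dim_corner[of "UNIV :: 'n set"] unfolding corner_eq_hull aff_dim_convex_hull by simp
    also have "\<dots> \<le> aff_dim ?B + 1" by (simp add: aff_dim_insert)
    also have "\<dots> \<le> aff_dim ?F + 1" using aff_dim_subset[OF sub] by simp
    finally have "aff_dim ?F \<ge> int CARD('n) - 1" by simp
    moreover have "aff_dim ?F \<le> aff_dim {y. u \<bullet> y = support_fun ?T u}"
      by (rule aff_dim_subset) (auto simp: face_in_direction_Int)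
    moreover have "u \<noteq> 0" using nu by auto
    ultimately show ?thesis using nu by (simp add: facet_normals_def)
  qed
  then have 1: "u \<in> facet_normals_o ?T" using supp s0 by (simp add: facet_normals_o_def)
  have "v = u" if "v \<in> facet_normals_o ?T" for v
  proof -
    let ?F = "face_in_direction ?T v" and ?h = "support_fun ?T v"
    have nv: "norm v = 1" and aF: "aff_dim ?F = int CARD('n) - 1"
      using that by (auto simp: facet_normals_o_def facet_normals_def)
    have h: "?h > 0" using cone_volume_pos[OF corner_polytopes_o that] by simp
    have le: "v $ j \<le> ?h" for j
      using support_fun_ge[OF T(3) axis_in_corner[of j UNIV], of v] by (simp add: inner_axis')
    \<comment> \<open>A smaller coordinate \<open>v $ j\<close> would force the facet into the
      hyperplane \<open>y $ j = 0\<close>. By dimension that would be its own hyperplane, which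
      would then contain the origin.\<close>
    have "v $ j = ?h" for j
    proof (rule ccontr)
      assume "v $ j \<noteq> ?h"
      then have lt: "v $ j < ?h" using le[of j] by simp
      have Fj: "y $ j = 0" if y: "y \<in> ?F" for y
      proof (rule ccontr)
        assume yj: "y $ j \<noteq> 0"
        have yT: "\<And>a. 0 \<le> y $ a" "(\<Sum>a\<in>UNIV. y $ a) \<le> 1"
          using y by (auto simp: face_in_direction_def corner_def)
        have "y \<bullet> v = (\<Sum>a\<in>UNIV. y $ a * v $ a)" by (simp add: inner_vec_def)
        also have "\<dots> < (\<Sum>a\<in>UNIV. y $ a * ?h)"
        proof (rule sum_strict_mono_ex1)
          show "\<forall>a\<in>UNIV. y $ a * v $ a \<le> y $ a * ?h" using yT le by (auto intro: mult_left_mono)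
          show "\<exists>a\<in>UNIV. y $ a * v $ a < y $ a * ?h"
            using yj yT(1)[of j] lt by (intro bexI[of _ j]) (auto simp: less_le)
        qed simp
        also have "\<dots> = (\<Sum>a\<in>UNIV. y $ a) * ?h" by (simp add: sum_distrib_right)
        also have "\<dots> \<le> 1 * ?h" using yT(2) h by (intro mult_right_mono) auto
        finally show False using face_in_direction_inner[OF y] by simp
      qed
      have Fne: "?F \<noteq> {}" by (rule face_in_direction_nonempty[OF T(3,5)])
      have eqH: "affine hull ?F = H" if H: "?F \<subseteq> H" "affine H" "aff_dim H = int CARD('n) - 1" for H
      proof (rule affine_dim_equal[OF affine_affine_hull H(2)])
        show "affine hull ?F \<subseteq> H" by (rule hull_minimal) (fact H)+
        show "affine hull ?F \<noteq> {}" using Fne by simp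
        show "aff_dim (affine hull ?F) = aff_dim H" using aF H(3) by (simp only: aff_dim_affine_hull)
      qed
      have "v \<noteq> 0" using nv by auto
      then have "affine hull ?F = {y. v \<bullet> y = ?h}"
        by (intro eqH affine_hyperplane) (auto simp: face_in_direction_Int)
      moreover have "affine hull ?F = {y. axis j 1 \<bullet> y = 0}"
      proof (intro eqH affine_hyperplane)
        show "aff_dim {y. axis j (1::real) \<bullet> y = 0} = int CARD('n) - 1" by simp
      qed (auto simp: Fj inner_axis')
      ultimately have eq: "{y. axis j 1 \<bullet> y = 0} = {y. v \<bullet> y = ?h}" by (metis (no_types))
      have "0 \<in> {y. axis j (1::real) \<bullet> y = 0}" by simp
      then have "0 \<in> {y. v \<bullet> y = ?h}" unfolding eq .
      then show False using h by simp
    qed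
    with h obtain h where h: "0 < h" "\<And>j. v $ j = h" by metis
    let ?one = "(\<chi> i. 1) :: real ^ 'n"
    have v: "v = h *\<^sub>R ?one" by (simp add: vec_eq_iff h)
    have u: "u = ?s *\<^sub>R ?one" by (simp add: vec_eq_iff u_def)
    have "h * norm ?one = 1" using nv h(1) unfolding v by simp
    moreover have "?s * norm ?one = 1" using nu s0 unfolding u by simp
    ultimately have "h = ?s" by (metis mult_cancel_right mult_zero_right zero_neq_one)
    then show ?thesis unfolding v u by simp
  qed
  then show "facet_normals_o ?T = {u}" using 1 by blast
qed

text \<open>\<kappa> is the cone volume of the single facet off the origin, that is, the volume of
  the coordinate simplex. It converts determinants into cone volumes.\<close>

lemma Pi_zeta_corner:
  "\<exists>\<kappa>>0. \<forall>\<zeta> x. Pi_zeta \<zeta> (corner UNIV) (x :: real ^ 'n) = \<zeta> (\<Sum>a\<in>UNIV. x $ a) \<kappa>"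
proof -
  let ?u = "(\<chi> i. 1 / sqrt (real CARD('n))) :: real ^ 'n"
  have "0 < cone_volume (corner UNIV) ?u"
    by (rule cone_volume_pos[OF corner_polytopes_o]) (simp add: corner_simplex_facet)
  moreover have "Pi_zeta \<zeta> (corner UNIV) x = \<zeta> (\<Sum>a\<in>UNIV. x $ a) (cone_volume (corner UNIV) ?u)" for \<zeta> and x :: "real ^ 'n"
    unfolding Pi_zeta_def corner_simplex_facet(1) by (simp add: corner_simplex_facet(2))
  ultimately show ?thesis by blast
qed

lemma V1_segment_corner_codim2:
  fixes k l :: "'n::finite"
  assumes "k \<noteq> l" "k \<notin> J" "l \<notin> J"
  shows "V1_segment (corner J) x = 0"
proof -
  have "J \<subseteq> UNIV - {k, l}" using assms by auto
  then have "card J \<le> card (UNIV - {k, l} :: 'n set)" by (intro card_mono) auto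
  also have "\<dots> < CARD('n) - 1" using assms(1) card_mono[of UNIV "{k, l}"] by (simp add: card_Diff_subset)
  finally have "facet_normals (corner J) = {}" by (intro facet_normals_empty) (simp add: aff_dim_corner)
  then show ?thesis by (simp add: V1_segment_def)
qed

text \<open>The simplex is its own face in direction e_k, with positive volume, and no other summand
  is negative. Positivity permits dividing by this constant later.\<close>

lemma V1_segment_corner_codim1_pos: "0 < V1_segment (corner (- {k})) (axis k (1::real))"
proof -
  let ?P = "corner (- {k})" and ?e = "axis k (1::real)"
  note P = polytopes_oD[OF corner_polytopes_o[of "- {k}"]]
  have ye: "y \<bullet> ?e = 0" if "y \<in> ?P" for y using that by (simp add: corner_def inner_axis)
  have "support_fun ?P ?e = ?e \<bullet> 0"
    by (rule support_fun_eqI[OF P(2)]) (simp add: ye inner_commute[of ?e])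
  then have "face_in_direction ?P ?e = ?P" by (auto simp: face_in_direction_def ye)
  moreover have "card (- {k}) = CARD('a) - 1" by (simp add: Compl_eq_Diff_UNIV card_Diff_singleton)
  ultimately have e: "?e \<in> facet_normals ?P" by (simp add: facet_normals_def aff_dim_corner of_nat_diff Suc_leI)
  have fin: "finite (facet_normals ?P)" by (rule finite_facet_normals[OF P(1)])
  have nn: "0 \<le> \<bar>?e \<bullet> u\<bar> * facet_volume ?P u" if "u \<in> facet_normals ?P" for u
    using that facet_volume_nonneg[OF P(3)] by (simp add: facet_normals_def)
  have "0 < \<bar>?e \<bullet> ?e\<bar> * facet_volume ?P ?e"
    using facet_volume_pos_iff[OF P(3,4,5), of ?e] e by (simp add: inner_axis)
  then have "0 < (\<Sum>u\<in>facet_normals ?P. \<bar>?e \<bullet> u\<bar> * facet_volume ?P u)"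
    using sum_pos2[OF fin e _ nn] by simp
  then show ?thesis by (simp add: V1_segment_def)
qed

text \<open>The origin is a vertex, so it is relatively interior only to the point simplex. The term
  thus adjusts the value at {o} without affecting the other simplices.\<close>

lemma euler_term_corner: "euler_term (corner J) = (if J = {} then 1 else 0)"
proof (cases "J = {}")
  case True
  then have "corner J = {0}" by (simp add: corner_eq_hull)
  then show ?thesis using True by (simp add: euler_term_def V0_def)
next
  case False
  then obtain j where j: "j \<in> J" by auto
  note P = polytopes_oD[OF corner_polytopes_o[of J]]
  have "0 \<notin> rel_interior (corner J)"
  proof
    assume "0 \<in> rel_interior (corner J)"
    then obtain e where "e > 1" "(1 - e) *\<^sub>R axis j 1 \<in> corner J"
      using convex_rel_interior_iff[OF P(4,5), of 0] axis_in_corner[OF j] by auto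
    then have "0 \<le> ((1 - e) *\<^sub>R axis j 1 :: real ^ 'a) $ j" unfolding corner_def by blast
    then show False using \<open>e > 1\<close> by simp
  qed
  then show ?thesis using False by (simp add: euler_term_def V0_def)
qed

text \<open>\<open>B\<close> is extended to a basis, whose vectors become the columns of
  \<open>A\<close>.\<close>

lemma simplex_as_matrix_image:
  fixes B :: "(real ^ 'n) set"
  assumes B: "independent B" and card: "CARD('n) \<ge> 3"
  obtains A J where "det A \<noteq> 0" "J = UNIV \<Longrightarrow> 0 < det A" "convex hull (insert 0 B) = (*v) A ` corner J"
proof -
  obtain C where C: "B \<subseteq> C" "independent C" and sC: "UNIV \<subseteq> span C"
    by (rule maximal_independent_subset_extend[OF subset_UNIV B])
  have C3: "span C = UNIV" using sC by (rule top_le)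
  have finC: "finite C" using C(2) by (rule independent_imp_finite)
  have "card C = CARD('n)"
  proof -
    have "card C = dim (span C)" by (simp only: dim_eq_card_independent[OF C(2)] dim_span)
    then show ?thesis unfolding C3 by simp
  qed
  then obtain f where f: "bij_betw f (UNIV :: 'n set) C"
    using finite_same_card_bij[of "UNIV :: 'n set" C] finC by auto
  define A :: "real ^ 'n ^ 'n" where "A = (\<chi> i j. f j $ i)"
  define J where "J = f -` B"
  have Af: "A *v axis j 1 = f j" for j
    unfolding matrix_vector_mult_basis by (simp add: A_def column_def)
  have "C \<subseteq> range ((*v) A)"
  proof
    fix c assume "c \<in> C"
    then obtain j where "c = f j" using f by (auto simp: bij_betw_def)
    then have "c = A *v axis j 1" by (simp only: Af)
    then show "c \<in> range ((*v) A)" by (rule range_eqI)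
  qed
  then have "span C \<subseteq> range ((*v) A)"
    by (intro span_minimal linear_subspace_image subspace_UNIV matrix_vector_mul_linear)
  then have "surj ((*v) A)" using C3 by auto
  then have "inj ((*v) A)" by (intro linear_surjective_imp_injective) auto
  then have dA: "det A \<noteq> 0" using det_nz_iff_inj[of "(*v) A"] by simp
  have "f ` J = B" using f C(1) by (auto simp: J_def bij_betw_def)
  then have "B = (*v) A ` (\<lambda>j. axis j 1) ` J" by (simp add: image_image Af)
  then have "insert 0 B = (*v) A ` insert 0 ((\<lambda>j. axis j 1) ` J)" by simp
  then have hull: "convex hull (insert 0 B) = (*v) A ` corner J"
    unfolding corner_eq_hull by (simp only: convex_hull_linear_image[OF matrix_vector_mul_linear])
  show ?thesis
  proof (cases "0 < det A")
    case True
    then show ?thesis using that[of A J] dA hull by simp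
  next
    case False
    fix k :: 'n
    obtain i j :: 'n where ij: "i \<noteq> j" using exists_two_others[OF card, of k] by blast
    \<comment> \<open>Exchanging two columns makes the determinant positive and leaves the image of
      the full coordinate simplex unchanged.\<close>
    let ?W = "swap_matrix i j"
    have "0 < det (A ** ?W)" using False dA ij by (simp add: det_mul det_swap_matrix)
    moreover have "(*v) (A ** ?W) ` corner UNIV = (*v) A ` corner UNIV"
    proof -
      have "(*v) (A ** ?W) ` corner UNIV = (*v) A ` (*v) ?W ` corner UNIV"
        unfolding image_image matrix_vector_mul_assoc ..
      then show ?thesis by (simp only: swap_matrix_corner_UNIV)
    qed
    ultimately show ?thesis
      using that[of A J] that[of "A ** ?W" UNIV] dA hull by (cases "J = UNIV") auto
  qed
qed

section \<open>The representation\<close>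

lemma sl_valuation_V1_segment: "sl_valuation V1_segment"
proof
  fix P :: "(real ^ 'n) set"
  show "continuous_on (- {0}) (V1_segment P)"
    unfolding V1_segment_def by (intro continuous_intros)
qed (rule V1_segment_contravariant V1_segment_valuation)+

text \<open>The classification in codimension one is applied to \<open>V1_segment\<close> itself,
  which vanishes in codimension two, so the formula follows from invariance alone and no facet
  volume has to be computed.\<close>

lemma V1_segment_corner_codim1:
  assumes card: "CARD('n) \<ge> 3"
  shows "\<exists>c>0. \<forall>k y. y \<noteq> 0 \<longrightarrow> V1_segment (corner (- {k})) (y :: real ^ 'n) = c * \<bar>y $ k\<bar>"
proof -
  interpret V: sl_valuation "V1_segment :: (real ^ 'n) set \<Rightarrow> _" by (rule sl_valuation_V1_segment)
  have "\<exists>c. \<forall>k y. y \<noteq> 0 \<longrightarrow> V1_segment (corner (- {k})) (y :: real ^ 'n) = 0 + c * \<bar>y $ k\<bar>"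
    by (rule V.Z_codim1_abs[OF card]) (rule V1_segment_corner_codim2)
  then obtain c where "\<forall>k y. y \<noteq> 0 \<longrightarrow> V1_segment (corner (- {k})) (y :: real ^ 'n) = 0 + c * \<bar>y $ k\<bar>"
    by (rule exE)
  then have c: "V1_segment (corner (- {k})) y = c * \<bar>y $ k\<bar>" if "y \<noteq> 0" for k and y :: "real ^ 'n"
    using that by simp
  fix k :: 'n
  have "0 < c" using V1_segment_corner_codim1_pos[of k] c[of "axis k 1" k] by simp
  then show ?thesis using c by (intro exI[of _ c]) simp
qed

lemma valuation_oD:
  assumes "valuation_o Z" "P \<in> polytopes_o" "Q \<in> polytopes_o" "P \<union> Q \<in> polytopes_o" "P \<inter> Q \<in> polytopes_o" "x \<noteq> 0"
  shows "Z P x + Z Q x = Z (P \<union> Q) x + Z (P \<inter> Q) x"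
  using assms unfolding valuation_o_def by simp

text \<open>Serves as one direction of the equivalence and, with \<zeta> = 0, certifies the
  combination that is subtracted in the other.\<close>

lemma representation_is_valuation:
  fixes Z :: "(real ^ 'n) set \<Rightarrow> real ^ 'n \<Rightarrow> real"
  assumes \<zeta>: "\<And>t. cauchy_function (\<zeta> t)"
    and Z: "\<And>P x. P \<in> polytopes_o \<Longrightarrow> x \<noteq> 0 \<Longrightarrow>
      Z P x = Pi_zeta \<zeta> P x + c1 * V1_segment P x + c0 + c0' * euler_term P"
  shows "SL_contravariant Z \<and> valuation_o Z"
proof
  show "SL_contravariant Z"
  proof (rule SL_contravariantI)
    fix P :: "(real ^ 'n) set" and A :: "real ^ 'n ^ 'n" and x :: "real ^ 'n"
    assume P: "P \<in> polytopes_o" and d: "det A = 1" and x: "x \<noteq> 0"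
    have d0: "det A \<noteq> 0" using d by simp
    note p = polytopes_oD(3,5)[OF P]
    show "Z ((*v) A ` P) (A *v x) = Z P x"
      unfolding Z[OF P x] Z[OF matrix_image_polytopes_o[OF P] matrix_mult_nonzero[OF d0 x]]
        Pi_zeta_linear_image[OF d0 p] V1_segment_linear_image[OF d0 p] euler_term_matrix_image[OF d0]
      by (simp add: d)
  qed
  show "valuation_o Z"
    unfolding valuation_o_def
  proof (intro allI impI)
    fix P Q :: "(real ^ 'n) set" and x :: "real ^ 'n"
    assume PQ: "P \<in> polytopes_o" "Q \<in> polytopes_o" "P \<union> Q \<in> polytopes_o" "P \<inter> Q \<in> polytopes_o"
      and x: "x \<noteq> 0"
    have "Pi_zeta \<zeta> P x + Pi_zeta \<zeta> Q x = Pi_zeta \<zeta> (P \<union> Q) x + Pi_zeta \<zeta> (P \<inter> Q) x"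
      by (rule valuation_oD[OF Pi_zeta_valuation[OF \<zeta>] PQ x])
    moreover have "V1_segment P x + V1_segment Q x = V1_segment (P \<union> Q) x + V1_segment (P \<inter> Q) x"
      by (rule valuation_oD[OF V1_segment_valuation PQ x])
    then have "c1 * V1_segment P x + c1 * V1_segment Q x = c1 * V1_segment (P \<union> Q) x + c1 * V1_segment (P \<inter> Q) x"
      by (simp only: distrib_left[symmetric])
    moreover have "c0' * euler_term P + c0' * euler_term Q = c0' * euler_term (P \<union> Q) + c0' * euler_term (P \<inter> Q)"
      using euler_term_Un_Int[OF PQ] by (simp only: distrib_left[symmetric])
    ultimately show "Z P x + Z Q x = Z (P \<union> Q) x + Z (P \<inter> Q) x"
      unfolding Z[OF PQ(1) x] Z[OF PQ(2) x] Z[OF PQ(3) x] Z[OF PQ(4) x] by linarith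
  qed
qed

lemma cauchy_function_zero: "cauchy_function (\<lambda>_. 0)"
  by (simp add: cauchy_function_def)

lemma valuation_o_diff:
  fixes Y Z :: "(real ^ 'n) set \<Rightarrow> real ^ 'n \<Rightarrow> real"
  assumes "valuation_o Y" "valuation_o Z"
  shows "valuation_o (\<lambda>P x. Y P x - Z P x)"
  unfolding valuation_o_def
proof (intro allI impI)
  fix P Q :: "(real ^ 'n) set" and x :: "real ^ 'n"
  assume *: "P \<in> polytopes_o" "Q \<in> polytopes_o" "P \<union> Q \<in> polytopes_o" "P \<inter> Q \<in> polytopes_o" "x \<noteq> 0"
  have "Y P x + Y Q x = Y (P \<union> Q) x + Y (P \<inter> Q) x" "Z P x + Z Q x = Z (P \<union> Q) x + Z (P \<inter> Q) x"
    by (rule valuation_oD[OF assms(1) *]) (rule valuation_oD[OF assms(2) *])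
  then show "(Y P x - Z P x) + (Y Q x - Z Q x) = (Y (P \<union> Q) x - Z (P \<union> Q) x) + (Y (P \<inter> Q) x - Z (P \<inter> Q) x)"
    by linarith
qed

lemma SL_contravariant_diff:
  assumes "SL_contravariant Y" "SL_contravariant Z"
  shows "SL_contravariant (\<lambda>P x. Y P x - Z P x)"
  using assms unfolding SL_contravariant_def by simp

lemma (in sl_valuation) representation:
  assumes card: "CARD('n) \<ge> 3"
  shows "\<exists>c1 c0 c0' \<zeta>. (\<forall>t. cauchy_function (\<zeta> t)) \<and> (\<forall>s>0. continuous_on UNIV (\<lambda>t. \<zeta> t s)) \<and>
    (\<forall>P\<in>polytopes_o. \<forall>x. x \<noteq> 0 \<longrightarrow> Z P x = Pi_zeta \<zeta> P x + c1 * V1_segment P x + c0 + c0' * euler_term P)"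
proof -
  obtain k l :: 'n where "k \<noteq> l" using exists_two_others[OF card] by blast
  then obtain a0 where a0: "\<forall>y. y \<noteq> 0 \<longrightarrow> Z (corner {}) y = a0" using Z_codim2_const[of k l "{}"] by blast
  obtain A where "\<forall>J. J \<noteq> {} \<longrightarrow> (\<exists>k l. k \<noteq> l \<and> k \<notin> J \<and> l \<notin> J) \<longrightarrow> (\<forall>y. y \<noteq> 0 \<longrightarrow> Z (corner J) y = A)"
    using Z_lower_const[OF card] by (rule exE)
  then have A: "Z (corner J) y = A" if "J \<noteq> {}" "k \<noteq> l" "k \<notin> J" "l \<notin> J" "y \<noteq> 0" for J k l y
    using that by metis
  obtain c where c: "\<forall>k y. y \<noteq> 0 \<longrightarrow> Z (corner (- {k})) y = A + c * \<bar>y $ k\<bar>"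
    using Z_codim1_abs[OF card A] by (rule exE)
  obtain cV where cV: "0 < cV" "\<forall>k y. y \<noteq> 0 \<longrightarrow> V1_segment (corner (- {k})) (y :: real ^ 'n) = cV * \<bar>y $ k\<bar>"
    using V1_segment_corner_codim1[OF card] by (elim exE conjE)
  \<comment> \<open>The coefficients are dictated by the simplices: \<open>A\<close> by dimensions 1
    to n - 2, \<open>c / cV\<close> by dimension n - 1, and \<open>a0 - A\<close> by the point
    {o}.\<close>
  define R where "R P x = (c / cV) * V1_segment P x + A + (a0 - A) * euler_term P" for P :: "(real ^ 'n) set" and x :: "real ^ 'n"
  have R: "SL_contravariant R \<and> valuation_o R"
    by (rule representation_is_valuation[of "\<lambda>_ _. 0" R "c / cV" A "a0 - A"])
       (simp_all add: cauchy_function_zero R_def Pi_zeta_def)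
  define Z' where "Z' P x = Z P x - R P x" for P x
  have contZ': "continuous_on (- {0}) (Z' P)" if "P \<in> polytopes_o" for P
    unfolding Z'_def R_def V1_segment_def by (intro continuous_intros cont[OF that])
  interpret Z': simple_sl_valuation Z'
  proof
    show "SL_contravariant Z'" unfolding Z'_def using contra R by (intro SL_contravariant_diff) auto
    show "valuation_o Z'" unfolding Z'_def using val R by (intro valuation_o_diff) auto
    show "CARD('n) \<ge> 3" by (rule card)
    fix J :: "'n set" and y :: "real ^ 'n" assume J: "J \<noteq> UNIV" and y: "y \<noteq> 0"
    obtain k where k: "k \<notin> J" using J by auto
    show "Z' (corner J) y = 0"
    proof (cases "\<exists>l. l \<noteq> k \<and> l \<notin> J")
      case True
      then obtain l where l: "k \<noteq> l" "l \<notin> J" by metis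
      have V: "V1_segment (corner J) y = 0" by (rule V1_segment_corner_codim2[OF l(1) k l(2)])
      show ?thesis
      proof (cases "J = {}")
        case True
        then show ?thesis using a0 y V by (simp add: Z'_def R_def euler_term_corner)
      next
        case False
        then have "Z (corner J) y = A" by (rule A[OF _ l(1) k l(2) y])
        then show ?thesis using False V by (simp add: Z'_def R_def euler_term_corner)
      qed
    next
      case False
      then have Jk: "J = - {k}" using k by auto
      obtain i where "i \<noteq> k" using exists_two_others[OF card, of k] by blast
      then have "J \<noteq> {}" unfolding Jk by auto
      then show ?thesis
        using c y cV unfolding Jk by (simp add: Z'_def R_def euler_term_corner)
    qed
  qed (rule contZ')
  obtain \<xi> where \<xi>: "\<forall>t. cauchy_function (\<xi> t)" "\<forall>s>0. continuous_on UNIV (\<lambda>t. \<xi> t s)"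
    and full: "\<forall>B y. 0 < det B \<longrightarrow> y \<noteq> 0 \<longrightarrow> Z' ((*v) B ` corner UNIV) (B *v y) = \<xi> (\<Sum>a\<in>UNIV. y $ a) (det B)"
    using Z'.full_dim_representation by (elim exE conjE)
  obtain \<kappa> where \<kappa>: "0 < \<kappa>" "\<And>\<zeta> x. Pi_zeta \<zeta> (corner UNIV) (x :: real ^ 'n) = \<zeta> (\<Sum>a\<in>UNIV. x $ a) \<kappa>"
    using Pi_zeta_corner by blast
  \<comment> \<open>\<xi> is indexed by the determinant of a simplex, \<zeta> by its cone volume,
    which is \<kappa> times the determinant.\<close>
  define \<zeta> where "\<zeta> t s = \<xi> t (s / \<kappa>)" for t s
  have \<zeta>: "cauchy_function (\<zeta> t)" for t
    unfolding cauchy_function_def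
  proof (intro allI impI)
    fix r s :: real assume "0 < r" "0 < s"
    then have "0 < r / \<kappa>" "0 < s / \<kappa>" using \<kappa> by auto
    then show "\<zeta> t (r + s) = \<zeta> t r + \<zeta> t s"
      using \<xi>(1) unfolding \<zeta>_def cauchy_function_def add_divide_distrib by blast
  qed
  have \<zeta>c: "continuous_on UNIV (\<lambda>t. \<zeta> t s)" if "0 < s" for s
    unfolding \<zeta>_def using \<xi>(2) that \<kappa>(1) by simp
  \<comment> \<open>Both functionals are valuations, so their difference vanishes as soon as it does
    on simplices with a vertex at the origin.\<close>
  have main: "Z' P x - Pi_zeta \<zeta> P x = 0" if P: "P \<in> polytopes_o" and x: "x \<noteq> 0" for P x
  proof (rule valuation_zero_from_simplices[where Y="\<lambda>P. Z' P x - Pi_zeta \<zeta> P x", OF _ _ P])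
    show "Z' P x - Pi_zeta \<zeta> P x + (Z' Q x - Pi_zeta \<zeta> Q x)
        = Z' (P \<union> Q) x - Pi_zeta \<zeta> (P \<union> Q) x + (Z' (P \<inter> Q) x - Pi_zeta \<zeta> (P \<inter> Q) x)"
      if "P \<in> polytopes_o" "Q \<in> polytopes_o" "P \<union> Q \<in> polytopes_o" "P \<inter> Q \<in> polytopes_o" for P Q
      by (rule valuation_oD[OF valuation_o_diff[OF Z'.val Pi_zeta_valuation[OF \<zeta>]] that x])
    fix B :: "(real ^ 'n) set" assume "independent B"
    then obtain M J where M: "det M \<noteq> 0" "J = UNIV \<Longrightarrow> 0 < det M" "convex hull (insert 0 B) = (*v) M ` corner J"
      using simplex_as_matrix_image[OF _ card] by blast
    define y where "y = matrix_inv M *v x"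
    have xy: "x = M *v y" by (simp add: y_def matrix_inv_det[OF M(1)])
    then have y: "y \<noteq> 0" using x by auto
    note corner = polytopes_oD(3,5)[OF corner_polytopes_o[of J]]
    show "Z' (convex hull (insert 0 B)) x - Pi_zeta \<zeta> (convex hull (insert 0 B)) x = 0"
    proof (cases "J = UNIV")
      case True
      then have d: "0 < det M" by (rule M(2))
      have "Pi_zeta \<zeta> ((*v) M ` corner J) (M *v y) = \<xi> (\<Sum>a\<in>UNIV. y $ a) (det M)"
        unfolding Pi_zeta_linear_image[OF M(1) corner] unfolding True \<kappa>(2) using d \<kappa>(1) by (simp add: \<zeta>_def)
      moreover have "Z' ((*v) M ` corner J) (M *v y) = \<xi> (\<Sum>a\<in>UNIV. y $ a) (det M)"
        using full d y unfolding True by blast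
      ultimately show ?thesis unfolding M(3) xy by simp
    next
      case False
      have "Pi_zeta \<zeta> ((*v) M ` corner J) (M *v y) = 0"
        unfolding Pi_zeta_linear_image[OF M(1) corner] by (rule Pi_zeta_corner_lower[OF False])
      then show ?thesis unfolding M(3) using Z'.low_image[OF False M(1) x] by (simp add: xy)
    qed
  qed
  show ?thesis
  proof (intro exI conjI ballI allI impI)
    fix P :: "(real ^ 'n) set" and x :: "real ^ 'n" assume *: "P \<in> polytopes_o" "x \<noteq> 0"
    show "Z P x = Pi_zeta \<zeta> P x + (c / cV) * V1_segment P x + A + (a0 - A) * euler_term P"
      using main[OF *] by (simp add: Z'_def R_def)
  qed (use \<zeta> \<zeta>c in auto)
qed

theorem theorem1:
  fixes Z :: "(real ^ 'n) set \<Rightarrow> real ^ 'n \<Rightarrow> real"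
  assumes "CARD('n) \<ge> 3"
    and "\<And>P. P \<in> polytopes_o \<Longrightarrow> continuous_on (- {0}) (Z P)"
  shows "(SL_contravariant Z \<and> valuation_o Z) \<longleftrightarrow>
    (\<exists>(c\<^sub>n\<^sub>1::real) (c\<^sub>0::real) (c\<^sub>0'::real) (\<zeta> :: real \<Rightarrow> real \<Rightarrow> real).
        (\<forall>t. cauchy_function (\<zeta> t)) \<and>
        (\<forall>s > 0. continuous_on UNIV (\<lambda>t. \<zeta> t s)) \<and>
        (\<forall>P \<in> polytopes_o. \<forall>x. x \<noteq> 0 \<longrightarrow>
           Z P x = Pi_zeta \<zeta> P x + c\<^sub>n\<^sub>1 * V1_segment P x + c\<^sub>0 * V0 P
             + c\<^sub>0' * (-1) ^ nat (aff_dim P) * V0 ({0} \<inter> rel_interior P)))"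
proof -
  have form: "Pi_zeta \<zeta> P x + c1 * V1_segment P x + c0 * V0 P + c0' * (-1) ^ nat (aff_dim P) * V0 ({0} \<inter> rel_interior P)
      = Pi_zeta \<zeta> P x + c1 * V1_segment P x + c0 + c0' * euler_term P"
    if "P \<in> polytopes_o" for \<zeta> c1 c0 c0' P and x :: "real ^ 'n"
    using polytopes_oD(5)[OF that] by (simp add: V0_def euler_term_def)
  show ?thesis
  proof (rule iffI, goal_cases)
    case 1
    then interpret sl_valuation Z using assms(2) by unfold_locales auto
    obtain c1 c0 c0' \<zeta> where "\<forall>t. cauchy_function (\<zeta> t)" "\<forall>s>0. continuous_on UNIV (\<lambda>t. \<zeta> t s)"
      "\<forall>P\<in>polytopes_o. \<forall>x. x \<noteq> 0 \<longrightarrow> Z P x = Pi_zeta \<zeta> P x + c1 * V1_segment P x + c0 + c0' * euler_term P"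
      using representation[OF assms(1)] by (elim exE conjE)
    then show ?case
      by (intro exI[of _ c1] exI[of _ c0] exI[of _ c0'] exI[of _ \<zeta>]) (simp add: form)
  next
    case 2
    then obtain c1 c0 c0' \<zeta> where "\<forall>t. cauchy_function (\<zeta> t)"
      "\<forall>P\<in>polytopes_o. \<forall>x. x \<noteq> 0 \<longrightarrow> Z P x = Pi_zeta \<zeta> P x + c1 * V1_segment P x + c0 * V0 P
         + c0' * (-1) ^ nat (aff_dim P) * V0 ({0} \<inter> rel_interior P)"
      by (elim exE conjE)
    then show ?case
      by (intro representation_is_valuation[of \<zeta> Z c1 c0 c0']) (simp_all add: form)
  qed
qed

end
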